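(* Let $Ax\le b$ (with $A$, $b$ integral) be a description of a pointed polyhedron $P\subseteq\mathbb{R}^2$ with $m$ facets, and let $c\in\mathbb{Z}^2\setminus\{0\}$ be such that $\max\{cx: x\in P\}$ is finite. Then the clockwise cutting plane algorithm (defined in the context) solves the integer program $\max\{cx: x\in P\cap\mathbb{Z}^2\}$ in $O(m(\log\|A\|_\infty)^2)$ iterations.
   Context: All polyhedra, cones, half-planes and lines are rational. $\|\cdot\|_\infty$ is the maximum absolute value of the entries of a vector or matrix. The number of iterations is the number of cutting planes computed. For a half-plane $H$, $H^=$ denotes its boundary line. $\operatorname{aff}(\cdot)$ denotes the affine hull. "Facet" and "facet-defining inequality (half-plane)" are used interchangeably. Split and Chvátal cuts. A split disjunction is $(\pi,\pi_0)$ with $\pi\in\mathbb{Z}^2\setminus\{0\}$, $\pi_0\in\mathbb{Z}$, also identified with the pair of half-planes $\{\pi x\le\pi_0\}$, $\{\pi x\ge\pi_0+1\}$. A split cut for $Q$ is an inequality valid for $\operatorname{conv}((Q\cap\{\pi x\le\pi_0\})\cup(Q\cap\{\pi x\ge\pi_0+1\}))$ for some split disjunction. If $Q\cap\{\pi x\ge \pi_0+1\}=\emptyset$, then $\pi x\le\pi_0$ is a Chvátal inequality (cut) for $Q$ (symmetrically for the other half-plane). For a half-plane $H=\{\pi x\le z\}$ with $\pi\in\mathbb{Z}^2$ primitive, its Chvátal strengthening is $\{\pi x\le\lfloor z\rfloor\}$; $H$ is Chvátal strengthened if $z\in\mathbb{Z}$. Translated cone. $(H_1,H_2):=H_1\cap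 H_2$ for two half-planes with non-parallel boundaries; its apex is the unique vertex. Tilt. Let $C=(H_1,H_2)$ be a translated cone with apex not in $\mathbb{Z}^2$ and $H_1$ Chvátal strengthened. Let $\widehat H\subset H_1$ be the line parallel to, distinct from, and closest to $H_1^=$ with $\widehat H\cap\mathbb{Z}^2\neq\emptyset$. Let $p\in H_1^=\cap C\cap\mathbb{Z}^2$ and $q\in(H_1^=\setminus C)\cap\mathbb{Z}^2$ be the unique points such that the open segment $(p,q)$ contains no integer point; let $x\in\widehat H\cap C\cap\mathbb{Z}^2$ and $y\in(\widehat H\setminus C)\cap\mathbb{Z}^2$ be the unique points such that the open segment $(x,y)$ contains no integer point. Let $W_0,W_1$ be the disjoint half-planes such that $W_0^=$ is the line through $p,x$ and $W_1^=$ is the line through $q,y$; they form a split disjunction $(\pi,\pi_0)$. The tilt $T$ of the facet of $C$ induced by $H_1$, with pivot $p$, with respect to $C$, is: if $C\cap W_1=\emptyset$, the Chvátal cut $T=W_0$; otherwise, letting $x'\in W_1^=\cap C\cap\mathbb{Z}^2$ and $y'\in(W_1^=\setminus C)\cap\mathbb{Z}^2$ be the unique points such that the open segment $(x',y')$ contains no integer point, $T$ is the split cut for $C$ with respect to $(\pi,\pi_0)$ whose boundary $T^=$ contains $p$ and $y'$. Clockwise cutting plane algorithm. Input: a pointed polyhedron $P\subseteq\mathbb{R}^2$ and $c\in\mathbb{Z}^2\setminus\{0\}$ with $\max\{cx:x\in P\}$ finite. Output: an optimal solution of $\max\{cx:x\in P\cap\mathbb{Z}^2\}$ or a certificate of infeasibility.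 (1) Set $Q:=P$. (2) If $\dim(Q)\le1$, apply at most one Chvátal cut to output INFEASIBLE or an optimal solution. (If $\dim(Q)\le0$ the problem is trivial; if $\dim(Q)=1$ and $\operatorname{aff}(Q)\cap\mathbb{Z}^2=\emptyset$, the cut certifying infeasibility has boundary parallel to $Q$; if $\dim(Q)=1$ and $\operatorname{aff}(Q)\cap\mathbb{Z}^2\ne\emptyset$, one applies one Chvátal cut whose boundary is orthogonal to $Q$.) (3) Otherwise solve $\max\{cx:x\in Q\}$ and let $v^*$ be the optimal vertex of $Q$; if the set of optimal solutions is a bounded facet of $Q$ (so that there are two optimal vertices), $v^*$ is the first vertex met when traversing that facet clockwise. If $v^*\in\mathbb{Z}^2$, stop and output $v^*$. (4) If $v^*\notin\mathbb{Z}^2$, number the facets of $Q$ as $F_1,\dots,F_{m^Q}$ so that their outer normals are in clockwise order, $v^*\in F_{m^Q}\cap F_1$, and $c$ is in the cone generated by the normals of $F_{m^Q}$ and $F_1$ (if the optimal set is a bounded facet, it is $F_1$; if it is an unbounded facet, it is $F_1$ when its unique vertex is the first point met when traversing it clockwise, and $F_{m^Q}$ when it is the last). If $F_{m^Q}$ is not Chvátal strengthened, let $T$ be its Chvátal strengthening; otherwise let $T$ be the tilt of $F_{m^Q}$ with respect to the translated cone $(F_{m^Q},F_1)$. Set $Q:=Q\cap T$ and go to (2).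
   Formalization: In step (2), for dim(Q)=1 with integer points in aff(Q), "orthogonal to Q" is read up to unimodular change of coordinates, since a Euclidean-orthogonal Chvátal cut can fail (segment (0.3,0.6)-(0.9,1.8)); log‖A‖ is read as log max(2,‖A‖), as the bound fails for ‖A‖=1. *)

theory Defs
  imports "HOL-Analysis.Analysis"
begin

section \<open>Integer points, half-planes and polyhedra\<close>

definition int_pts :: "(real^2) set" where
  "int_pts = {x. \<forall>i. x $ i \<in> \<int>}"

definition rvec :: "int^2 \<Rightarrow> real^2" where
  "rvec v = (\<chi> i. real_of_int (v $ i))"

definition primitive :: "int^2 \<Rightarrow> bool" where
  "primitive a \<longleftrightarrow> gcd (a $ 1) (a $ 2) = 1"

definition halfplane :: "int^2 \<Rightarrow> real \<Rightarrow> (real^2) set" where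
  "halfplane a z = {x. rvec a \<bullet> x \<le> z}"

text \<open>The boundary line of a half-plane \<open>H\<close> is written \<^term>\<open>frontier H\<close>.\<close>

definition rat_halfplane :: "(real^2) set \<Rightarrow> bool" where
  "rat_halfplane H \<longleftrightarrow> (\<exists>a z. a \<noteq> 0 \<and> z \<in> \<rat> \<and> H = halfplane a z)"

definition polyhedron_of :: "nat \<Rightarrow> (nat \<Rightarrow> int^2) \<Rightarrow> (nat \<Rightarrow> int) \<Rightarrow> (real^2) set" where
  "polyhedron_of n A b = {x. \<forall>i<n. rvec (A i) \<bullet> x \<le> real_of_int (b i)}"

text \<open>Only meaningful for \<open>n > 0\<close>; a system without rows describes the whole plane, which is
  not pointed.\<close>

definition max_abs_entry :: "nat \<Rightarrow> (nat \<Rightarrow> int^2) \<Rightarrow> int" where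
  "max_abs_entry n A = Max {\<bar>A i $ j\<bar> | i j. i < n}"

definition pointed :: "(real^2) set \<Rightarrow> bool" where
  "pointed P \<longleftrightarrow> \<not> (\<exists>x d. d \<noteq> 0 \<and> (\<forall>t. x + t *\<^sub>R d \<in> P))"

section \<open>Split and Chvatal cuts\<close>

definition split_disjunction :: "(real^2) set \<Rightarrow> (real^2) set \<Rightarrow> bool" where
  "split_disjunction W0 W1 \<longleftrightarrow>
     (\<exists>a (k::int). a \<noteq> 0 \<and> W0 = halfplane a (of_int k) \<and> W1 = {x. rvec a \<bullet> x \<ge> of_int (k + 1)})"

definition split_cut :: "(real^2) set \<Rightarrow> (real^2) set \<Rightarrow> (real^2) set \<Rightarrow> (real^2) set \<Rightarrow> bool" where
  "split_cut Q W0 W1 T \<longleftrightarrow> split_disjunction W0 W1 \<and> rat_halfplane T \<and>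
     convex hull ((Q \<inter> W0) \<union> (Q \<inter> W1)) \<subseteq> T"

text \<open>The cut is \<^term>\<open>halfplane a (of_int k)\<close>. Cuts of the form \<open>a x \<ge> k + 1\<close> are obtained by
  negating \<open>a\<close>.\<close>

definition chvatal_cut :: "(real^2) set \<Rightarrow> int^2 \<Rightarrow> int \<Rightarrow> bool" where
  "chvatal_cut Q a k \<longleftrightarrow> a \<noteq> 0 \<and> Q \<inter> {x. rvec a \<bullet> x \<ge> of_int (k + 1)} = {}"

definition chvatal_strengthened :: "(real^2) set \<Rightarrow> bool" where
  "chvatal_strengthened H \<longleftrightarrow> (\<exists>a z. primitive a \<and> z \<in> \<int> \<and> H = halfplane a z)"

definition is_chvatal_strengthening :: "(real^2) set \<Rightarrow> (real^2) set \<Rightarrow> bool" where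
  "is_chvatal_strengthening H T \<longleftrightarrow>
     (\<exists>a z. primitive a \<and> H = halfplane a z \<and> T = halfplane a (of_int \<lfloor>z\<rfloor>))"

section \<open>Tilting a facet of a translated cone\<close>

definition hat_line :: "(real^2) set \<Rightarrow> (real^2) set \<Rightarrow> bool" where
  "hat_line H L \<longleftrightarrow> (\<exists>a z t. a \<noteq> 0 \<and> H = halfplane a z \<and> L = {x. rvec a \<bullet> x = t} \<and>
     t < z \<and> L \<inter> int_pts \<noteq> {} \<and>
     (\<forall>s<z. {x. rvec a \<bullet> x = s} \<inter> int_pts \<noteq> {} \<longrightarrow> s \<le> t))"

definition lattice_gap :: "(real^2) set \<Rightarrow> (real^2) set \<Rightarrow> real^2 \<Rightarrow> real^2 \<Rightarrow> bool" where
  "lattice_gap L C p q \<longleftrightarrow> p \<in> L \<inter> C \<inter> int_pts \<and> q \<in> (L - C) \<inter> int_pts \<and>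
     open_segment p q \<inter> int_pts = {}"

text \<open>\<open>T\<close> is the tilt of the facet induced by \<open>H1\<close> with respect to the translated cone
  \<open>H1 \<inter> H2\<close>. It is meant for \<open>H1\<close> Chvatal strengthened, \<open>H1\<close> and \<open>H2\<close> with non-parallel
  boundaries and apex outside \<^term>\<open>int_pts\<close>; the algorithm below uses it only then. The points
  and half-planes quantified here are then unique.\<close>

definition is_tilt :: "(real^2) set \<Rightarrow> (real^2) set \<Rightarrow> (real^2) set \<Rightarrow> bool" where
  "is_tilt H1 H2 T \<longleftrightarrow> (let C = H1 \<inter> H2 in
     \<exists>L p q x y W0 W1.
       hat_line H1 L \<and> lattice_gap (frontier H1) C p q \<and> lattice_gap L C x y \<and>
       split_disjunction W0 W1 \<and>
       frontier W0 = affine hull {p, x} \<and> frontier W1 = affine hull {q, y} \<and>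
       (if C \<inter> W1 = {} then T = W0
        else \<exists>x' y'. lattice_gap (frontier W1) C x' y' \<and> split_cut C W0 W1 T \<and>
               p \<in> frontier T \<and> y' \<in> frontier T))"

section \<open>The clockwise cutting plane algorithm\<close>

text \<open>Traversed clockwise, a facet with outer normal \<open>c\<close> runs in direction \<open>(c\<^sub>2, -c\<^sub>1)\<close>. The last
  conjunct therefore selects the first of two optimal vertices; it is void if there is only one.\<close>

definition optimal_vertex :: "int^2 \<Rightarrow> (real^2) set \<Rightarrow> real^2 \<Rightarrow> bool" where
  "optimal_vertex c Q v \<longleftrightarrow> v extreme_point_of Q \<and> (\<forall>x\<in>Q. rvec c \<bullet> x \<le> rvec c \<bullet> v) \<and>
     (\<forall>w. w extreme_point_of Q \<and> rvec c \<bullet> w = rvec c \<bullet> v \<longrightarrow>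
        rvec (vector [c $ 2, - c $ 1]) \<bullet> v \<le> rvec (vector [c $ 2, - c $ 1]) \<bullet> w)"

definition facet_halfplane :: "(real^2) set \<Rightarrow> (real^2) set \<Rightarrow> bool" where
  "facet_halfplane Q H \<longleftrightarrow> rat_halfplane H \<and> Q \<subseteq> H \<and> (Q \<inter> frontier H) facet_of Q"

text \<open>\<open>Hm\<close> and \<open>H1\<close> are the last and the first facet in the clockwise numbering that starts at
  the vertex \<open>v\<close>. Only these two are ever used. At a vertex of a two-dimensional polyhedron they
  are the two facets containing \<open>v\<close>, and the outer normal \<open>a1\<close> of \<open>H1\<close> is reached from the outer
  normal \<open>am\<close> of \<open>Hm\<close> by a clockwise turn of less than a straight angle, that is,
  \<open>det (am, a1) < 0\<close>.\<close>

definition corner_facets ::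
    "int^2 \<Rightarrow> (real^2) set \<Rightarrow> real^2 \<Rightarrow> (real^2) set \<Rightarrow> (real^2) set \<Rightarrow> bool" where
  "corner_facets c Q v Hm H1 \<longleftrightarrow>
     facet_halfplane Q Hm \<and> facet_halfplane Q H1 \<and> v \<in> frontier Hm \<and> v \<in> frontier H1 \<and>
     (\<exists>am zm a1 z1. Hm = halfplane am zm \<and> H1 = halfplane a1 z1 \<and>
        am $ 1 * a1 $ 2 - am $ 2 * a1 $ 1 < 0 \<and>
        rvec c \<in> convex_cone hull {rvec am, rvec a1})"

datatype outcome = Infeasible | Optimal "real^2"

text \<open>The natural number in a state counts the cutting planes computed so far.\<close>

datatype state = Running "(real^2) set" nat | Halted outcome nat

primrec num_cuts :: "state \<Rightarrow> nat" where
  "num_cuts (Running Q k) = k"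
| "num_cuts (Halted r k) = k"

text \<open>In the rules for a one-dimensional \<open>Q\<close> the answer has to be visible from \<open>Q\<close> and the single
  Chvatal cut \<open>T\<close>. In the second of them, orthogonality of the boundary of \<open>T\<close> to \<open>Q\<close> is
  understood up to a unimodular change of coordinates: the normal \<open>a\<close> satisfies \<open>a u = \<plusminus>1\<close> for the
  primitive direction \<open>u\<close> of \<open>Q\<close>, so that every integer point of the line spanned by \<open>Q\<close> lies on
  its own lattice line parallel to the boundary of \<open>T\<close>. Euclidean orthogonality would not do: the
  segment from \<open>(3/10, 6/10)\<close> to \<open>(9/10, 18/10)\<close> contains no integer point, but no single Chvatal
  cut with a boundary perpendicular to it makes it empty.\<close>

inductive clockwise_step :: "int^2 \<Rightarrow> state \<Rightarrow> state \<Rightarrow> bool" for c where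
  empty: "clockwise_step c (Running {} k) (Halted Infeasible k)"
| point_integral: "q \<in> int_pts \<Longrightarrow> clockwise_step c (Running {q} k) (Halted (Optimal q) k)"
| point_fractional: "q \<notin> int_pts \<Longrightarrow> clockwise_step c (Running {q} k) (Halted Infeasible k)"
| line_lattice_free:
    "\<lbrakk>aff_dim Q = 1; affine hull Q \<inter> int_pts = {};
      chvatal_cut Q a a0; \<forall>x\<in>Q. \<forall>y\<in>Q. rvec a \<bullet> x = rvec a \<bullet> y;
      Q \<inter> halfplane a (of_int a0) = {}\<rbrakk>
     \<Longrightarrow> clockwise_step c (Running Q k) (Halted Infeasible (k + 1))"
| line_lattice:
    "\<lbrakk>aff_dim Q = 1; affine hull Q \<inter> int_pts \<noteq> {};
      primitive u; \<forall>x\<in>Q. \<forall>y\<in>Q. \<exists>t. x - y = t *\<^sub>R rvec u;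
      chvatal_cut Q a a0; \<bar>a $ 1 * u $ 1 + a $ 2 * u $ 2\<bar> = 1;
      T = halfplane a (of_int a0);
      r = Infeasible \<and> Q \<inter> T = {} \<or>
      (\<exists>v. r = Optimal v \<and> v \<in> Q \<inter> T \<inter> int_pts \<and> (\<forall>y\<in>Q \<inter> T. rvec c \<bullet> y \<le> rvec c \<bullet> v))\<rbrakk>
     \<Longrightarrow> clockwise_step c (Running Q k) (Halted r (k + 1))"
| integral_vertex:
    "\<lbrakk>aff_dim Q = 2; optimal_vertex c Q v; v \<in> int_pts\<rbrakk>
     \<Longrightarrow> clockwise_step c (Running Q k) (Halted (Optimal v) k)"
| strengthen:
    "\<lbrakk>aff_dim Q = 2; optimal_vertex c Q v; v \<notin> int_pts; corner_facets c Q v Hm H1;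
      \<not> chvatal_strengthened Hm; is_chvatal_strengthening Hm T\<rbrakk>
     \<Longrightarrow> clockwise_step c (Running Q k) (Running (Q \<inter> T) (k + 1))"
| tilt:
    "\<lbrakk>aff_dim Q = 2; optimal_vertex c Q v; v \<notin> int_pts; corner_facets c Q v Hm H1;
      chvatal_strengthened Hm; is_tilt Hm H1 T\<rbrakk>
     \<Longrightarrow> clockwise_step c (Running Q k) (Running (Q \<inter> T) (k + 1))"

definition correct_outcome :: "int^2 \<Rightarrow> (real^2) set \<Rightarrow> outcome \<Rightarrow> bool" where
  "correct_outcome c P r \<longleftrightarrow> (case r of
       Infeasible \<Rightarrow> P \<inter> int_pts = {}
     | Optimal v \<Rightarrow> v \<in> P \<inter> int_pts \<and> (\<forall>y \<in> P \<inter> int_pts. rvec c \<bullet> y \<le> rvec c \<bullet> v))"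

text \<open>Every execution started on \<open>P\<close> computes at most \<open>N\<close> cutting planes, never gets stuck, and
  halts only with a correct answer. Since a step between two running states increments the number
  of cuts, the bound on that number also forces every execution to terminate.\<close>

definition solves_ip_within :: "int^2 \<Rightarrow> (real^2) set \<Rightarrow> real \<Rightarrow> bool" where
  "solves_ip_within c P N \<longleftrightarrow>
     (\<forall>s. (clockwise_step c)\<^sup>*\<^sup>* (Running P 0) s \<longrightarrow>
        real (num_cuts s) \<le> N \<and>
        (case s of
           Running Q k \<Rightarrow> (\<exists>s'. clockwise_step c s s')
         | Halted r k \<Rightarrow> correct_outcome c P r))"

end

theory Submission
  imports Defs
begin

text \<open>Let \<open>n1\<close>, \<open>n2\<close> be the primitive outer normals at the current vertex. The normal of the tilt lies
  in the triangle with vertices 0, \<open>n1\<close>, \<open>n2\<close>, so that all normals keep entries bounded by the largest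
  entry of \<open>A\<close>. While the second facet stays the same, the determinant \<open>D\<close> of the two normals, the slack
  \<open>\<sigma>\<close> of the pivot in the second half-plane and one more integer \<open>a\<close> evolve as in a Euclidean algorithm:
  split cuts halve \<open>a\<close>, and a Chvatal cut together with the cut after it shrinks \<open>D\<close> by a constant
  factor. Hence such a phase lasts only quadratically many steps in \<open>log D\<close>. If a new phase begins, a facet
  to the right of the optimal vertex is lost or a facet to its left turns into one to its right, which
  happens at most twice per facet. An arbitrarily small rotation of the objective removes all ties, in
  the direction prescribed by the rule that selects among two optimal vertices.\<close>

section \<open>The dynamics of consecutive tilts\<close>

text \<open>Inside a phase two quantities move at different rates. A split cut may leave the size of
  the corner as it is and only halve \<open>a\<close>; a Chvatal cut shrinks that size but may bring
  \<open>a\<close> back to the order of \<open>D\<close>. The measure is therefore lexicographic: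
  one unit of the outer logarithm is worth a whole inner logarithm, and this is where the square
  comes from. Across phases the edges are counted by their side of the optimal vertex. As long as
  the edge being tilted contains no integer point, the cut destroys it, so left edges never become
  more numerous and one may turn into a right edge. Once it contains one, the pivot belongs to
  \<open>Q\<close>, the vertex cannot move past it, and only right edges matter. To have two sides
  at all, no edge normal may be parallel to the objective. The sense in which the objective is
  rotated depends on \<open>P\<close>: an optimal facet that has a first vertex must lie right of
  \<open>d\<close>, one that extends backwards to infinity must lie left of it. The flag
  \<open>ray\<close> separates the two cases, and cuts do not mix them.\<close>

text \<open>\<open>D\<close> is the determinant of the normals at the corner; after the next tilt it is at most
  \<open>a + \<sigma>\<close> if \<open>a > 0\<close> and equal to \<open>- a\<close> otherwise. The determinant alone may shrink by less than a
  constant factor; the product of its present value and this bound does not.\<close>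

definition phase_size :: "int \<Rightarrow> real \<Rightarrow> int \<Rightarrow> real" where
  "phase_size D \<sigma> a = max 1 (of_int D * (if a > 0 then of_int a + \<sigma> else - of_int a))"

text \<open>A Chvatal cut can raise the second summand from 0 to at most
  \<open>\<Lambda> + 1\<close> if \<open>\<Lambda>\<close> bounds the logarithm of \<open>D\<close>.
  So each unit of the first logarithm is weighted with \<open>\<Lambda> + 2\<close>: it pays for
  that rise and for the cut itself. The base 3/2 belongs to the factor 2/3 that a Chvatal cut
  gains.\<close>

definition phase_potential :: "real \<Rightarrow> int \<Rightarrow> real \<Rightarrow> int \<Rightarrow> real" where
  "phase_potential \<Lambda> D \<sigma> a =
     (\<Lambda> + 2) * log (3/2) (phase_size D \<sigma> a) + (if a > 0 then log 2 (of_int a) + 1 else 0)"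

text \<open>The bounds on \<open>j\<close> give \<open>\<sigma> < D'\<close> and
  \<open>D' \<le> a + \<sigma>\<close>. With \<open>t \<ge> 0\<close> this would make
  \<open>a' \<ge> a \<ge> D' - \<sigma>\<close>, outside the range of \<open>a'\<close>. Hence
  \<open>a' \<le> a - D'\<close>, and adding \<open>a' < D' - \<sigma>\<close> yields
  \<open>2 * a' \<le> a\<close>. The second summand loses 1, so the first one only must not
  grow.\<close>

lemma split_phase_drop:
  fixes D a j t :: int and \<sigma> \<Lambda> :: real
  assumes \<sigma>: "0 < \<sigma>" and a: "a > 0"
    and j: "of_int (j * a) < of_int D - \<sigma>" "of_int D - \<sigma> \<le> of_int ((j + 1) * a)"
    and D': "D' = D - j * a" and a': "a' = a + t * D'"
    and range: "of_int a < of_int D - \<sigma>" "- \<sigma> \<le> of_int a'" "of_int a' < of_int D' - \<sigma>" and \<Lambda>: "\<Lambda> \<ge> 0"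
  shows "phase_potential \<Lambda> D' \<sigma> a' + 1 \<le> phase_potential \<Lambda> D \<sigma> a"
proof -
  have D'l: "real_of_int D' \<le> of_int a + \<sigma>" and D'g: "real_of_int D' > \<sigma>"
    using j D' by (auto simp: algebra_simps)
  have tneg: "t < 0"
  proof (rule ccontr)
    assume "\<not> t < 0"
    then have "t * D' \<ge> 0" using D'g \<sigma> by (intro mult_nonneg_nonneg) linarith+
    then have "a' \<ge> a" using a' by simp
    then show False using range(3) D'l by linarith
  qed
  then have "t * D' \<le> (-1) * D'" using D'g \<sigma> by (intro mult_right_mono) linarith+
  then have a'le: "a' \<le> a - D'" using a' by simp
  have half: "2 * a' \<le> a" using a'le range(3) \<sigma> by linarith
  have Dg: "real_of_int D \<ge> of_int D'" using range(1) D'l by linarith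
  \<comment> \<open>The factors change places: \<open>D'\<close> is at most the old second factor
    \<open>a + \<sigma>\<close>, and the new second factor is at most \<open>D'\<close>, hence at
    most \<open>D\<close>.\<close>
  have size: "phase_size D' \<sigma> a' \<le> phase_size D \<sigma> a"
  proof -
    have *: "(if a' > 0 then of_int a' + \<sigma> else - of_int a') \<le> real_of_int D'"
      using range D'g by auto
    have "of_int D' * (if a' > 0 then of_int a' + \<sigma> else - of_int a') \<le> (of_int a + \<sigma>) * real_of_int D"
      using * Dg D'l D'g \<sigma> a range(2)
      by (intro mult_mono) auto
    then show ?thesis using a unfolding phase_size_def
      by (auto simp: max_def mult.commute)
  qed
  have "log (3/2) (phase_size D' \<sigma> a') \<le> log (3/2) (phase_size D \<sigma> a)"
    using size by (subst log_le_cancel_iff) (auto simp: phase_size_def)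
  then have 1: "(\<Lambda> + 2) * log (3/2) (phase_size D' \<sigma> a') \<le> (\<Lambda> + 2) * log (3/2) (phase_size D \<sigma> a)"
    using \<Lambda> by (intro mult_left_mono) auto
  have 2: "(if a' > 0 then log 2 (of_int a') + 1 else 0) + 1 \<le> log 2 (of_int a) + 1"
  proof (cases "a' > 0")
    case True
    have "log 2 (of_int a') + 1 = log 2 (2 * of_int a')" using True by (simp add: log_mult)
    also have "\<dots> \<le> log 2 (of_int a)" using half True
      by (subst log_le_cancel_iff) linarith+
    finally show ?thesis using True by simp
  next
    case False
    then show ?thesis using a by simp
  qed
  show ?thesis using 1 2 a unfolding phase_potential_def by simp
qed

text \<open>The old size is \<open>D * D'\<close>, so the new second factor \<open>Y\<close> has to
  be at most \<open>2/3 * D\<close>. As \<open>Y < D'\<close>, this is clear unless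
  \<open>D'\<close> exceeds \<open>2/3 * D\<close>. Then the ranges leave room only for
  \<open>\<sigma>' = \<sigma> - D'\<close> and \<open>a' = D - D'\<close>, and
  \<open>Y = D + \<sigma> - 2 * D'\<close> is below twice \<open>D - D'\<close>, thus small
  again.\<close>

lemma chvatal_phase_size_drop:
  fixes D a t s :: int and \<sigma> \<sigma>' :: real
  assumes \<sigma>: "0 < \<sigma>" "\<sigma> < of_int D" and a: "a < 0" "- \<sigma> \<le> of_int a"
    and D': "D' = - a" and \<sigma>': "\<sigma>' = \<sigma> + of_int (s * D')" "0 < \<sigma>'" "\<sigma>' < of_int D'"
    and a': "a' = D + t * D'" "- \<sigma>' \<le> of_int a'" "of_int a' < of_int D' - \<sigma>'"
  shows "phase_size D' \<sigma>' a' \<le> 2/3 * phase_size D \<sigma> a"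
proof -
  define Y where "Y = (if a' > 0 then of_int a' + \<sigma>' else - real_of_int a')"
  have D'D: "1 \<le> D'" "D' < D" using \<sigma> a D' by linarith+
  have Y0: "0 \<le> Y" "Y < of_int D'" unfolding Y_def using \<sigma>'(2,3) a'(2,3) by (cases "a' > 0"; simp)+
  have Y: "3 * Y \<le> 2 * of_int D"
  proof (cases "3 * D' \<le> 2 * D")
    case True then show ?thesis using Y0 by linarith
  next
    case False
    then have D2: "D < 2 * D'" using D'D by linarith
    have s: "s = -1"
    proof -
      have "of_int (s * D') < real_of_int 0"
        using \<sigma>' a D' by linarith
      then have "s * D' < 0" by linarith
      then have "s < 0" using D'D by (simp add: mult_less_0_iff)
      moreover have "\<not> s \<le> -2"
      proof
        assume "s \<le> -2"
        then have "s * D' \<le> -2 * D'" using D'D by (intro mult_right_mono) auto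
        then have "real_of_int (s * D') \<le> -2 * of_int D'" by (metis of_int_le_iff of_int_minus of_int_mult of_int_numeral)
        then show False using \<sigma>' \<sigma> D2 by linarith
      qed
      ultimately show ?thesis by linarith
    qed
    have \<sigma>'': "\<sigma>' = \<sigma> - of_int D'" using \<sigma>' s by simp
    have t: "t = -1 \<or> t = -2"
    proof -
      have "t < 0"
      proof (rule ccontr)
        assume "\<not> t < 0"
        then have "t * D' \<ge> 0" using D'D by simp
        then show False using a' \<sigma>' D'D by linarith
      qed
      moreover have "\<not> t \<le> -3"
      proof
        assume "t \<le> -3"
        then have "t * D' \<le> -3 * D'" using D'D by (intro mult_right_mono) auto
        then show False using a' \<sigma>' D2 by linarith
      qed
      ultimately show ?thesis by linarith
    qed
    show ?thesis
    proof (cases "t = -1")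
      case True
      then have "a' = D - D'" using a' by simp
      then show ?thesis using False D'D \<sigma>'' \<sigma> unfolding Y_def by auto
    next
      case f2: False
      then have *: "a' = D - 2 * D'" using t a' by simp
      \<comment> \<open>Now \<open>a' \<ge> - \<sigma>'\<close> says
        \<open>\<sigma> \<ge> 3 * D' - D\<close>, which exceeds \<open>D\<close> because
        \<open>3 * D' > 2 * D\<close>.\<close>
      then have False using False D'D \<sigma>'' \<sigma> a'(2) by linarith
      then show ?thesis ..
    qed
  qed
  have X: "phase_size D \<sigma> a = of_int D * of_int D'"
  proof -
    have "D * D' \<ge> 1 * 1" using D'D by (intro mult_mono) auto
    then have "real_of_int D * of_int D' \<ge> 1" by (metis mult_1 of_int_1_le_iff of_int_mult)
    then show ?thesis using a D' unfolding phase_size_def by auto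
  qed
  have "D * D' \<ge> 2 * 1" using D'D by (intro mult_mono) auto
  then have "real_of_int (D * D') \<ge> 2" by linarith
  then have 1: "1 \<le> 2/3 * (real_of_int D * of_int D')" by simp
  have "of_int D' * (3 * Y) \<le> of_int D' * (2 * real_of_int D)" using Y D'D by (intro mult_left_mono) auto
  then have 2: "of_int D' * Y \<le> 2/3 * (real_of_int D * of_int D')" by (simp add: algebra_simps)
  show ?thesis unfolding X using 1 2 unfolding phase_size_def Y_def by simp
qed

lemma chvatal_phase_drop:
  fixes D a t s :: int and \<sigma> \<sigma>' \<Lambda> :: real
  assumes \<sigma>: "0 < \<sigma>" "\<sigma> < of_int D" and a: "a < 0" "- \<sigma> \<le> of_int a"
    and D': "D' = - a" and \<sigma>': "\<sigma>' = \<sigma> + of_int (s * D')" "0 < \<sigma>'" "\<sigma>' < of_int D'"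
    and a': "a' = D + t * D'" "- \<sigma>' \<le> of_int a'" "of_int a' < of_int D' - \<sigma>'"
    and \<Lambda>: "log 2 (of_int D) \<le> \<Lambda>"
  shows "phase_potential \<Lambda> D' \<sigma>' a' + 1 \<le> phase_potential \<Lambda> D \<sigma> a"
proof -
  have "D > 0" using \<sigma> by linarith
  then have D1: "real_of_int D \<ge> 1" by linarith
  have \<Lambda>0: "\<Lambda> \<ge> 0" using \<Lambda> D1 by (smt (verit) zero_le_log_cancel_iff)
  have pos: "phase_size D \<sigma> a \<ge> 1" "phase_size D' \<sigma>' a' \<ge> 1" by (auto simp: phase_size_def)
  have "phase_size D' \<sigma>' a' \<le> 2/3 * phase_size D \<sigma> a"
    using chvatal_phase_size_drop[OF \<sigma> a D' \<sigma>' a'] .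
  then have "3/2 * phase_size D' \<sigma>' a' \<le> phase_size D \<sigma> a" by simp
  then have "log (3/2) (3/2 * phase_size D' \<sigma>' a') \<le> log (3/2) (phase_size D \<sigma> a)"
    using pos by (subst log_le_cancel_iff) auto
  moreover have "log (3/2) (3/2 * phase_size D' \<sigma>' a') = 1 + log (3/2) (phase_size D' \<sigma>' a')"
    using pos by (subst log_mult) auto
  ultimately have "log (3/2) (phase_size D' \<sigma>' a') + 1 \<le> log (3/2) (phase_size D \<sigma> a)" by simp
  then have "(\<Lambda> + 2) * (log (3/2) (phase_size D' \<sigma>' a') + 1) \<le> (\<Lambda> + 2) * log (3/2) (phase_size D \<sigma> a)"
    using \<Lambda>0 by (intro mult_left_mono) auto
  moreover have "(if a' > 0 then log 2 (of_int a') + 1 else 0) \<le> \<Lambda> + 1"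
  proof (cases "a' > 0")
    case True
    have "log 2 (of_int a') \<le> log 2 (of_int D)"
      using True a' \<sigma>' D' a \<sigma> by (subst log_le_cancel_iff) linarith+
    then show ?thesis using True \<Lambda> by simp
  qed (use \<Lambda>0 in auto)
  ultimately show ?thesis using a unfolding phase_potential_def by (simp add: algebra_simps)
qed

text \<open>Origin of 64: the size is at most \<open>D * D\<close>, and logarithms to base 3/2 are
  at most twice those to base 2 since 9/4 exceeds 2, so the first logarithm is at most
  \<open>12 * L\<close>. With \<open>\<Lambda> = 3 * L\<close> the total is at most
  \<open>36 * L\<^sup>2 + 27 * L + 1\<close>, and \<open>L \<ge> 1\<close> finishes.\<close>

lemma phase_potential_bounds:
  fixes D a :: int and \<sigma> L :: real
  assumes \<sigma>: "0 < \<sigma>" "\<sigma> < of_int D" and a: "- \<sigma> \<le> of_int a" "of_int a < of_int D - \<sigma>"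
    and L: "L \<ge> 1" "log 2 (of_int D) \<le> 3 * L"
  shows "0 \<le> phase_potential (3 * L) D \<sigma> a" "phase_potential (3 * L) D \<sigma> a \<le> 64 * L\<^sup>2"
proof -
  have "D > 0" using \<sigma> by linarith
  then have D1: "real_of_int D \<ge> 1" by linarith
  have X1: "phase_size D \<sigma> a \<ge> 1" by (simp add: phase_size_def)
  show "0 \<le> phase_potential (3 * L) D \<sigma> a"
    using X1 L unfolding phase_potential_def by (auto intro!: add_nonneg_nonneg mult_nonneg_nonneg)
  have "(if a > 0 then of_int a + \<sigma> else - of_int a) \<le> real_of_int D" using a \<sigma> by auto
  then have "of_int D * (if a > 0 then of_int a + \<sigma> else - of_int a) \<le> of_int D * real_of_int D"
    using D1 by (intro mult_left_mono) auto
  moreover have "1 * 1 \<le> of_int D * real_of_int D" using D1 by (intro mult_mono) auto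
  ultimately have X: "phase_size D \<sigma> a \<le> of_int D * of_int D" by (simp add: phase_size_def)
  have l32: "log (3/2) Y \<le> 2 * log 2 Y" if "Y \<ge> 1" for Y :: real
  proof -
    have "ln 2 \<le> ln ((3/2)^2 :: real)" by (subst ln_le_cancel_iff) (auto simp: power2_eq_square)
    also have "\<dots> = 2 * ln (3/2 :: real)" by (subst ln_realpow) auto
    finally have *: "ln 2 \<le> 2 * ln (3/2 :: real)" .
    have "ln Y * ln 2 \<le> ln Y * (2 * ln (3/2))" using * that by (intro mult_left_mono) auto
    moreover have "ln (3/2 :: real) > 0" "ln (2 :: real) > 0" by auto
    ultimately show ?thesis unfolding log_def by (simp add: field_simps)
  qed
  have "log (3/2) (phase_size D \<sigma> a) \<le> log (3/2) (of_int D * of_int D)"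
    using X X1 by (subst log_le_cancel_iff) linarith+
  also have "\<dots> = 2 * log (3/2) (of_int D)" using D1 by (subst log_mult) auto
  also have "\<dots> \<le> 2 * (2 * log 2 (of_int D))" using l32[OF D1] by simp
  also have "\<dots> \<le> 12 * L" using L by simp
  finally have "(3 * L + 2) * log (3/2) (phase_size D \<sigma> a) \<le> (3 * L + 2) * (12 * L)"
    using L by (intro mult_left_mono) auto
  moreover have "(if a > 0 then log 2 (of_int a) + 1 else 0) \<le> 3 * L + 1"
  proof (cases "a > 0")
    case True
    have "log 2 (of_int a) \<le> log 2 (of_int D)"
      using True a \<sigma> by (subst log_le_cancel_iff) linarith+
    then show ?thesis using True L by simp
  qed (use L in auto)
  moreover have "(3 * L + 2) * (12 * L) + (3 * L + 1) \<le> 64 * L\<^sup>2"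
  proof -
    have "L * 1 \<le> L * L" using L by (intro mult_left_mono) auto
    then have "27 * L + 1 \<le> 28 * (L * L)" using L by linarith
    then show ?thesis by (simp add: algebra_simps power2_eq_square)
  qed
  ultimately show "phase_potential (3 * L) D \<sigma> a \<le> 64 * L\<^sup>2"
    unfolding phase_potential_def by linarith
qed

section \<open>Plane linear algebra\<close>

text \<open>The determinant; it is negative if and only if the second vector is reached from the
  first by a clockwise turn of less than a straight angle.\<close>

definition cross2 :: "real^2 \<Rightarrow> real^2 \<Rightarrow> real" where
  "cross2 a b = a $ 1 * b $ 2 - a $ 2 * b $ 1"

text \<open>Clockwise quarter turn, polymorphic so that it acts on integral normals and real
  directions alike. Applied to an outer normal it gives the direction in which the facet is
  traversed clockwise.\<close>

definition turn :: "'a::ring_1^2 \<Rightarrow> 'a^2" where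
  "turn a = vector [a $ 2, - a $ 1]"

definition idot :: "int^2 \<Rightarrow> int^2 \<Rightarrow> int" where
  "idot a b = a $ 1 * b $ 1 + a $ 2 * b $ 2"

lemma inner_2: "(a::real^2) \<bullet> x = a $ 1 * x $ 1 + a $ 2 * x $ 2"
  by (simp add: inner_vec_def sum_2)

lemma vec_eq_2: "(x::'a^2) = y \<longleftrightarrow> x $ 1 = y $ 1 \<and> x $ 2 = y $ 2"
  by (simp add: vec_eq_iff forall_2)

lemma turn_nth [simp]: "turn a $ 1 = a $ 2" "turn a $ 2 = - a $ 1"
  by (simp_all add: turn_def)

lemma rvec_nth [simp]: "rvec a $ i = of_int (a $ i)"
  by (simp add: rvec_def)

lemma rvec_arith: "rvec (a + b) = rvec a + rvec b" "rvec (a - b) = rvec a - rvec b"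
  "rvec (- a) = - rvec a" "rvec (k *s a) = of_int k *\<^sub>R rvec a" "rvec (turn a) = turn (rvec a)"
  "rvec 0 = 0"
  by (auto simp: vec_eq_2)

lemma rvec_eq_iff [simp]: "rvec a = rvec b \<longleftrightarrow> a = b"
  by (simp add: vec_eq_2)

lemma rvec_eq_0_iff [simp]: "rvec a = 0 \<longleftrightarrow> a = 0"
  using rvec_eq_iff[of a 0] by (simp only: rvec_arith)

lemma inner_rvec: "rvec a \<bullet> rvec b = of_int (idot a b)"
  by (simp add: inner_2 idot_def)

lemma int_pts_eq: "int_pts = range rvec"
proof
  show "range rvec \<subseteq> int_pts" by (auto simp: int_pts_def)
  show "int_pts \<subseteq> range rvec"
  proof
    fix x assume "x \<in> int_pts"
    then have "x = rvec (\<chi> i. \<lfloor>x $ i\<rfloor>)" by (auto simp: int_pts_def vec_eq_iff)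
    then show "x \<in> range rvec" by blast
  qed
qed

lemma rvec_in_int_pts [simp]: "rvec a \<in> int_pts" by (simp add: int_pts_eq)

lemma turn_eq_0_iff [simp]: "turn (a::real^2) = 0 \<longleftrightarrow> a = 0"
  by (auto simp: vec_eq_2)

lemma inner_turn [simp]: "(a::real^2) \<bullet> turn a = 0" by (simp add: inner_2)

lemma inner_turn_cross2: "a \<bullet> turn b = - cross2 b a"
  by (simp add: inner_2 cross2_def)

lemma parallel_if_orthogonal:
  fixes a u v :: "real^2"
  assumes "a \<noteq> 0" "a \<bullet> u = 0" "a \<bullet> v = 0" "u \<noteq> 0"
  shows "\<exists>s. v = s *\<^sub>R u"
proof -
  have au: "a $ 1 * u $ 1 + a $ 2 * u $ 2 = 0" and av: "a $ 1 * v $ 1 + a $ 2 * v $ 2 = 0"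
    using assms by (simp_all add: inner_2)
  have "a $ 1 * (u $ 1 * v $ 2 - u $ 2 * v $ 1) = 0" "a $ 2 * (u $ 1 * v $ 2 - u $ 2 * v $ 1) = 0"
    using au av by algebra+
  then have c: "u $ 1 * v $ 2 = u $ 2 * v $ 1" using assms(1) by (auto simp: vec_eq_2)
  show ?thesis
  proof (cases "u $ 1 = 0")
    case True
    then have "u $ 2 \<noteq> 0" using assms(4) by (auto simp: vec_eq_2)
    then have "v = (v $ 2 / u $ 2) *\<^sub>R u" using c True by (simp add: vec_eq_2)
    then show ?thesis by blast
  next
    case False
    then have "v = (v $ 1 / u $ 1) *\<^sub>R u" using c by (simp add: vec_eq_2 field_simps)
    then show ?thesis by blast
  qed
qed

lemma parallel_normals:
  fixes a b u :: "real^2"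
  assumes "u \<noteq> 0" "a \<bullet> u = 0" "b \<bullet> u = 0" "a \<noteq> 0"
  shows "\<exists>s. b = s *\<^sub>R a"
  using parallel_if_orthogonal[of u a b] assms by (simp add: inner_commute)

lemma cramer_2:
  assumes "cross2 a b \<noteq> 0"
  shows "d = (cross2 d b / cross2 a b) *\<^sub>R a + (cross2 a d / cross2 a b) *\<^sub>R b"
proof -
  have "cross2 a b *\<^sub>R d = cross2 d b *\<^sub>R a + cross2 a d *\<^sub>R b"
    by (simp add: vec_eq_2 cross2_def algebra_simps)
  then have "(1 / cross2 a b) *\<^sub>R (cross2 a b *\<^sub>R d) = (1 / cross2 a b) *\<^sub>R (cross2 d b *\<^sub>R a + cross2 a d *\<^sub>R b)"
    by simp
  then show ?thesis using assms by (simp add: scaleR_add_right)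
qed

lemma affine_hull_2_eq_line:
  fixes a p x :: "real^2"
  assumes "a \<noteq> 0" "a \<bullet> p = k" "a \<bullet> x = k" "p \<noteq> x"
  shows "affine hull {p, x} = {y. a \<bullet> y = k}"
proof
  show "affine hull {p, x} \<subseteq> {y. a \<bullet> y = k}"
    by (rule hull_minimal) (use assms in \<open>auto simp: affine_hyperplane\<close>)
  show "{y. a \<bullet> y = k} \<subseteq> affine hull {p, x}"
  proof
    fix y assume "y \<in> {y. a \<bullet> y = k}"
    then have "a \<bullet> (x - p) = 0" "a \<bullet> (y - p) = 0" using assms by (auto simp: inner_diff_right)
    then obtain s where "y - p = s *\<^sub>R (x - p)" using parallel_if_orthogonal[of a "x - p" "y - p"] assms by auto
    then have "y = (1 - s) *\<^sub>R p + s *\<^sub>R x" by (simp add: algebra_simps)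
    then show "y \<in> affine hull {p, x}" unfolding affine_hull_2 by (force intro: exI[of _ "1 - s"])
  qed
qed

section \<open>Half-planes with primitive normals\<close>

lemma primitive_nonzero: "primitive a \<Longrightarrow> a \<noteq> 0"
  by (auto simp: primitive_def)

lemma primitive_bezout:
  assumes "primitive a" shows "\<exists>f. idot a f = 1"
proof -
  obtain u v where "u * a $ 1 + v * a $ 2 = gcd (a $ 1) (a $ 2)" using bezout_int by blast
  then have "idot a (vector [u, v]) = 1" using assms by (simp add: idot_def primitive_def mult.commute)
  then show ?thesis by blast
qed

lemma primitive_if_idot_1:
  assumes "idot a f = 1" shows "primitive a"
proof -
  have "gcd (a $ 1) (a $ 2) dvd idot a f" unfolding idot_def by (intro dvd_add dvd_mult2) auto
  then show ?thesis using assms by (simp add: primitive_def)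
qed

lemma primitive_turn: "primitive a \<Longrightarrow> primitive (turn a)"
  by (simp add: primitive_def gcd.commute)

lemma primitive_part:
  assumes "a \<noteq> (0::int^2)" shows "\<exists>b g. primitive b \<and> g > 0 \<and> a = g *s b"
proof -
  define g where "g = gcd (a $ 1) (a $ 2)"
  have g: "g > 0" unfolding g_def using assms by (auto simp: vec_eq_2)
  define b :: "int^2" where "b = vector [a $ 1 div g, a $ 2 div g]"
  have "primitive b" unfolding primitive_def b_def g_def
    using assms by (simp add: vec_eq_2 div_gcd_coprime)
  moreover have "a = g *s b" by (simp add: vec_eq_2 b_def g_def)
  ultimately show ?thesis using g by blast
qed

lemma halfplane_scale: "g > 0 \<Longrightarrow> halfplane (g *s b) z = halfplane b (z / of_int g)"
  by (auto simp: halfplane_def rvec_arith field_simps)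

lemma halfplane_primitive:
  assumes "a \<noteq> 0" shows "\<exists>b g. primitive b \<and> g > 0 \<and> a = g *s b \<and> halfplane a z = halfplane b (z / of_int g)"
  using primitive_part[OF assms] halfplane_scale by metis

lemma frontier_halfplane: "a \<noteq> 0 \<Longrightarrow> frontier (halfplane a z) = {x. rvec a \<bullet> x = z}"
  unfolding halfplane_def by (rule frontier_halfspace_le) simp

text \<open>A functional bounded above on a half-plane cannot vary along the boundary line and
  cannot increase inwards; both contradictions move far enough in such a direction.\<close>

lemma halfplane_subset:
  assumes "a \<noteq> 0" "halfplane a z \<subseteq> halfplane b w"
  shows "\<exists>\<mu>\<ge>0. rvec b = \<mu> *\<^sub>R rvec a \<and> \<mu> * z \<le> w"
proof -
  define A B where "A = rvec a" and "B = rvec b"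
  have A0: "A \<noteq> 0" using assms by (simp add: A_def)
  have AA: "A \<bullet> A > 0" using A0 by simp
  define x0 where "x0 = (z / (A \<bullet> A)) *\<^sub>R A"
  have x0: "A \<bullet> x0 = z" using AA by (simp add: x0_def)
  have H: "B \<bullet> x \<le> w" if "A \<bullet> x \<le> z" for x
    using assms(2) that by (auto simp: halfplane_def A_def B_def)
  have Bt: "B \<bullet> turn A = 0"
  proof (rule ccontr)
    assume nz: "B \<bullet> turn A \<noteq> 0"
    define t where "t = (w - B \<bullet> x0 + 1) / (B \<bullet> turn A)"
    have "B \<bullet> (x0 + t *\<^sub>R turn A) \<le> w" by (rule H) (simp add: inner_add_right x0)
    then show False using nz by (simp add: inner_add_right t_def)
  qed
  then obtain \<mu> where \<mu>: "B = \<mu> *\<^sub>R A"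
    using parallel_if_orthogonal[of "turn A" A B] A0 by (auto simp: inner_commute)
  have "\<mu> \<ge> 0"
  proof (rule ccontr)
    assume neg: "\<not> \<mu> \<ge> 0"
    define t where "t = (\<bar>w - B \<bullet> x0\<bar> + 1) / (- \<mu> * (A \<bullet> A))"
    have "- \<mu> * (A \<bullet> A) > 0" using neg AA by (intro mult_pos_pos) auto
    then have t: "t \<ge> 0" unfolding t_def by (intro divide_nonneg_pos) auto
    have "B \<bullet> (x0 - t *\<^sub>R A) \<le> w" by (rule H) (use t AA in \<open>simp add: inner_diff_right x0\<close>)
    moreover have "B \<bullet> (t *\<^sub>R A) = - (\<bar>w - B \<bullet> x0\<bar> + 1)" using neg AA by (simp add: \<mu> t_def)
    ultimately show False by (simp add: inner_diff_right)
  qed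
  moreover have "\<mu> * z \<le> w" using H[of x0] x0 by (simp add: \<mu>)
  ultimately show ?thesis using \<mu> unfolding A_def B_def by blast
qed

text \<open>Pairing with a Bezout vector of \<open>a\<close> shows that \<open>\<mu>\<close> is an
  integer; it then divides both entries of \<open>b\<close> and is a unit. Thus primitive normal and
  right-hand side are a canonical name of a half-plane.\<close>

lemma primitive_parallel:
  assumes "primitive a" "primitive b" "\<mu> > 0" "rvec b = \<mu> *\<^sub>R rvec a"
  shows "\<mu> = 1 \<and> b = a"
proof -
  obtain f where f: "idot a f = 1" using primitive_bezout assms by blast
  have "real_of_int (idot b f) = \<mu> * of_int (idot a f)" by (metis assms(4) inner_rvec inner_scaleR_left)
  then have \<mu>: "\<mu> = of_int (idot b f)" using f by simp
  then have b: "b = idot b f *s a" using assms(4) rvec_eq_iff rvec_arith(4) by metis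
  have "idot b f dvd gcd (b $ 1) (b $ 2)" by (subst (2 3) b) auto
  then have "is_unit (idot b f)" using assms unfolding primitive_def by simp
  then have "idot b f = 1" using \<mu> assms(3) by auto
  then show ?thesis using \<mu> b by simp
qed

lemma halfplane_eq_scaled:
  assumes "a \<noteq> 0" "b \<noteq> 0" "halfplane a z = halfplane b w"
  shows "\<exists>\<mu>>0. rvec b = \<mu> *\<^sub>R rvec a \<and> w = \<mu> * z"
proof -
  obtain \<mu> where \<mu>: "\<mu> \<ge> 0" "rvec b = \<mu> *\<^sub>R rvec a" "\<mu> * z \<le> w"
    using halfplane_subset assms by blast
  obtain \<nu> where \<nu>: "\<nu> \<ge> 0" "rvec a = \<nu> *\<^sub>R rvec b" "\<nu> * w \<le> z"
    using halfplane_subset assms by blast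
  have "\<mu> \<noteq> 0" using \<mu> assms(2) by auto
  then have \<mu>0: "\<mu> > 0" using \<mu> by simp
  have "1 *\<^sub>R rvec a = (\<nu> * \<mu>) *\<^sub>R rvec a" using \<mu>(2) \<nu>(2) by (metis scaleR_one scaleR_scaleR)
  then have "\<nu> * \<mu> = 1" using assms(1) by (metis rvec_eq_0_iff scaleR_cancel_right)
  then have "\<mu> * (\<nu> * w) = w" by (simp add: mult.commute mult.assoc[symmetric])
  then have "w \<le> \<mu> * z" using \<nu>(3) \<mu>0 by (metis mult_left_mono less_imp_le)
  then show ?thesis using \<mu> \<mu>0 by force
qed

lemma halfplane_eq_iff:
  assumes "primitive a" "primitive b"
  shows "halfplane a z = halfplane b w \<longleftrightarrow> a = b \<and> z = w"
proof
  assume "halfplane a z = halfplane b w"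
  then obtain \<mu> where "\<mu> > 0" "rvec b = \<mu> *\<^sub>R rvec a" "w = \<mu> * z"
    using halfplane_eq_scaled assms primitive_nonzero by blast
  then show "a = b \<and> z = w" using primitive_parallel[OF assms] by auto
qed auto

section \<open>Integer points on rational lines\<close>

lemma idot_simps: "idot a (p + q) = idot a p + idot a q" "idot a (p - q) = idot a p - idot a q"
  "idot a (t *s p) = t * idot a p" "idot (a + b) p = idot a p + idot b p"
  "idot (t *s a) p = t * idot a p" "idot a (turn a) = 0" "idot a (- p) = - idot a p"
  by (simp_all add: idot_def algebra_simps)

lemma lattice_line:
  assumes "primitive n" "idot n p = idot n q"
  shows "\<exists>t. q = p + t *s turn n"
proof -
  obtain f where f: "idot n f = 1" using primitive_bezout assms by blast
  \<comment> \<open>The turned Bezout vector pairs with \<open>turn n\<close> to 1, so this reads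
    off the coordinate along the line.\<close>
  define t where "t = idot (vector [f $ 2, - f $ 1]) (q - p)"
  have "n $ 1 * (q - p) $ 1 + n $ 2 * (q - p) $ 2 = 0" using assms(2) by (simp add: idot_def algebra_simps)
  moreover have "n $ 1 * f $ 1 + n $ 2 * f $ 2 = 1" using f by (simp add: idot_def)
  ultimately have "q $ 1 - p $ 1 = t * n $ 2" "q $ 2 - p $ 2 = - t * n $ 1"
    unfolding t_def idot_def by (simp_all, algebra+)
  then have "q = p + t *s turn n" by (simp add: vec_eq_2)
  then show ?thesis by blast
qed

text \<open>The ends lie on neighbouring levels of an integral functional, and an integer point
  between them would have a level strictly in between.\<close>

lemma open_segment_lattice_free:
  assumes "idot a q = idot a p + 1 \<or> idot a q = idot a p - 1"
  shows "open_segment (rvec p) (rvec q) \<inter> int_pts = {}"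
proof (rule ccontr)
  assume "\<not> ?thesis"
  then obtain r where r: "rvec r \<in> open_segment (rvec p) (rvec q)" by (auto simp: int_pts_eq)
  then obtain u where u: "0 < u" "u < 1" "rvec r = (1 - u) *\<^sub>R rvec p + u *\<^sub>R rvec q"
    by (auto simp: in_segment)
  have "real_of_int (idot a r) = rvec a \<bullet> ((1 - u) *\<^sub>R rvec p + u *\<^sub>R rvec q)"
    using u(3) inner_rvec by metis
  also have "\<dots> = of_int (idot a p) + u * (of_int (idot a q) - of_int (idot a p))"
    by (simp add: inner_add_right inner_rvec algebra_simps)
  finally have *: "real_of_int (idot a r - idot a p) = u * of_int (idot a q - idot a p)" by simp
  have no_int: "real_of_int k \<noteq> u" for k
  proof
    assume "real_of_int k = u"
    then have "0 < real_of_int k" "real_of_int k < 1" using u by auto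
    then show False by simp
  qed
  show False
  proof (cases "idot a q = idot a p + 1")
    case True
    then have "real_of_int (idot a r - idot a p) = u" using * by simp
    then show False using no_int by blast
  next
    case False
    then have "real_of_int (idot a p - idot a r) = u" using * assms by simp
    then show False using no_int by blast
  qed
qed

lemma open_segment_lattice_free_step:
  assumes "open_segment (rvec p) (rvec (p + t *s g)) \<inter> int_pts = {}" "t \<noteq> 0" "g \<noteq> 0"
  shows "t = 1 \<or> t = -1"
proof (rule ccontr)
  assume "\<not> ?thesis"
  then have t: "\<bar>t\<bar> \<ge> 2" using assms(2) by linarith
  define u where "u = 1 / real_of_int \<bar>t\<bar>"
  have "u * of_int t = of_int (sgn t)" unfolding u_def using assms(2) by (cases "t > 0") (auto simp: sgn_if)
  then have "rvec (p + sgn t *s g) = (1 - u) *\<^sub>R rvec p + u *\<^sub>R rvec (p + t *s g)"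
    by (simp add: rvec_arith algebra_simps)
  moreover have "0 < u" "u < 1" unfolding u_def using t by auto
  moreover have "t *s g \<noteq> 0" using assms by (auto simp: vec_eq_2)
  then have "p \<noteq> p + t *s g" by simp
  ultimately have "rvec (p + sgn t *s g) \<in> open_segment (rvec p) (rvec (p + t *s g))"
    unfolding in_segment by (metis rvec_eq_iff)
  then show False using assms(1) rvec_in_int_pts by blast
qed

section \<open>The tilt in lattice coordinates\<close>

text \<open>Minus the determinant of the normals, written as the growth of the second functional
  along one lattice step of the first boundary line. In this form it is the period of the slacks of
  the integer points on that line.\<close>

definition width :: "int^2 \<Rightarrow> int^2 \<Rightarrow> int" where
  "width n1 n2 = idot n2 (turn n1)"

definition slack :: "int^2 \<Rightarrow> real \<Rightarrow> int^2 \<Rightarrow> real" where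
  "slack n z p = z - of_int (idot n p)"

text \<open>Here \<open>p\<close> is the pivot and \<open>p - f\<close> is the point called \<open>x\<close> in the construction of the tilt, so
  that \<open>W\<^sub>0\<close> has normal \<open>turn f\<close>.\<close>

definition corner_lattice :: "int^2 \<Rightarrow> int^2 \<Rightarrow> real \<Rightarrow> int^2 \<Rightarrow> int^2 \<Rightarrow> bool" where
  "corner_lattice n1 n2 z2 p f \<longleftrightarrow> idot n1 f = 1 \<and>
     0 \<le> slack n2 z2 p \<and> slack n2 z2 p < of_int (width n1 n2) \<and>
     - slack n2 z2 p \<le> of_int (idot n2 f) \<and> of_int (idot n2 f) < of_int (width n1 n2) - slack n2 z2 p"

text \<open>If \<open>idot n2 f\<close> is positive, this is the largest number of steps that does
  not yet reach the cone: on the boundary of the upper side of the split the lattice points are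
  \<open>p + turn n1 - i *s f\<close>, and they belong to the cone from \<open>i = j + 1\<close> on.
  Rounding up and subtracting 1 makes a point on the boundary of the cone count as inside.\<close>

definition tilt_steps :: "int^2 \<Rightarrow> int^2 \<Rightarrow> real \<Rightarrow> int^2 \<Rightarrow> int^2 \<Rightarrow> int" where
  "tilt_steps n1 n2 z2 p f = \<lceil>(of_int (width n1 n2) - slack n2 z2 p) / of_int (idot n2 f)\<rceil> - 1"

text \<open>In the split case the boundary must contain the pivot and
  \<open>p + turn n1 - j *s f\<close>. The normal vanishes on their difference because
  \<open>turn f\<close>, \<open>n1\<close> are dual to \<open>turn n1\<close>,
  \<open>f\<close>.\<close>

definition tilt_normal :: "int^2 \<Rightarrow> int^2 \<Rightarrow> real \<Rightarrow> int^2 \<Rightarrow> int^2 \<Rightarrow> int^2" where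
  "tilt_normal n1 n2 z2 p f =
     (if idot n2 f \<le> 0 then turn f else n1 + tilt_steps n1 n2 z2 p f *s turn f)"

definition tilt_plane :: "int^2 \<Rightarrow> int^2 \<Rightarrow> real \<Rightarrow> int^2 \<Rightarrow> int^2 \<Rightarrow> (real^2) set" where
  "tilt_plane n1 n2 z2 p f =
     halfplane (tilt_normal n1 n2 z2 p f) (of_int (idot (tilt_normal n1 n2 z2 p f) p))"

lemma rvec_in_halfplane [simp]: "rvec p \<in> halfplane n z \<longleftrightarrow> of_int (idot n p) \<le> z"
  by (simp add: halfplane_def inner_rvec)

lemma idot_turn_turn: "idot (turn f) (turn n) = idot n f"
  by (simp add: idot_def algebra_simps)

lemma idot_turn_self: "idot (turn f) f = 0"
  by (simp add: idot_def)

lemma turn_turn: "turn (turn f) = - f"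
  by (simp add: vec_eq_2)

text \<open>\<open>turn n1\<close> and \<open>f\<close> form a lattice basis with dual basis
  \<open>turn f\<close> and \<open>n1\<close>; \<open>width n1 n2\<close> and
  \<open>idot n2 f\<close> are the values of \<open>n2\<close> on it.\<close>

lemma normal_decomposition:
  assumes "idot n1 f = 1"
  shows "n2 = width n1 n2 *s turn f + idot n2 f *s n1"
proof -
  have "n1 $ 1 * f $ 1 + n1 $ 2 * f $ 2 = 1" using assms by (simp add: idot_def)
  then have "(n2 $ 1 * n1 $ 2 + n2 $ 2 * - n1 $ 1) * f $ 2 + (n2 $ 1 * f $ 1 + n2 $ 2 * f $ 2) * n1 $ 1 = n2 $ 1"
    "(n2 $ 1 * n1 $ 2 + n2 $ 2 * - n1 $ 1) * - f $ 1 + (n2 $ 1 * f $ 1 + n2 $ 2 * f $ 2) * n1 $ 2 = n2 $ 2"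
    by algebra+
  then show ?thesis unfolding width_def idot_def vec_eq_2
    by (simp only: turn_nth vector_add_component vector_smult_component)
qed

lemma inner_decomposition:
  assumes "idot n1 f = 1"
  shows "rvec n2 \<bullet> x = of_int (width n1 n2) * (rvec (turn f) \<bullet> x) + of_int (idot n2 f) * (rvec n1 \<bullet> x)"
proof -
  have "rvec n2 \<bullet> x = rvec (width n1 n2 *s turn f + idot n2 f *s n1) \<bullet> x"
    using normal_decomposition[OF assms] by metis
  then show ?thesis unfolding rvec_arith(1,4) by (simp add: inner_add_left)
qed

lemma tilt_steps_bounds:
  assumes "idot n2 f > 0"
  shows "of_int (tilt_steps n1 n2 z2 p f * idot n2 f) < of_int (width n1 n2) - slack n2 z2 p"
    "of_int (width n1 n2) - slack n2 z2 p \<le> of_int ((tilt_steps n1 n2 z2 p f + 1) * idot n2 f)"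
proof -
  define E where "E = of_int (width n1 n2) - slack n2 z2 p"
  define a where "a = real_of_int (idot n2 f)"
  have a: "a > 0" using assms by (simp add: a_def)
  have "of_int \<lceil>E / a\<rceil> - 1 < E / a" "E / a \<le> of_int \<lceil>E / a\<rceil>" by linarith+
  then have "(of_int \<lceil>E / a\<rceil> - 1) * a < E" "E \<le> of_int \<lceil>E / a\<rceil> * a"
    using a by (metis pos_less_divide_eq, metis pos_divide_le_eq)
  then show "of_int (tilt_steps n1 n2 z2 p f * idot n2 f) < of_int (width n1 n2) - slack n2 z2 p"
    "of_int (width n1 n2) - slack n2 z2 p \<le> of_int ((tilt_steps n1 n2 z2 p f + 1) * idot n2 f)"
    unfolding tilt_steps_def E_def a_def by simp_all
qed

lemma tilt_steps_unique:
  assumes a: "idot n2 f > 0" and j: "of_int (j * idot n2 f) < of_int (width n1 n2) - slack n2 z2 p"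
    "of_int (width n1 n2) - slack n2 z2 p \<le> of_int ((j + 1) * idot n2 f)"
  shows "j = tilt_steps n1 n2 z2 p f"
proof -
  have "j * idot n2 f < (tilt_steps n1 n2 z2 p f + 1) * idot n2 f"
    "tilt_steps n1 n2 z2 p f * idot n2 f < (j + 1) * idot n2 f"
    using j tilt_steps_bounds[OF a, of n1 z2 p] by linarith+
  then show ?thesis using a by (simp add: mult_less_cancel_right)
qed

lemma tilt_steps_pos:
  assumes "corner_lattice n1 n2 z2 p f" "idot n2 f > 0"
  shows "tilt_steps n1 n2 z2 p f \<ge> 1"
proof -
  have "1 * idot n2 f < (tilt_steps n1 n2 z2 p f + 1) * idot n2 f"
    using tilt_steps_bounds(2)[OF assms(2), of n1 z2 p] assms(1) unfolding corner_lattice_def by linarith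
  then have "1 < tilt_steps n1 n2 z2 p f + 1" using assms(2) by (simp only: mult_less_cancel_right)
  then show ?thesis by simp
qed

text \<open>Division with remainder, twice: moving the pivot along its line changes the slack by
  multiples of the width, and adding multiples of \<open>turn n1\<close> to \<open>f\<close> does
  the same to \<open>idot n2 f\<close>. Each range is one full period.\<close>

lemma corner_lattice_exists:
  assumes "primitive n1" "width n1 n2 > 0"
  shows "\<exists>p f. idot n1 p = z1 \<and> corner_lattice n1 n2 z2 p f"
proof -
  define D where "D = width n1 n2"
  have D: "real_of_int D > 0" using assms by (simp add: D_def)
  obtain f0 where f0: "idot n1 f0 = 1" using primitive_bezout assms by blast
  define s0 where "s0 = slack n2 z2 (z1 *s f0)"
  define p where "p = z1 *s f0 + \<lfloor>s0 / of_int D\<rfloor> *s turn n1"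
  have p: "idot n1 p = z1" by (simp add: p_def idot_simps f0)
  have sp: "slack n2 z2 p = s0 - of_int \<lfloor>s0 / of_int D\<rfloor> * of_int D"
    unfolding s0_def slack_def p_def D_def width_def by (simp add: idot_simps algebra_simps)
  have "of_int \<lfloor>s0 / of_int D\<rfloor> \<le> s0 / of_int D" "s0 / of_int D < of_int \<lfloor>s0 / of_int D\<rfloor> + 1" by linarith+
  then have "of_int \<lfloor>s0 / of_int D\<rfloor> * of_int D \<le> s0" "s0 < (of_int \<lfloor>s0 / of_int D\<rfloor> + 1) * of_int D"
    using D by (metis pos_le_divide_eq, metis pos_divide_less_eq)
  then have sl: "0 \<le> slack n2 z2 p" "slack n2 z2 p < of_int D" unfolding sp by (simp_all add: algebra_simps)
  define u where "u = (- slack n2 z2 p - of_int (idot n2 f0)) / of_int D"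
  define f where "f = f0 + \<lceil>u\<rceil> *s turn n1"
  have f: "idot n1 f = 1" by (simp add: f_def idot_simps f0)
  have af: "real_of_int (idot n2 f) = of_int (idot n2 f0) + of_int \<lceil>u\<rceil> * of_int D"
    unfolding f_def D_def width_def by (simp add: idot_simps)
  have "u \<le> of_int \<lceil>u\<rceil>" "of_int \<lceil>u\<rceil> < u + 1" by linarith+
  then have "u * of_int D \<le> of_int \<lceil>u\<rceil> * of_int D" "of_int \<lceil>u\<rceil> * of_int D < (u + 1) * of_int D"
    using D by simp_all
  moreover have "u * of_int D = - slack n2 z2 p - of_int (idot n2 f0)" using D by (simp add: u_def)
  ultimately have "- slack n2 z2 p \<le> of_int (idot n2 f)" "of_int (idot n2 f) < of_int D - slack n2 z2 p"
    unfolding af by (simp_all add: algebra_simps)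
  then show ?thesis using p f sl unfolding corner_lattice_def D_def by blast
qed

text \<open>On a level \<open>k \<le> z1\<close> the first inequality holds automatically, so the
  cone is cut out by the second one, which is monotone along \<open>turn n1\<close>. The levels
  needed are \<open>z1\<close> for the pivot and \<open>z1 - 1\<close> for the neighbouring
  line.\<close>

lemma lattice_gap_line_iff:
  assumes n1: "primitive n1" and D: "width n1 n2 > 0" and k: "k \<le> z1"
  shows "lattice_gap {x. rvec n1 \<bullet> x = of_int k} (halfplane n1 (of_int z1) \<inter> halfplane n2 z2) x y \<longleftrightarrow>
    (\<exists>p. x = rvec p \<and> y = rvec (p + turn n1) \<and> idot n1 p = k \<and>
       0 \<le> slack n2 z2 p \<and> slack n2 z2 p < of_int (width n1 n2))" (is "?gap \<longleftrightarrow> ?rhs")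
proof
  assume ?gap
  then obtain p q where pq: "x = rvec p" "y = rvec q" "idot n1 p = k" "idot n1 q = k"
    "of_int (idot n2 p) \<le> z2" "of_int (idot n2 q) > z2" "open_segment (rvec p) (rvec q) \<inter> int_pts = {}"
    using k unfolding lattice_gap_def by (force simp: int_pts_eq inner_rvec)
  obtain t where t: "q = p + t *s turn n1" using lattice_line[OF n1] pq by metis
  have q: "idot n2 q = idot n2 p + t * width n1 n2" unfolding t width_def by (simp add: idot_simps)
  have "idot n2 p < idot n2 q" using pq by linarith
  then have t0: "t > 0" using q D by (simp add: zero_less_mult_iff)
  have "turn n1 \<noteq> 0" using primitive_nonzero[OF n1] by (auto simp: vec_eq_2)
  then have "t = 1" using open_segment_lattice_free_step pq(7) t t0 by fastforce
  then have "q = p + turn n1" using t by (simp add: vec_eq_2)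
  moreover have "0 \<le> slack n2 z2 p" "slack n2 z2 p < of_int (width n1 n2)"
    using pq q \<open>t = 1\<close> by (simp_all add: slack_def)
  ultimately show ?rhs using pq by blast
next
  assume ?rhs
  then obtain p where p: "x = rvec p" "y = rvec (p + turn n1)" "idot n1 p = k"
       "0 \<le> slack n2 z2 p" "slack n2 z2 p < of_int (width n1 n2)" by blast
  obtain f where f: "idot n1 f = 1" using primitive_bezout n1 by blast
  have "open_segment (rvec p) (rvec (p + turn n1)) \<inter> int_pts = {}"
    by (rule open_segment_lattice_free[of "turn f"]) (simp add: idot_simps idot_turn_turn f)
  moreover have "idot n2 (p + turn n1) = idot n2 p + width n1 n2" by (simp add: idot_simps width_def)
  ultimately show ?gap using p k unfolding lattice_gap_def slack_def
    by (auto simp: inner_rvec idot_simps)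
qed

text \<open>A primitive functional takes every integer value at integer points, so the next lattice
  line is one level below. The normal in \<open>hat_line\<close> may be a multiple of
  \<open>n\<close>, whence the scaling factor in the proof.\<close>

lemma hat_line_iff:
  assumes "primitive n"
  shows "hat_line (halfplane n (of_int z)) L \<longleftrightarrow> L = {x. rvec n \<bullet> x = of_int (z - 1)}"
proof
  obtain f where f: "idot n f = 1" using primitive_bezout assms by blast
  { assume L: "L = {x. rvec n \<bullet> x = of_int (z - 1)}"
    have "rvec ((z - 1) *s f) \<in> L" unfolding L by (simp add: inner_rvec idot_simps f)
    then have "L \<inter> int_pts \<noteq> {}" by auto
    moreover have "s \<le> of_int (z - 1)" if "s < of_int z" "{x. rvec n \<bullet> x = s} \<inter> int_pts \<noteq> {}" for s
      using that by (auto simp: int_pts_eq inner_rvec)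
    ultimately show "hat_line (halfplane n (of_int z)) L"
      using L primitive_nonzero[OF assms] unfolding hat_line_def
      by (intro exI[of _ n] exI[of _ "real_of_int z"] exI[of _ "real_of_int (z - 1)"]) auto }
  { assume "hat_line (halfplane n (of_int z)) L"
    then obtain a za t where a: "a \<noteq> 0" "halfplane n (of_int z) = halfplane a za" "L = {x. rvec a \<bullet> x = t}"
      "t < za" "L \<inter> int_pts \<noteq> {}" "\<And>s. s < za \<Longrightarrow> {x. rvec a \<bullet> x = s} \<inter> int_pts \<noteq> {} \<Longrightarrow> s \<le> t"
      unfolding hat_line_def by blast
    obtain \<mu> where \<mu>: "\<mu> > 0" "rvec a = \<mu> *\<^sub>R rvec n" "za = \<mu> * of_int z"
      using halfplane_eq_scaled[OF primitive_nonzero[OF assms] a(1,2)] by blast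
    obtain q where "rvec q \<in> L" using a(5) by (auto simp: int_pts_eq)
    then have q: "\<mu> * of_int (idot n q) = t" unfolding a(3) \<mu>(2) by (simp add: inner_rvec)
    have "\<mu> * of_int (idot n q) < \<mu> * of_int z" using q a(4) \<mu>(3) by simp
    then have 1: "idot n q \<le> z - 1" using \<mu>(1) by simp
    have "\<mu> * of_int (z - 1) \<le> t"
    proof (rule a(6))
      show "\<mu> * of_int (z - 1) < za" using \<mu> by simp
      have "rvec a \<bullet> rvec ((z - 1) *s f) = \<mu> * of_int (z - 1)"
        by (simp add: \<mu>(2) inner_rvec idot_simps f)
      then have "rvec ((z - 1) *s f) \<in> {x. rvec a \<bullet> x = \<mu> * of_int (z - 1)} \<inter> int_pts" by simp
      then show "{x. rvec a \<bullet> x = \<mu> * of_int (z - 1)} \<inter> int_pts \<noteq> {}" by blast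
    qed
    then have "\<mu> * of_int (z - 1) \<le> \<mu> * of_int (idot n q)" using q by simp
    then have "real_of_int (z - 1) \<le> of_int (idot n q)" using \<mu>(1) mult_le_cancel_left_pos by blast
    then have t: "t = \<mu> * of_int (z - 1)" using 1 q by (metis antisym of_int_le_iff)
    show "L = {x. rvec n \<bullet> x = of_int (z - 1)}" unfolding a(3) t using \<mu>(1,2) by auto }
qed

definition split_upper :: "int^2 \<Rightarrow> int^2 \<Rightarrow> (real^2) set" where
  "split_upper p f = {x. rvec (turn f) \<bullet> x \<ge> of_int (idot (turn f) p + 1)}"

lemma frontier_split_upper:
  "f \<noteq> 0 \<Longrightarrow> frontier (split_upper p f) = {x. rvec (turn f) \<bullet> x = of_int (idot (turn f) p + 1)}"
proof -
  assume "f \<noteq> 0"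
  then have "rvec (turn f) \<noteq> 0" by (auto simp: rvec_arith)
  then show ?thesis unfolding split_upper_def by (intro frontier_halfspace_ge disjI1)
qed

text \<open>Relative to the pivot let \<open>X \<le> 0\<close> be the change of \<open>n1\<close>
  and \<open>W \<ge> 1\<close> that of \<open>turn f\<close>. The second functional changes by
  \<open>D * W + a * X\<close>, which for \<open>a \<le> 0\<close> is at least \<open>D\<close> and
  so exceeds the slack. For \<open>a > 0\<close> the lattice point after \<open>j + 1\<close> steps
  lies in both sets.\<close>

lemma cone_inter_split_upper_empty_iff:
  assumes cl: "corner_lattice n1 n2 z2 p f" and p: "idot n1 p = z1"
  shows "halfplane n1 (of_int z1) \<inter> halfplane n2 z2 \<inter> split_upper p f = {} \<longleftrightarrow> idot n2 f \<le> 0"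
proof
  assume a: "idot n2 f \<le> 0"
  show "halfplane n1 (of_int z1) \<inter> halfplane n2 z2 \<inter> split_upper p f = {}"
  proof (rule equals0I)
    fix x assume "x \<in> halfplane n1 (of_int z1) \<inter> halfplane n2 z2 \<inter> split_upper p f"
    then have x: "rvec n1 \<bullet> x \<le> of_int z1" "rvec n2 \<bullet> x \<le> z2" "rvec (turn f) \<bullet> x \<ge> of_int (idot (turn f) p) + 1"
      by (auto simp: halfplane_def split_upper_def)
    define D where "D = real_of_int (width n1 n2)"
    have D: "D > slack n2 z2 p" "D > 0" using cl by (auto simp: D_def corner_lattice_def)
    have "rvec n2 \<bullet> x - of_int (idot n2 p) = D * (rvec (turn f) \<bullet> x - of_int (idot (turn f) p)) + of_int (idot n2 f) * (rvec n1 \<bullet> x - of_int z1)"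
      using inner_decomposition[of n1 f n2 x] inner_decomposition[of n1 f n2 "rvec p"] cl p
      unfolding corner_lattice_def D_def by (simp add: inner_rvec algebra_simps)
    moreover have "D * 1 \<le> D * (rvec (turn f) \<bullet> x - of_int (idot (turn f) p))"
      using D x by (intro mult_left_mono) auto
    moreover have "0 \<le> of_int (idot n2 f) * (rvec n1 \<bullet> x - of_int z1)"
      using a x by (intro mult_nonpos_nonpos) auto
    ultimately show False using x D unfolding slack_def by linarith
  qed
next
  assume emp: "halfplane n1 (of_int z1) \<inter> halfplane n2 z2 \<inter> split_upper p f = {}"
  show "idot n2 f \<le> 0"
  proof (rule ccontr)
    assume "\<not> idot n2 f \<le> 0"
    then have a: "idot n2 f > 0" by simp
    let ?j = "tilt_steps n1 n2 z2 p f"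
    define r where "r = p + turn n1 - (?j + 1) *s f"
    have f: "idot n1 f = 1" using cl by (simp add: corner_lattice_def)
    have "idot n1 r \<le> z1" using tilt_steps_pos[OF cl a] by (simp add: r_def idot_simps p f)
    moreover have "of_int (idot n2 r) \<le> z2"
      using tilt_steps_bounds(2)[OF a, of n1 z2 p] by (simp add: r_def idot_simps slack_def width_def algebra_simps)
    moreover have "idot (turn f) r = idot (turn f) p + 1"
      by (simp add: r_def idot_simps idot_turn_turn idot_turn_self f)
    ultimately have "rvec r \<in> halfplane n1 (of_int z1) \<inter> halfplane n2 z2 \<inter> split_upper p f"
      by (simp add: split_upper_def inner_rvec)
    then show False using emp by blast
  qed
qed

text \<open>All lattice points on the boundary of the upper side are
  \<open>p + turn n1 - i *s f\<close>, and membership in the cone reads \<open>i \<ge> 0\<close> and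
  \<open>i * a \<ge> D - \<sigma>\<close>. Hence the gap is between \<open>j + 1\<close> and
  \<open>j\<close>.\<close>

lemma lattice_gap_split_iff:
  assumes cl: "corner_lattice n1 n2 z2 p f" and p: "idot n1 p = z1" and a: "idot n2 f > 0"
  shows "lattice_gap (frontier (split_upper p f)) (halfplane n1 (of_int z1) \<inter> halfplane n2 z2) x y \<longleftrightarrow>
    x = rvec (p + turn n1 - (tilt_steps n1 n2 z2 p f + 1) *s f) \<and>
    y = rvec (p + turn n1 - tilt_steps n1 n2 z2 p f *s f)"
proof -
  let ?j = "tilt_steps n1 n2 z2 p f" and ?q = "p + turn n1"
  have f: "idot n1 f = 1" using cl by (simp add: corner_lattice_def)
  have f0: "f \<noteq> 0" using f by (auto simp: idot_def)
  have w: "primitive (turn f)" by (rule primitive_if_idot_1[of _ "turn n1"]) (simp add: idot_turn_turn f)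
  have fr: "rvec r \<in> frontier (split_upper p f) \<longleftrightarrow> idot (turn f) r = idot (turn f) p + 1" for r
    unfolding frontier_split_upper[OF f0] by (simp add: inner_rvec; linarith)
  have wq: "idot (turn f) (?q - i *s f) = idot (turn f) p + 1" for i
    by (simp add: idot_simps idot_turn_turn idot_turn_self f)
  define E where "E = of_int (width n1 n2) - slack n2 z2 p"
  have E0: "E > 0" using cl by (auto simp: E_def corner_lattice_def)
  have C: "rvec (?q - i *s f) \<in> halfplane n1 (of_int z1) \<inter> halfplane n2 z2 \<longleftrightarrow> 0 \<le> i \<and> E \<le> of_int (i * idot n2 f)" for i
    by (auto simp: idot_simps p f E_def slack_def width_def)
  note jb = tilt_steps_bounds[OF a, of n1 z2 p, folded E_def]
  show ?thesis
  proof
    assume "lattice_gap (frontier (split_upper p f)) (halfplane n1 (of_int z1) \<inter> halfplane n2 z2) x y"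
    then obtain x1 y1 where xy: "x = rvec x1" "y = rvec y1" "idot (turn f) x1 = idot (turn f) p + 1"
       "idot (turn f) y1 = idot (turn f) p + 1" "rvec x1 \<in> halfplane n1 (of_int z1) \<inter> halfplane n2 z2"
       "rvec y1 \<notin> halfplane n1 (of_int z1) \<inter> halfplane n2 z2" "open_segment (rvec x1) (rvec y1) \<inter> int_pts = {}"
    proof -
      assume gap: "lattice_gap (frontier (split_upper p f)) (halfplane n1 (of_int z1) \<inter> halfplane n2 z2) x y"
      then obtain x1 y1 where "x = rvec x1" "y = rvec y1" unfolding lattice_gap_def int_pts_eq by blast
      with gap fr[of x1] fr[of y1] that[of x1 y1] show thesis unfolding lattice_gap_def by simp
    qed
    have ex: "\<exists>i. r = ?q - i *s f" if "idot (turn f) r = idot (turn f) p + 1" for r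
    proof -
      have "idot (turn f) ?q = idot (turn f) r" using that by (simp add: idot_simps idot_turn_turn f)
      then obtain t where "r = ?q + t *s (- f)" using lattice_line[OF w] unfolding turn_turn by metis
      then have "r = ?q - t *s f" by (simp add: vec_eq_2)
      then show ?thesis by blast
    qed
    obtain i i' where i: "x1 = ?q - i *s f" "y1 = ?q - i' *s f" using ex xy by metis
    have "y1 = x1 + (i - i') *s f" using i by (simp add: vec_eq_2 algebra_simps)
    moreover have "i \<noteq> i'" using i xy by auto
    ultimately have ii: "i - i' = 1 \<or> i - i' = -1" using open_segment_lattice_free_step[of x1 "i - i'" f] xy(7) f0 by auto
    have i1: "0 \<le> i" "E \<le> of_int (i * idot n2 f)" using C[of i] xy(5) i by auto
    have i2: "i' < 0 \<or> of_int (i' * idot n2 f) < E" using C[of i'] xy(6) i by auto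
    have lt: "i' < i"
    proof (rule ccontr)
      assume "\<not> i' < i"
      then have le: "i \<le> i'" by simp
      then have "of_int (i' * idot n2 f) < E" using i1 i2 by linarith
      moreover have "i * idot n2 f \<le> i' * idot n2 f" using le a by (intro mult_right_mono) auto
      ultimately show False using i1 by linarith
    qed
    then have i3: "i = i' + 1" using ii by linarith
    have "i > 0" using i1 E0 a by (cases "i = 0") auto
    then have "of_int (i' * idot n2 f) < E" using i2 i3 by auto
    then have "i' = ?j" using i1 i3 unfolding E_def by (intro tilt_steps_unique[OF a]) auto
    then show "x = rvec (?q - (?j + 1) *s f) \<and> y = rvec (?q - ?j *s f)" using i i3 xy by simp
  next
    assume xy: "x = rvec (?q - (?j + 1) *s f) \<and> y = rvec (?q - ?j *s f)"
    have "x \<in> halfplane n1 (of_int z1) \<inter> halfplane n2 z2" using xy C[of "?j + 1"] jb tilt_steps_pos[OF cl a] by simp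
    moreover have "y \<notin> halfplane n1 (of_int z1) \<inter> halfplane n2 z2" using xy C[of ?j] jb by simp
    moreover have "open_segment (rvec (?q - (?j + 1) *s f)) (rvec (?q - ?j *s f)) \<inter> int_pts = {}"
      by (rule open_segment_lattice_free[of n1]) (simp add: idot_simps f)
    moreover have "x \<in> frontier (split_upper p f)" "y \<in> frontier (split_upper p f)"
      using xy fr[of "?q - (?j + 1) *s f"] fr[of "?q - ?j *s f"] wq[of ?j] wq[of "?j + 1"]
      by (simp_all only:)
    ultimately show "lattice_gap (frontier (split_upper p f)) (halfplane n1 (of_int z1) \<inter> halfplane n2 z2) x y"
      using xy unfolding lattice_gap_def by auto
  qed
qed

lemma tilt_normal_idots:
  assumes "idot n1 f = 1"
  shows "idot (n1 + j *s turn f) f = 1" "idot (n1 + j *s turn f) (turn n1 - j *s f) = 0"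
  using assms by (simp_all add: idot_simps idot_turn_self idot_turn_turn algebra_simps)

text \<open>Existence of a tilt, needed for progress. The only inequality with content is validity
  of the split cut.\<close>

lemma is_tilt_tilt_plane:
  assumes n1: "primitive n1" and cl: "corner_lattice n1 n2 z2 p f" and p: "idot n1 p = z1"
  shows "is_tilt (halfplane n1 (of_int z1)) (halfplane n2 z2) (tilt_plane n1 n2 z2 p f)"
proof -
  let ?C = "halfplane n1 (of_int z1) \<inter> halfplane n2 z2"
  let ?L = "{x. rvec n1 \<bullet> x = of_int (z1 - 1)}"
  let ?W0 = "halfplane (turn f) (of_int (idot (turn f) p))" and ?W1 = "split_upper p f"
  have f: "idot n1 f = 1" and D: "width n1 n2 > 0" using cl by (auto simp: corner_lattice_def)
  have f0: "f \<noteq> 0" using f by (auto simp: idot_def)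
  then have wr0: "rvec (turn f) \<noteq> 0" by (auto simp: rvec_arith)
  then have w0: "turn f \<noteq> 0" by auto
  have n0: "n1 \<noteq> 0" using primitive_nonzero n1 by blast
  have hl: "hat_line (halfplane n1 (of_int z1)) ?L" by (simp only: hat_line_iff[OF n1])
  have g1: "lattice_gap (frontier (halfplane n1 (of_int z1))) ?C (rvec p) (rvec (p + turn n1))"
    unfolding frontier_halfplane[OF n0] lattice_gap_line_iff[OF n1 D order_refl]
    using p cl unfolding corner_lattice_def by blast
  have g2: "lattice_gap ?L ?C (rvec (p - f)) (rvec (p - f + turn n1))"
  proof -
    have "idot n1 (p - f) = z1 - 1" "0 \<le> slack n2 z2 (p - f)" "slack n2 z2 (p - f) < of_int (width n1 n2)"
      using p cl unfolding corner_lattice_def slack_def by (simp_all add: idot_simps)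
    moreover have "z1 - 1 \<le> z1" by simp
    ultimately show ?thesis using lattice_gap_line_iff[OF n1 D] by blast
  qed
  have sd: "split_disjunction ?W0 ?W1" unfolding split_disjunction_def split_upper_def
    by (intro exI[of _ "turn f"] exI[of _ "idot (turn f) p"] conjI w0 refl)
  have fr0: "frontier ?W0 = affine hull {rvec p, rvec (p - f)}" unfolding frontier_halfplane[OF w0]
    using wr0 f0 by (intro affine_hull_2_eq_line[symmetric]) (simp_all add: inner_rvec idot_simps idot_turn_self)
  have fr1: "frontier ?W1 = affine hull {rvec (p + turn n1), rvec (p - f + turn n1)}"
    unfolding frontier_split_upper[OF f0]
    using wr0 f0 f
    by (intro affine_hull_2_eq_line[symmetric]) (simp_all add: inner_rvec idot_simps idot_turn_self idot_turn_turn)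
  let ?T = "tilt_plane n1 n2 z2 p f"
  have "if ?C \<inter> ?W1 = {} then ?T = ?W0
        else \<exists>x' y'. lattice_gap (frontier ?W1) ?C x' y' \<and> split_cut ?C ?W0 ?W1 ?T \<and>
               rvec p \<in> frontier ?T \<and> y' \<in> frontier ?T"
  proof (cases "idot n2 f \<le> 0")
    case True
    then show ?thesis using cone_inter_split_upper_empty_iff[OF cl p]
      by (simp add: tilt_plane_def tilt_normal_def)
  next
    case False
    then have a: "idot n2 f > 0" by simp
    define j where "j = tilt_steps n1 n2 z2 p f"
    define n where "n = n1 + j *s turn f"
    have T: "?T = halfplane n (of_int (idot n p))" using a by (simp add: tilt_plane_def tilt_normal_def n_def j_def)
    have nf: "idot n f = 1" unfolding n_def using tilt_normal_idots[OF f] by blast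
    then have nn: "n \<noteq> 0" by (auto simp: idot_def)
    have frT: "frontier ?T = {x. rvec n \<bullet> x = of_int (idot n p)}" unfolding T frontier_halfplane[OF nn] ..
    have j1: "j \<ge> 1" unfolding j_def by (rule tilt_steps_pos[OF cl a])
    have nx: "rvec n \<bullet> x = rvec n1 \<bullet> x + of_int j * (rvec (turn f) \<bullet> x)" for x
      unfolding n_def rvec_arith(1,4) by (simp add: inner_add_left)
    \<comment> \<open>With \<open>X\<close> and \<open>W\<close> as defined next, the claim is
      \<open>X + j * W \<le> 0\<close>. On \<open>W0\<close> both terms are nonpositive. On
      \<open>W1\<close> the second inequality of the cone gives
      \<open>\<alpha> * X \<le> \<sigma> - D * W\<close>, and with
      \<open>j * \<alpha> \<le> D - \<sigma>\<close> there remains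
      \<open>\<sigma> * (1 - W)\<close>, which is nonpositive.\<close>
    have ineq: "x \<in> ?T" if "x \<in> ?C" "x \<in> ?W0 \<or> x \<in> ?W1" for x
    proof -
      define X where "X = rvec n1 \<bullet> x - of_int z1"
      define W where "W = rvec (turn f) \<bullet> x - of_int (idot (turn f) p)"
      define E where "E = of_int (width n1 n2) - slack n2 z2 p"
      define \<alpha> where "\<alpha> = real_of_int (idot n2 f)"
      have X: "X \<le> 0" using that by (auto simp: X_def halfplane_def)
      have "rvec n2 \<bullet> x - of_int (idot n2 p) = of_int (width n1 n2) * W + \<alpha> * X"
        using inner_decomposition[of n1 f n2 x] inner_decomposition[of n1 f n2 "rvec p"] f p
        unfolding X_def W_def \<alpha>_def by (simp add: inner_rvec algebra_simps)
      moreover have "rvec n2 \<bullet> x \<le> z2" using that by (auto simp: halfplane_def)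
      ultimately have N: "of_int (width n1 n2) * W + \<alpha> * X \<le> slack n2 z2 p" unfolding slack_def by simp
      have jE: "of_int j * \<alpha> \<le> E" using tilt_steps_bounds(1)[OF a, of n1 z2 p] by (simp add: j_def E_def \<alpha>_def)
      have \<alpha>0: "\<alpha> > 0" using a by (simp add: \<alpha>_def)
      have "X + of_int j * W \<le> 0" using that(2)
      proof
        assume "x \<in> ?W0"
        then have "W \<le> 0" by (simp add: W_def halfplane_def)
        then have "of_int j * W \<le> 0" using j1 by (intro mult_nonneg_nonpos) auto
        then show ?thesis using X by simp
      next
        assume "x \<in> ?W1"
        then have W1: "W \<ge> 1" by (simp add: W_def split_upper_def)
        have s0: "slack n2 z2 p \<ge> 0" using cl by (simp add: corner_lattice_def)
        have "of_int j * \<alpha> * W \<le> E * W" using jE W1 by (intro mult_right_mono) auto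
        moreover have "slack n2 z2 p * 1 \<le> slack n2 z2 p * W" using s0 W1 by (intro mult_left_mono) auto
        ultimately have "\<alpha> * (X + of_int j * W) \<le> 0" using N unfolding E_def by (simp add: algebra_simps)
        then show ?thesis using \<alpha>0 by (simp add: mult_le_0_iff)
      qed
      moreover have "real_of_int (idot n p) = of_int z1 + of_int j * of_int (idot (turn f) p)"
        using p by (simp add: n_def idot_simps)
      ultimately show ?thesis unfolding T halfplane_def X_def W_def
        by (simp add: nx algebra_simps)
    qed
    have "convex ?T" unfolding T halfplane_def by (rule convex_halfspace_le)
    then have "convex hull ((?C \<inter> ?W0) \<union> (?C \<inter> ?W1)) \<subseteq> ?T" using ineq by (intro hull_minimal) auto
    moreover have "rat_halfplane ?T" unfolding T rat_halfplane_def
      by (intro exI[of _ n] exI[of _ "real_of_int (idot n p)"] conjI nn Rats_of_int refl)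
    ultimately have sc: "split_cut ?C ?W0 ?W1 ?T" using sd unfolding split_cut_def by blast
    have gp: "lattice_gap (frontier ?W1) ?C (rvec (p + turn n1 - (j + 1) *s f)) (rvec (p + turn n1 - j *s f))"
      using lattice_gap_split_iff[OF cl p a] unfolding j_def by blast
    have "idot n (p + turn n1 - j *s f) = idot n p"
      using tilt_normal_idots(2)[OF f, of j] unfolding n_def[symmetric] by (simp add: idot_simps)
    then have "rvec (p + turn n1 - j *s f) \<in> frontier ?T" unfolding frT by (simp add: inner_rvec)
    moreover have "rvec p \<in> frontier ?T" unfolding frT by (simp add: inner_rvec)
    moreover have "?C \<inter> ?W1 \<noteq> {}" using cone_inter_split_upper_empty_iff[OF cl p] a by simp
    ultimately show ?thesis using sc gp by (simp only: if_False) blast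
  qed
  then show ?thesis unfolding is_tilt_def Let_def
    by (intro exI[of _ ?L] exI[of _ "rvec p"] exI[of _ "rvec (p + turn n1)"] exI[of _ "rvec (p - f)"]
        exI[of _ "rvec (p - f + turn n1)"] exI[of _ ?W0] exI[of _ ?W1] conjI hl g1 g2 sd fr0 fr1)
qed

text \<open>Uniqueness, needed because every run has to be bounded: the points are determined by
  their levels and slacks, and the split disjunction by its values at these points.\<close>

lemma is_tilt_imp_tilt_plane:
  assumes tilt: "is_tilt (halfplane n1 (of_int z1)) (halfplane n2 z2) T"
    and n1: "primitive n1" and D: "width n1 n2 > 0"
  shows "\<exists>p f. idot n1 p = z1 \<and> corner_lattice n1 n2 z2 p f \<and> T = tilt_plane n1 n2 z2 p f"
proof -
  let ?C = "halfplane n1 (of_int z1) \<inter> halfplane n2 z2"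
  obtain L pr qr xr yr W0 W1 where t: "hat_line (halfplane n1 (of_int z1)) L"
      "lattice_gap (frontier (halfplane n1 (of_int z1))) ?C pr qr" "lattice_gap L ?C xr yr"
      "split_disjunction W0 W1" "frontier W0 = affine hull {pr, xr}" "frontier W1 = affine hull {qr, yr}"
      "if ?C \<inter> W1 = {} then T = W0
        else \<exists>x' y'. lattice_gap (frontier W1) ?C x' y' \<and> split_cut ?C W0 W1 T \<and>
               pr \<in> frontier T \<and> y' \<in> frontier T"
    using tilt unfolding is_tilt_def Let_def by blast
  have n0: "n1 \<noteq> 0" using primitive_nonzero n1 by blast
  obtain p where p: "pr = rvec p" "qr = rvec (p + turn n1)" "idot n1 p = z1"
     "0 \<le> slack n2 z2 p" "slack n2 z2 p < of_int (width n1 n2)"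
    using t(2) lattice_gap_line_iff[OF n1 D, of z1 z1] unfolding frontier_halfplane[OF n0] by auto
  have L: "L = {x. rvec n1 \<bullet> x = of_int (z1 - 1)}" using t(1) hat_line_iff[OF n1] by blast
  obtain x where x: "xr = rvec x" "yr = rvec (x + turn n1)" "idot n1 x = z1 - 1"
     "0 \<le> slack n2 z2 x" "slack n2 z2 x < of_int (width n1 n2)"
    using t(3) lattice_gap_line_iff[OF n1 D, of "z1 - 1" z1] unfolding L by auto
  define f where "f = p - x"
  have f: "idot n1 f = 1" using p x by (simp add: f_def idot_simps)
  have f0: "f \<noteq> 0" using f by (auto simp: idot_def)
  then have wr0: "rvec (turn f) \<noteq> 0" by (auto simp: rvec_arith)
  then have w0: "turn f \<noteq> 0" by auto
  have cl: "corner_lattice n1 n2 z2 p f" unfolding corner_lattice_def using p x f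
    by (simp add: slack_def f_def idot_simps)
  obtain a k where a: "a \<noteq> 0" "W0 = halfplane a (of_int k)" "W1 = {x. rvec a \<bullet> x \<ge> of_int (k + 1)}"
    using t(4) unfolding split_disjunction_def by blast
  have "frontier W1 = {x. rvec a \<bullet> x = of_int (k + 1)}" unfolding a(3) using a(1) by (simp add: frontier_halfspace_ge)
  moreover have "qr \<in> affine hull {qr, yr}" by (simp add: hull_inc)
  ultimately have "qr \<in> {x. rvec a \<bullet> x = of_int (k + 1)}" using t(6) by simp
  then have aq: "idot a (p + turn n1) = k + 1" unfolding p(2) by (simp add: inner_rvec; linarith)
  have "frontier W0 = {x. rvec a \<bullet> x = of_int k}" unfolding a(2) using a(1) by (simp add: frontier_halfplane)
  moreover have "pr \<in> affine hull {pr, xr}" "xr \<in> affine hull {pr, xr}" by (simp_all add: hull_inc)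
  ultimately have "pr \<in> {x. rvec a \<bullet> x = of_int k}" "xr \<in> {x. rvec a \<bullet> x = of_int k}" using t(5) by simp_all
  then have ap: "idot a p = k" and ax: "idot a x = k" by (auto simp: inner_rvec p x)
  \<comment> \<open>Value 1 on \<open>turn n1\<close> and 0 on \<open>f\<close> identify the normal
    as \<open>turn f\<close> by duality.\<close>
  have "width n1 a = 1" using aq ap unfolding width_def by (simp add: idot_simps)
  moreover have "idot a f = 0" using ap ax by (simp add: f_def idot_simps)
  ultimately have aw: "a = turn f" using normal_decomposition[OF f, of a] by (simp add: vec_eq_2)
  have W0: "W0 = halfplane (turn f) (of_int (idot (turn f) p))" using a(2) aw ap by simp
  have W1: "W1 = split_upper p f" unfolding split_upper_def using a(3) aw ap by simp
  have "T = tilt_plane n1 n2 z2 p f"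
  proof (cases "idot n2 f \<le> 0")
    case True
    then show ?thesis using cone_inter_split_upper_empty_iff[OF cl p(3)] t(7) W0 W1
      by (simp add: tilt_plane_def tilt_normal_def)
  next
    case False
    then have a0: "idot n2 f > 0" by simp
    define j where "j = tilt_steps n1 n2 z2 p f"
    define n where "n = n1 + j *s turn f"
    have TP: "tilt_plane n1 n2 z2 p f = halfplane n (of_int (idot n p))"
      using a0 by (simp add: tilt_plane_def tilt_normal_def n_def j_def)
    have "?C \<inter> W1 \<noteq> {}" unfolding W1 using cone_inter_split_upper_empty_iff[OF cl p(3)] False by simp
    then obtain x' y' where xy: "lattice_gap (frontier W1) ?C x' y'" "split_cut ?C W0 W1 T"
               "pr \<in> frontier T" "y' \<in> frontier T" using t(7) by auto
    have x': "x' = rvec (p + turn n1 - (j + 1) *s f)" and y': "y' = rvec (p + turn n1 - j *s f)"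
      using xy(1) lattice_gap_split_iff[OF cl p(3) a0] unfolding W1 j_def by auto
    obtain b z where b: "b \<noteq> 0" "T = halfplane b z" using xy(2) unfolding split_cut_def rat_halfplane_def by blast
    have bp: "of_int (idot b p) = z" and by': "of_int (idot b (p + turn n1 - j *s f)) = z"
      using xy(3,4) unfolding b(2) frontier_halfplane[OF b(1)] p(1) y' by (auto simp: inner_rvec)
    have "idot b (p + turn n1 - j *s f) = idot b p" using bp by' by (metis of_int_eq_iff)
    then have bd: "idot b (turn n1 - j *s f) = 0" by (simp add: idot_simps)
    have nd: "idot n (turn n1 - j *s f) = 0" and nf: "idot n f = 1"
      unfolding n_def using tilt_normal_idots[OF f] by blast+
    have n_nz: "n \<noteq> 0" using nf by (auto simp: idot_def)
    have d0: "turn n1 - j *s f \<noteq> 0"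
    proof
      assume "turn n1 - j *s f = 0"
      then have "idot (turn f) (turn n1 - j *s f) = 0" by (simp add: idot_def)
      then show False by (simp add: idot_simps idot_turn_turn idot_turn_self f)
    qed
    have "rvec (turn n1 - j *s f) \<noteq> 0" "rvec n \<bullet> rvec (turn n1 - j *s f) = 0"
        "rvec b \<bullet> rvec (turn n1 - j *s f) = 0" "rvec n \<noteq> 0"
      using d0 nd bd n_nz by (simp_all add: inner_rvec)
    then obtain s where s: "rvec b = s *\<^sub>R rvec n" using parallel_normals by blast
    \<comment> \<open>The line through the pivot and \<open>y'\<close> fixes the normal up to a
      scalar; that \<open>x'\<close> lies on the valid side makes the scalar positive.\<close>
    have "x' \<in> ?C \<inter> W1"
    proof -
      have "x' \<in> frontier W1 \<inter> ?C" using xy(1) by (auto simp: lattice_gap_def)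
      then show ?thesis unfolding W1 frontier_split_upper[OF f0] by (auto simp: split_upper_def)
    qed
    moreover have "?C \<inter> W0 \<union> ?C \<inter> W1 \<subseteq> T"
      using xy(2) hull_subset[of "?C \<inter> W0 \<union> ?C \<inter> W1" convex] unfolding split_cut_def
      by (meson order_trans)
    ultimately have "x' \<in> T" by auto
    then have "idot b (p + turn n1 - (j + 1) *s f) \<le> idot b p" unfolding b(2) x' using bp by simp
    then have bf: "idot b f \<ge> 0" using bd by (simp add: idot_simps algebra_simps)
    have bs: "real_of_int (idot b f) = s" using s nf by (metis inner_rvec inner_scaleR_left mult.right_neutral of_int_1)
    then have "s \<noteq> 0" using s b(1) by auto
    then have s0: "s > 0" using bf bs by linarith
    have "z = s * of_int (idot n p)" using bp s by (metis inner_rvec inner_scaleR_left)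
    then show ?thesis unfolding TP b(2) halfplane_def s using s0 by auto
  qed
  then show ?thesis using cl p(3) by blast
qed

section \<open>Determinant, size and position of the tilted normal\<close>

lemma width_tilt:
  assumes "idot n1 f = 1"
  shows "width (turn f) n2 = - idot n2 f" "width (n1 + j *s turn f) n2 = width n1 n2 - j * idot n2 f"
  by (simp_all add: width_def idot_def algebra_simps)

lemma width_cross2: "cross2 (rvec a) (rvec b) = - of_int (width a b)"
  by (simp add: cross2_def width_def idot_def algebra_simps)

lemma tilt_normal_primitive:
  assumes "idot n1 f = 1" shows "primitive (tilt_normal n1 n2 z2 p f)"
proof (cases "idot n2 f \<le> 0")
  case True
  have "idot (turn f) (turn n1) = 1" using assms by (simp add: idot_turn_turn idot_def mult.commute)
  then show ?thesis using True primitive_if_idot_1 by (simp add: tilt_normal_def)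
next
  case False
  then show ?thesis
    using primitive_if_idot_1[OF tilt_normal_idots(1)[OF assms, of "tilt_steps n1 n2 z2 p f"]]
    by (simp add: tilt_normal_def)
qed

text \<open>This is membership in the triangle with vertices 0, \<open>n1\<close>,
  \<open>n2\<close>, multiplied by the width. For a Chvatal cut the coefficient sum is
  \<open>1 - a\<close>, at most \<open>D\<close> since \<open>- a \<le> \<sigma> < D\<close>; for a
  split cut it is \<open>D - j * a + j\<close>, at most \<open>D\<close> since
  \<open>a \<ge> 1\<close>.\<close>

lemma tilt_normal_conv:
  assumes cl: "corner_lattice n1 n2 z2 p f"
  shows "\<exists>\<alpha> \<beta>. 0 \<le> \<alpha> \<and> 0 < \<beta> \<and> \<alpha> + \<beta> \<le> width n1 n2 \<and>
    width n1 n2 *s tilt_normal n1 n2 z2 p f = \<alpha> *s n1 + \<beta> *s n2"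
proof -
  let ?D = "width n1 n2" and ?a = "idot n2 f"
  have f: "idot n1 f = 1" using cl by (simp add: corner_lattice_def)
  have dec: "?D *s turn f = n2 - ?a *s n1" using normal_decomposition[OF f, of n2] by (simp add: vec_eq_2)
  show ?thesis
  proof (cases "?a \<le> 0")
    case True
    have "- real_of_int ?a < of_int ?D" using cl unfolding corner_lattice_def by linarith
    then have "- ?a + 1 \<le> ?D" by linarith
    moreover have "?D *s tilt_normal n1 n2 z2 p f = (- ?a) *s n1 + 1 *s n2"
      using True dec by (simp add: tilt_normal_def vec_eq_2)
    ultimately show ?thesis using True by (intro exI[of _ "- ?a"] exI[of _ 1]) auto
  next
    case False
    then have a: "?a > 0" by simp
    define j where "j = tilt_steps n1 n2 z2 p f"
    have j1: "j \<ge> 1" unfolding j_def by (rule tilt_steps_pos[OF cl a])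
    have "real_of_int (j * ?a) < of_int ?D - slack n2 z2 p" using tilt_steps_bounds(1)[OF a] by (simp only: j_def)
    then have "real_of_int (j * ?a) < of_int ?D" using cl unfolding corner_lattice_def by linarith
    then have ja: "j * ?a < ?D" by linarith
    have "j * 1 \<le> j * ?a" using j1 a by (intro mult_left_mono) auto
    then have "(?D - j * ?a) + j \<le> ?D" by simp
    moreover have "?D *s tilt_normal n1 n2 z2 p f = (?D - j * ?a) *s n1 + j *s n2"
    proof -
      have "?D *s tilt_normal n1 n2 z2 p f = ?D *s n1 + j *s (?D *s turn f)"
        using a by (simp add: tilt_normal_def j_def vec_eq_2 algebra_simps)
      then show ?thesis unfolding dec by (simp add: vec_eq_2 algebra_simps)
    qed
    ultimately show ?thesis using ja j1 by (intro exI[of _ "?D - j * ?a"] exI[of _ j]) auto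
  qed
qed

lemma tilt_normal_bound:
  assumes cl: "corner_lattice n1 n2 z2 p f" and "\<bar>n1 $ i\<bar> \<le> M" "\<bar>n2 $ i\<bar> \<le> M"
  shows "\<bar>tilt_normal n1 n2 z2 p f $ i\<bar> \<le> M"
proof -
  obtain \<alpha> \<beta> where ab: "0 \<le> \<alpha>" "0 < \<beta>" "\<alpha> + \<beta> \<le> width n1 n2"
    "width n1 n2 *s tilt_normal n1 n2 z2 p f = \<alpha> *s n1 + \<beta> *s n2" using tilt_normal_conv[OF cl] by blast
  have M: "M \<ge> 0" using assms(2) by linarith
  have "width n1 n2 * \<bar>tilt_normal n1 n2 z2 p f $ i\<bar> = \<bar>(width n1 n2 *s tilt_normal n1 n2 z2 p f) $ i\<bar>"
    unfolding vector_smult_component using ab(1-3) by (simp add: abs_mult)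
  also have "\<dots> = \<bar>\<alpha> * n1 $ i + \<beta> * n2 $ i\<bar>" unfolding ab(4) by simp
  also have "\<dots> \<le> \<alpha> * \<bar>n1 $ i\<bar> + \<beta> * \<bar>n2 $ i\<bar>"
    using ab abs_triangle_ineq[of "\<alpha> * n1 $ i" "\<beta> * n2 $ i"] by (simp add: abs_mult)
  also have "\<dots> \<le> \<alpha> * M + \<beta> * M" using ab assms by (intro add_mono mult_left_mono) auto
  also have "\<dots> = (\<alpha> + \<beta>) * M" by (simp add: algebra_simps)
  also have "\<dots> \<le> width n1 n2 * M" using ab M by (intro mult_right_mono) auto
  finally show ?thesis using ab by simp
qed

text \<open>The signs follow from \<open>\<alpha> \<ge> 0\<close> and \<open>\<beta> > 0\<close> in
  the combination above. In particular the apex violates the cut by \<open>\<beta>\<close> times the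
  slack of the pivot, divided by the width.\<close>

lemma tilt_normal_cone:
  assumes cl: "corner_lattice n1 n2 z2 p f"
  shows "cross2 (rvec n1) (rvec (tilt_normal n1 n2 z2 p f)) < 0"
    "cross2 (rvec (tilt_normal n1 n2 z2 p f)) (rvec n2) \<le> 0"
    "rvec n1 \<bullet> v = of_int (idot n1 p) \<Longrightarrow> rvec n2 \<bullet> v = z2 \<Longrightarrow> slack n2 z2 p > 0 \<Longrightarrow>
      rvec (tilt_normal n1 n2 z2 p f) \<bullet> v > of_int (idot (tilt_normal n1 n2 z2 p f) p)"
proof -
  let ?t = "tilt_normal n1 n2 z2 p f" and ?D = "real_of_int (width n1 n2)"
  obtain \<alpha> \<beta> where ab: "0 \<le> \<alpha>" "0 < \<beta>" "\<alpha> + \<beta> \<le> width n1 n2"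
    "width n1 n2 *s ?t = \<alpha> *s n1 + \<beta> *s n2" using tilt_normal_conv[OF cl] by blast
  have D: "?D > 0" using ab by simp
  have t: "?D *\<^sub>R rvec ?t = of_int \<alpha> *\<^sub>R rvec n1 + of_int \<beta> *\<^sub>R rvec n2"
    using arg_cong[OF ab(4), of rvec] by (simp only: rvec_arith)
  have "?D * cross2 (rvec n1) (rvec ?t) = cross2 (rvec n1) (?D *\<^sub>R rvec ?t)" by (simp add: cross2_def algebra_simps)
  also have "\<dots> = of_int \<beta> * cross2 (rvec n1) (rvec n2)" unfolding t by (simp add: cross2_def algebra_simps)
  also have "\<dots> = - (of_int \<beta> * ?D)" by (simp add: width_cross2)
  finally have "?D * cross2 (rvec n1) (rvec ?t) = - (of_int \<beta> * ?D)" .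
  then have "?D * cross2 (rvec n1) (rvec ?t) = ?D * - of_int \<beta>" by simp
  then have "cross2 (rvec n1) (rvec ?t) = - of_int \<beta>" using D mult_cancel_left by (metis less_irrefl)
  then show "cross2 (rvec n1) (rvec ?t) < 0" using ab by simp
  have "?D * cross2 (rvec ?t) (rvec n2) = cross2 (?D *\<^sub>R rvec ?t) (rvec n2)" by (simp add: cross2_def algebra_simps)
  also have "\<dots> = of_int \<alpha> * cross2 (rvec n1) (rvec n2)" unfolding t by (simp add: cross2_def algebra_simps)
  also have "\<dots> = - (of_int \<alpha> * ?D)" by (simp add: width_cross2)
  finally have "?D * cross2 (rvec ?t) (rvec n2) = ?D * - of_int \<alpha>" by simp
  then have "cross2 (rvec ?t) (rvec n2) = - of_int \<alpha>" using D mult_cancel_left by (metis less_irrefl)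
  then show "cross2 (rvec ?t) (rvec n2) \<le> 0" using ab by simp
  assume v: "rvec n1 \<bullet> v = of_int (idot n1 p)" "rvec n2 \<bullet> v = z2" "slack n2 z2 p > 0"
  have "?D * (rvec ?t \<bullet> (v - rvec p)) = (?D *\<^sub>R rvec ?t) \<bullet> (v - rvec p)" by simp
  also have "\<dots> = of_int \<beta> * slack n2 z2 p"
    unfolding t using v by (simp add: inner_add_left inner_diff_right inner_rvec slack_def algebra_simps)
  finally have "?D * (rvec ?t \<bullet> (v - rvec p)) > 0" using ab v by simp
  then have "rvec ?t \<bullet> (v - rvec p) > 0" using D by (simp add: zero_less_mult_iff)
  then show "rvec ?t \<bullet> v > of_int (idot ?t p)" by (simp add: inner_diff_right inner_rvec)
qed

text \<open>Successive tilts against the same second half-plane follow the dynamics analysed above.\<close>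

lemma phase_step:
  assumes cl: "corner_lattice n1 n2 z2 p f" and s0: "slack n2 z2 p > 0" and a0: "idot n2 f \<noteq> 0"
    and n: "n = tilt_normal n1 n2 z2 p f" and p': "idot n p' = idot n p"
    and cl': "corner_lattice n n2 z2 p' f'" and s0': "slack n2 z2 p' > 0"
    and \<Lambda>: "log 2 (of_int (width n1 n2)) \<le> \<Lambda>"
  shows "phase_potential \<Lambda> (width n n2) (slack n2 z2 p') (idot n2 f') + 1
    \<le> phase_potential \<Lambda> (width n1 n2) (slack n2 z2 p) (idot n2 f)"
proof -
  let ?D = "width n1 n2" and ?a = "idot n2 f" and ?D' = "width n n2" and ?a' = "idot n2 f'"
  have f: "idot n1 f = 1" using cl by (simp add: corner_lattice_def)
  have n': "primitive n" unfolding n by (rule tilt_normal_primitive[OF f])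
  have f': "idot n f' = 1" using cl' by (simp add: corner_lattice_def)
  obtain s where s: "p' = p + s *s turn n" using lattice_line[OF n'] p' by metis
  have sl: "slack n2 z2 p' = slack n2 z2 p + of_int ((- s) * ?D')"
    unfolding s slack_def width_def by (simp add: idot_simps)
  note cl'' = cl'[unfolded corner_lattice_def] and clu = cl[unfolded corner_lattice_def]
  show ?thesis
  proof (cases "?a > 0")
    case True
    let ?j = "tilt_steps n1 n2 z2 p f"
    have nj: "n = n1 + ?j *s turn f" using True by (simp add: n tilt_normal_def)
    have D': "?D' = ?D - ?j * ?a" unfolding nj by (rule width_tilt(2)[OF f])
    have "idot n f = 1" unfolding nj by (rule tilt_normal_idots(1)[OF f])
    then obtain t where t: "f' = f + t *s turn n" using lattice_line[OF n'] f' by metis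
    have a': "?a' = ?a + t * ?D'" unfolding t width_def by (simp add: idot_simps)
    note jb = tilt_steps_bounds[OF True, of n1 z2 p]
    have lt: "slack n2 z2 p < of_int ?D'" using jb(1) D' by simp
    \<comment> \<open>A split cut keeps the pivot: old and new slack lie in one period of length
      \<open>D'\<close> and differ by a multiple of it.\<close>
    have "s = 0"
    proof (rule ccontr)
      assume "s \<noteq> 0"
      then consider "s \<ge> 1" | "s \<le> -1" by linarith
      then show False
      proof cases
        case 1
        have "1 * ?D' \<le> s * ?D'" using 1 cl'' by (intro mult_right_mono) auto
        then have "(-s) * ?D' \<le> - ?D'" by simp
        then have "of_int ((-s) * ?D') \<le> - real_of_int ?D'" by linarith
        then show False using sl lt s0' by linarith
      next
        case 2
        have "s * ?D' \<le> (-1) * ?D'" using 2 cl'' by (intro mult_right_mono) auto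
        then have "(-s) * ?D' \<ge> ?D'" by simp
        then have "of_int ((-s) * ?D') \<ge> real_of_int ?D'" by linarith
        then show False using sl s0 cl'' by linarith
      qed
    qed
    then have ss: "slack n2 z2 p' = slack n2 z2 p" using sl by simp
    have "\<Lambda> \<ge> 0"
    proof -
      have "?D > 0" using clu by linarith
      then have "0 \<le> log 2 (real_of_int ?D)" by (subst zero_le_log_cancel_iff) auto
      then show ?thesis using \<Lambda> by linarith
    qed
    then show ?thesis unfolding ss
      using cl'' clu ss by (intro split_phase_drop[OF s0 True jb D' a']) auto
  next
    case False
    then have a: "?a < 0" using a0 by simp
    have nw: "n = turn f" using a by (simp add: n tilt_normal_def)
    have D': "?D' = - ?a" unfolding nw by (rule width_tilt(1)[OF f])
    \<comment> \<open>For \<open>n = turn f\<close> the old direction \<open>turn n1\<close> already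
      satisfies the normalisation of the new \<open>f\<close>. So \<open>D\<close> becomes the value
      to be reduced modulo \<open>D'\<close>, as in the Euclidean algorithm.\<close>
    have "idot n (turn n1) = 1" unfolding nw using f by (simp add: idot_turn_turn idot_def mult.commute)
    then obtain t where t: "f' = turn n1 + t *s turn n" using lattice_line[OF n'] f' by metis
    have a': "?a' = ?D + t * ?D'" unfolding t width_def by (simp add: idot_simps)
    show ?thesis
      using cl'' clu s0' by (intro chvatal_phase_drop[OF s0 _ a _ D' sl _ _ a' _ _ \<Lambda>]) auto
  qed
qed

section \<open>Edges of planar convex sets\<close>

text \<open>Two distinct points on a supporting line replace the dimension of a face, so that
  survival of an edge under a cut can be tested with points. For two-dimensional convex sets the
  pairs with rational level are the facet half-planes.\<close>

definition edges :: "(real^2) set \<Rightarrow> ((int^2) \<times> real) set" where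
  "edges Q = {(a, z). primitive a \<and> (\<forall>x\<in>Q. rvec a \<bullet> x \<le> z) \<and>
     (\<exists>x\<in>Q. \<exists>y\<in>Q. x \<noteq> y \<and> rvec a \<bullet> x = z \<and> rvec a \<bullet> y = z)}"

lemma edgesD:
  assumes "(a, z) \<in> edges Q"
  shows "primitive a" "rvec a \<noteq> 0" "\<And>x. x \<in> Q \<Longrightarrow> rvec a \<bullet> x \<le> z"
    "\<And>v. \<exists>x\<in>Q. x \<noteq> v \<and> rvec a \<bullet> x = z"
  using assms primitive_nonzero unfolding edges_def by (auto, metis)

lemma edge_facet:
  assumes Q: "convex Q" "aff_dim Q = 2" and az: "(a, z) \<in> edges Q"
  shows "(Q \<inter> {x. rvec a \<bullet> x = z}) facet_of Q"
proof -
  have an: "a \<noteq> 0" using primitive_nonzero edgesD(1)[OF az] by blast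
  obtain x y where xy: "x \<in> Q" "y \<in> Q" "x \<noteq> y" "rvec a \<bullet> x = z" "rvec a \<bullet> y = z"
    using az by (auto simp: edges_def)
  have "{x, y} \<subseteq> Q \<inter> {x. rvec a \<bullet> x = z}" using xy by auto
  then have "aff_dim {x, y} \<le> aff_dim (Q \<inter> {x. rvec a \<bullet> x = z})" by (rule aff_dim_subset)
  moreover have "aff_dim {x, y} = 1" using xy by (simp add: aff_dim_2)
  moreover have "aff_dim (Q \<inter> {x. rvec a \<bullet> x = z}) \<le> aff_dim {x. rvec a \<bullet> x = z}" by (rule aff_dim_subset) auto
  moreover have "aff_dim {x. rvec a \<bullet> x = z} = 1" using an by (simp add: aff_dim_hyperplane)
  ultimately have "aff_dim (Q \<inter> {x. rvec a \<bullet> x = z}) = 1" by simp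
  moreover have "(Q \<inter> {x. rvec a \<bullet> x = z}) face_of Q"
    using face_of_Int_supporting_hyperplane_le[OF Q(1)] edgesD(3)[OF az] by blast
  moreover have "Q \<inter> {x. rvec a \<bullet> x = z} \<noteq> {}" using xy by auto
  ultimately show ?thesis unfolding facet_of_def using Q(2) by simp
qed

lemma facet_halfplane_iff_edge:
  assumes Q: "convex Q" "aff_dim Q = 2"
  shows "facet_halfplane Q H \<longleftrightarrow> (\<exists>a z. (a, z) \<in> edges Q \<and> z \<in> \<rat> \<and> H = halfplane a z)"
proof
  assume H: "facet_halfplane Q H"
  then obtain a0 z0 where a0: "a0 \<noteq> 0" "z0 \<in> \<rat>" "H = halfplane a0 z0"
    unfolding facet_halfplane_def rat_halfplane_def by blast
  obtain a g where a: "primitive a" "g > 0" "halfplane a0 z0 = halfplane a (z0 / of_int g)"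
    using halfplane_primitive[OF a0(1)] by blast
  let ?z = "z0 / of_int g" and ?F = "Q \<inter> frontier H"
  have an: "a \<noteq> 0" using primitive_nonzero a(1) by blast
  have fr: "frontier H = {x. rvec a \<bullet> x = ?z}" unfolding a0(3) a(3) frontier_halfplane[OF an] ..
  have "?F facet_of Q" using H by (simp add: facet_halfplane_def)
  then have F: "aff_dim ?F = 1" "?F \<noteq> {}" using Q by (auto simp: facet_of_def)
  then obtain x where x: "x \<in> ?F" by blast
  have "?F \<noteq> {x}" using F by (metis aff_dim_sing zero_neq_one)
  then obtain y where "y \<in> ?F" "x \<noteq> y" using x by blast
  then have "\<exists>x\<in>Q. \<exists>y\<in>Q. x \<noteq> y \<and> rvec a \<bullet> x = ?z \<and> rvec a \<bullet> y = ?z" using x unfolding fr by blast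
  moreover have "\<forall>x\<in>Q. rvec a \<bullet> x \<le> ?z"
    using H unfolding facet_halfplane_def a0(3) a(3) by (auto simp: halfplane_def)
  ultimately have "(a, ?z) \<in> edges Q" using a(1) by (simp add: edges_def)
  moreover have "?z \<in> \<rat>" using a0 by simp
  ultimately show "\<exists>a z. (a, z) \<in> edges Q \<and> z \<in> \<rat> \<and> H = halfplane a z" using a0(3) a(3) by blast
next
  assume "\<exists>a z. (a, z) \<in> edges Q \<and> z \<in> \<rat> \<and> H = halfplane a z"
  then obtain a z where az: "(a, z) \<in> edges Q" "z \<in> \<rat>" "H = halfplane a z" by blast
  have an: "a \<noteq> 0" using primitive_nonzero edgesD(1)[OF az(1)] by blast
  have fr: "frontier H = {x. rvec a \<bullet> x = z}" unfolding az(3) frontier_halfplane[OF an] ..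
  have "(Q \<inter> frontier H) facet_of Q" unfolding fr by (rule edge_facet[OF Q az(1)])
  moreover have "Q \<subseteq> H" using edgesD(3)[OF az(1)] by (auto simp: az(3) halfplane_def)
  moreover have "rat_halfplane H" unfolding rat_halfplane_def az(3)
    by (intro exI[of _ a] exI[of _ z] conjI an az(2) refl)
  ultimately show "facet_halfplane Q H" by (simp add: facet_halfplane_def)
qed

section \<open>Edges before and after a cut\<close>

lemma interior_strict:
  fixes a :: "real^2"
  assumes "i \<in> interior Q" "\<And>x. x \<in> Q \<Longrightarrow> a \<bullet> x \<le> z" "a \<noteq> 0"
  shows "a \<bullet> i < z"
proof -
  have "interior Q \<subseteq> interior {x. a \<bullet> x \<le> z}" using assms by (intro interior_mono) auto
  then show ?thesis using assms by auto
qed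

lemma convex_local_point:
  fixes t :: "real^2"
  assumes "convex Q" "e \<in> Q" "y \<in> Q" "t \<bullet> e < s"
  shows "\<exists>\<epsilon>. 0 < \<epsilon> \<and> \<epsilon> \<le> 1 \<and> e + \<epsilon> *\<^sub>R (y - e) \<in> Q \<and> t \<bullet> (e + \<epsilon> *\<^sub>R (y - e)) \<le> s"
proof -
  define k where "k = \<bar>t \<bullet> (y - e)\<bar> + 1"
  define \<epsilon> where "\<epsilon> = min 1 ((s - t \<bullet> e) / k)"
  have k: "k > 0" by (simp add: k_def)
  have \<epsilon>: "0 < \<epsilon>" "\<epsilon> \<le> 1" "\<epsilon> \<le> (s - t \<bullet> e) / k" using assms k by (auto simp: \<epsilon>_def)
  have "e + \<epsilon> *\<^sub>R (y - e) = (1 - \<epsilon>) *\<^sub>R e + \<epsilon> *\<^sub>R y" by (simp add: algebra_simps)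
  then have "e + \<epsilon> *\<^sub>R (y - e) \<in> Q" using assms \<epsilon> by (simp add: convexD)
  moreover have "\<epsilon> * (t \<bullet> (y - e)) \<le> \<epsilon> * k" using \<epsilon> unfolding k_def by (intro mult_left_mono) auto
  moreover have "\<epsilon> * k \<le> s - t \<bullet> e" using \<epsilon>(3) k by (simp add: pos_le_divide_eq)
  ultimately have "e + \<epsilon> *\<^sub>R (y - e) \<in> Q" "t \<bullet> (e + \<epsilon> *\<^sub>R (y - e)) \<le> s"
    unfolding inner_add_right inner_scaleR_right by linarith+
  then show ?thesis using \<epsilon> by blast
qed

lemma convex_crossing:
  fixes t :: "real^2"
  assumes "convex Q" "u \<in> Q" "v \<in> Q" "t \<bullet> u \<le> s" "t \<bullet> v > s"
  shows "\<exists>\<epsilon>. 0 \<le> \<epsilon> \<and> \<epsilon> < 1 \<and> (1 - \<epsilon>) *\<^sub>R u + \<epsilon> *\<^sub>R v \<in> Q \<and> t \<bullet> ((1 - \<epsilon>) *\<^sub>R u + \<epsilon> *\<^sub>R v) = s"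
proof -
  define \<epsilon> where "\<epsilon> = (s - t \<bullet> u) / (t \<bullet> v - t \<bullet> u)"
  have \<epsilon>: "0 \<le> \<epsilon>" "\<epsilon> < 1" "\<epsilon> * (t \<bullet> v - t \<bullet> u) = s - t \<bullet> u" using assms by (auto simp: \<epsilon>_def)
  have "(1 - \<epsilon>) *\<^sub>R u + \<epsilon> *\<^sub>R v \<in> Q" using assms \<epsilon> by (simp add: convexD)
  moreover have "t \<bullet> ((1 - \<epsilon>) *\<^sub>R u + \<epsilon> *\<^sub>R v) = s" using \<epsilon>(3) by (simp add: inner_add_right algebra_simps)
  ultimately show ?thesis using \<epsilon> by blast
qed

text \<open>The normals are parallel; an interior point excludes opposite directions, primitivity
  excludes scaling.\<close>

lemma edges_unique:
  assumes int: "interior Q \<noteq> {}" and a: "primitive a" "\<And>x. x \<in> Q \<Longrightarrow> rvec a \<bullet> x \<le> z"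
    and t: "primitive t" "\<And>x. x \<in> Q \<Longrightarrow> rvec t \<bullet> x \<le> s"
    and xy: "x \<noteq> y" "rvec a \<bullet> x = z" "rvec a \<bullet> y = z" "rvec t \<bullet> x = s" "rvec t \<bullet> y = s"
  shows "(a, z) = (t, s)"
proof -
  have an: "rvec a \<noteq> 0" and tn: "rvec t \<noteq> 0" using a t primitive_nonzero by auto
  have "x - y \<noteq> 0" "rvec a \<bullet> (x - y) = 0" "rvec t \<bullet> (x - y) = 0" using xy by (auto simp: inner_diff_right)
  then obtain \<mu> where \<mu>: "rvec t = \<mu> *\<^sub>R rvec a" using parallel_normals an by blast
  then have s: "s = \<mu> * z" using xy by simp
  obtain i where i: "i \<in> interior Q" using int by blast
  have "rvec a \<bullet> i < z" using interior_strict[OF i a(2) an] .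
  moreover have "rvec t \<bullet> i < s" using interior_strict[OF i t(2) tn] .
  moreover have "\<mu> * z \<le> \<mu> * (rvec a \<bullet> i)" if "\<mu> \<le> 0" "rvec a \<bullet> i < z"
    using that by (intro mult_left_mono_neg) auto
  ultimately have "\<mu> > 0" unfolding \<mu> s by force
  then have "t = a" "\<mu> = 1" using primitive_parallel[OF a(1) t(1) _ \<mu>] by auto
  then show ?thesis using s by simp
qed

text \<open>If one of two points of a new edge lies strictly inside the cutting half-plane, a small
  move from it towards any point of \<open>Q\<close> stays in the cut set, so the edge supports all
  of \<open>Q\<close>. Otherwise both lie on the cutting line.\<close>

lemma edges_Int_halfplane:
  assumes Q: "convex Q" and t: "primitive t" and int: "interior (Q \<inter> halfplane t s) \<noteq> {}"
  shows "edges (Q \<inter> halfplane t s) \<subseteq> insert (t, s) (edges Q)"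
proof
  fix az assume "az \<in> edges (Q \<inter> halfplane t s)"
  then obtain a z where az: "az = (a, z)" "(a, z) \<in> edges (Q \<inter> halfplane t s)" by (cases az) auto
  note E = edgesD[OF az(2)]
  obtain x y where xy: "x \<in> Q" "y \<in> Q" "rvec t \<bullet> x \<le> s" "rvec t \<bullet> y \<le> s" "x \<noteq> y" "rvec a \<bullet> x = z" "rvec a \<bullet> y = z"
    using az(2) by (auto simp: edges_def halfplane_def)
  show "az \<in> insert (t, s) (edges Q)"
  proof (cases "rvec t \<bullet> x = s \<and> rvec t \<bullet> y = s")
    case True
    have "(a, z) = (t, s)"
      by (rule edges_unique[OF int E(1) E(3) t _ xy(5-7)]) (use True in \<open>auto simp: halfplane_def\<close>)
    then show ?thesis using az by simp
  next
    case False
    then have "rvec t \<bullet> x < s \<or> rvec t \<bullet> y < s" using xy(3,4) by linarith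
    then obtain e where e: "e \<in> Q" "rvec t \<bullet> e < s" "rvec a \<bullet> e = z" using xy(1,2,6,7) by blast
    have "rvec a \<bullet> w \<le> z" if w: "w \<in> Q" for w
    proof (rule ccontr)
      assume gt: "\<not> rvec a \<bullet> w \<le> z"
      obtain \<epsilon> where \<epsilon>: "0 < \<epsilon>" "e + \<epsilon> *\<^sub>R (w - e) \<in> Q" "rvec t \<bullet> (e + \<epsilon> *\<^sub>R (w - e)) \<le> s"
        using convex_local_point[OF Q e(1) w e(2)] by blast
      then have "e + \<epsilon> *\<^sub>R (w - e) \<in> Q \<inter> halfplane t s" by (simp add: halfplane_def)
      then have "rvec a \<bullet> (e + \<epsilon> *\<^sub>R (w - e)) \<le> z" by (rule E(3))
      then have "\<epsilon> * (rvec a \<bullet> w - z) \<le> 0" using e by (simp add: inner_add_right inner_diff_right)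
      then show False using \<epsilon>(1) gt by (simp add: mult_le_0_iff)
    qed
    then have "(a, z) \<in> edges Q" using E(1) xy unfolding edges_def by blast
    then show ?thesis using az by simp
  qed
qed

text \<open>Two points of the interior ball with the same value of \<open>t\<close>, moved towards
  the removed point \<open>v\<close> by the same proportion, reach the cutting line at distinct
  points.\<close>

lemma cutting_edge:
  assumes Q: "convex Q" and t: "primitive t" and int: "interior (Q \<inter> halfplane t s) \<noteq> {}"
    and v: "v \<in> Q" "rvec t \<bullet> v > s"
  shows "(t, s) \<in> edges (Q \<inter> halfplane t s)"
proof -
  let ?Q' = "Q \<inter> halfplane t s"
  have tn: "rvec t \<noteq> 0" using t primitive_nonzero by auto
  obtain i where i: "i \<in> interior ?Q'" using int by blast
  then obtain e where e: "e > 0" "ball i e \<subseteq> ?Q'" by (meson mem_interior)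
  define i' where "i' = i + (e / 2 / norm (turn (rvec t))) *\<^sub>R turn (rvec t)"
  have "dist i i' < e" using e tn by (simp add: i'_def dist_norm)
  then have i'Q: "i' \<in> ?Q'" using e by auto
  have ii: "i' \<noteq> i" using e tn by (simp add: i'_def)
  have iQ: "i \<in> ?Q'" using i interior_subset by blast
  have ti: "rvec t \<bullet> i' = rvec t \<bullet> i" by (simp add: i'_def inner_add_right)
  obtain \<epsilon> where \<epsilon>: "0 \<le> \<epsilon>" "\<epsilon> < 1" "(1 - \<epsilon>) *\<^sub>R i + \<epsilon> *\<^sub>R v \<in> Q" "rvec t \<bullet> ((1 - \<epsilon>) *\<^sub>R i + \<epsilon> *\<^sub>R v) = s"
    using convex_crossing[OF Q _ v(1) _ v(2), of i] iQ by (auto simp: halfplane_def)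
  have "(1 - \<epsilon>) *\<^sub>R i' + \<epsilon> *\<^sub>R v \<in> Q" using Q i'Q v \<epsilon> by (intro convexD) auto
  moreover have "rvec t \<bullet> ((1 - \<epsilon>) *\<^sub>R i' + \<epsilon> *\<^sub>R v) = s" using \<epsilon>(4) ti by (simp add: inner_add_right)
  moreover have "(1 - \<epsilon>) *\<^sub>R i' + \<epsilon> *\<^sub>R v \<noteq> (1 - \<epsilon>) *\<^sub>R i + \<epsilon> *\<^sub>R v" using ii \<epsilon> by simp
  ultimately have "\<exists>x\<in>?Q'. \<exists>y\<in>?Q'. x \<noteq> y \<and> rvec t \<bullet> x = s \<and> rvec t \<bullet> y = s" using \<epsilon>(3,4)
    unfolding halfplane_def
    by (intro bexI[of _ "(1 - \<epsilon>) *\<^sub>R i' + \<epsilon> *\<^sub>R v"] bexI[of _ "(1 - \<epsilon>) *\<^sub>R i + \<epsilon> *\<^sub>R v"]) auto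
  then show ?thesis using t by (simp add: edges_def halfplane_def)
qed

section \<open>Corners\<close>

text \<open>\<open>d\<close> will be the rotated objective. The strict turns put it inside the cone
  of the two normals, so \<open>v\<close> is its unique maximiser on \<open>Q\<close>, and no third
  edge passes through \<open>v\<close>.\<close>

definition corner :: "real^2 \<Rightarrow> (real^2) set \<Rightarrow> real^2 \<Rightarrow> int^2 \<Rightarrow> real \<Rightarrow> int^2 \<Rightarrow> real \<Rightarrow> bool" where
  "corner d Q v a za b zb \<longleftrightarrow> (a, za) \<in> edges Q \<and> (b, zb) \<in> edges Q \<and> v \<in> Q \<and>
     rvec a \<bullet> v = za \<and> rvec b \<bullet> v = zb \<and>
     cross2 (rvec a) d < 0 \<and> cross2 d (rvec b) < 0 \<and> cross2 (rvec a) (rvec b) < 0"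

lemma cross2_cone:
  assumes "cross2 a b < 0"
  obtains \<alpha> \<beta> where "d = \<alpha> *\<^sub>R a + \<beta> *\<^sub>R b" "\<alpha> = cross2 d b / cross2 a b" "\<beta> = cross2 a d / cross2 a b"
    "\<alpha> > 0 \<longleftrightarrow> cross2 d b < 0" "\<beta> > 0 \<longleftrightarrow> cross2 a d < 0" "\<alpha> \<ge> 0 \<longleftrightarrow> cross2 d b \<le> 0" "\<beta> \<ge> 0 \<longleftrightarrow> cross2 a d \<le> 0"
  using cramer_2[of a b d] assms by (force simp: zero_less_divide_iff zero_le_divide_iff)

lemma cross2_lines_unique:
  assumes "cross2 a b \<noteq> 0" "a \<bullet> x = a \<bullet> y" "b \<bullet> x = b \<bullet> y"
  shows "x = y"
proof (rule ccontr)
  assume "x \<noteq> y"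
  have an: "a \<noteq> 0" using assms(1) by (auto simp: cross2_def)
  have "x - y \<noteq> 0" "a \<bullet> (x - y) = 0" "b \<bullet> (x - y) = 0" using assms \<open>x \<noteq> y\<close> by (auto simp: inner_diff_right)
  then obtain \<mu> where "b = \<mu> *\<^sub>R a" using parallel_normals an by blast
  then show False using assms(1) by (simp add: cross2_def)
qed

lemma cone_apex_maximal:
  assumes c: "cross2 a d < 0" "cross2 d b < 0" "cross2 a b < 0"
    and x: "a \<bullet> x \<le> a \<bullet> v" "b \<bullet> x \<le> b \<bullet> v"
  shows "d \<bullet> x \<le> d \<bullet> v" "d \<bullet> x = d \<bullet> v \<Longrightarrow> x = v"
proof -
  obtain \<alpha> \<beta> where d: "d = \<alpha> *\<^sub>R a + \<beta> *\<^sub>R b" "\<alpha> > 0" "\<beta> > 0"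
    using cross2_cone[OF c(3), of d] c by metis
  have 1: "\<alpha> * (a \<bullet> x) \<le> \<alpha> * (a \<bullet> v)" "\<beta> * (b \<bullet> x) \<le> \<beta> * (b \<bullet> v)" using d x by auto
  then show "d \<bullet> x \<le> d \<bullet> v" unfolding d by (simp add: inner_add_left)
  assume "d \<bullet> x = d \<bullet> v"
  then have "\<alpha> * (a \<bullet> x) + \<beta> * (b \<bullet> x) = \<alpha> * (a \<bullet> v) + \<beta> * (b \<bullet> v)" unfolding d by (simp add: inner_add_left)
  then have "\<alpha> * (a \<bullet> x) = \<alpha> * (a \<bullet> v)" "\<beta> * (b \<bullet> x) = \<beta> * (b \<bullet> v)" using 1 by linarith+
  then show "x = v" using d c by (intro cross2_lines_unique[of a b]) auto
qed

lemma cross2_swap: "cross2 a b = - cross2 b a" by (simp add: cross2_def)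

text \<open>A third tight normal is a combination of \<open>a\<close> and \<open>b\<close>. Testing
  it at a second point of each edge gives nonnegative coefficients, and two positive ones would
  leave no point but \<open>v\<close> on the third edge.\<close>

lemma corner_edge_cases:
  assumes C: "corner d Q v a za b zb" and t: "(t, s) \<in> edges Q" "rvec t \<bullet> v = s"
  shows "(t, s) = (a, za) \<or> (t, s) = (b, zb)"
proof -
  have c: "cross2 (rvec a) (rvec b) < 0" and ea: "(a, za) \<in> edges Q" and eb: "(b, zb) \<in> edges Q"
    and va: "rvec a \<bullet> v = za" and vb: "rvec b \<bullet> v = zb"
    using C by (auto simp: corner_def)
  obtain \<alpha> \<beta> where ab: "rvec t = \<alpha> *\<^sub>R rvec a + \<beta> *\<^sub>R rvec b" using cross2_cone[OF c] by metis
  have tv: "rvec t \<bullet> x - s = \<alpha> * (rvec a \<bullet> x - za) + \<beta> * (rvec b \<bullet> x - zb)" for x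
    using t(2) va vb unfolding ab by (simp add: inner_add_left algebra_simps)
  obtain u1 where u1: "u1 \<in> Q" "u1 \<noteq> v" "rvec a \<bullet> u1 = za" using edgesD(4)[OF ea] by blast
  obtain u2 where u2: "u2 \<in> Q" "u2 \<noteq> v" "rvec b \<bullet> u2 = zb" using edgesD(4)[OF eb] by blast
  obtain u where u: "u \<in> Q" "u \<noteq> v" "rvec t \<bullet> u = s" using edgesD(4)[OF t(1)] by blast
  have uniq: "x = v" if "rvec a \<bullet> x = za" "rvec b \<bullet> x = zb" for x
    using cross2_lines_unique[of "rvec a" "rvec b" x v] c va vb that by auto
  have b1: "rvec b \<bullet> u1 < zb" using edgesD(3)[OF eb u1(1)] uniq u1 by force
  have a2: "rvec a \<bullet> u2 < za" using edgesD(3)[OF ea u2(1)] uniq u2 by force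
  have "\<beta> * (rvec b \<bullet> u1 - zb) \<le> 0" using tv[of u1] edgesD(3)[OF t(1) u1(1)] u1 by simp
  then have \<beta>: "\<beta> \<ge> 0" using b1 by (simp add: mult_le_0_iff)
  have "\<alpha> * (rvec a \<bullet> u2 - za) \<le> 0" using tv[of u2] edgesD(3)[OF t(1) u2(1)] u2 by simp
  then have \<alpha>: "\<alpha> \<ge> 0" using a2 by (simp add: mult_le_0_iff)
  have tn: "rvec t \<noteq> 0" using edgesD(2)[OF t(1)] .
  have "\<alpha> = 0 \<or> \<beta> = 0"
  proof (rule ccontr)
    assume "\<not> ?thesis"
    then have pos: "\<alpha> > 0" "\<beta> > 0" using \<alpha> \<beta> by auto
    have le: "rvec a \<bullet> u \<le> za" "rvec b \<bullet> u \<le> zb" using edgesD(3) ea eb u by auto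
    have "\<alpha> * (rvec a \<bullet> u - za) \<le> 0" "\<beta> * (rvec b \<bullet> u - zb) \<le> 0" using pos le by (auto simp: mult_le_0_iff)
    moreover have "\<alpha> * (rvec a \<bullet> u - za) + \<beta> * (rvec b \<bullet> u - zb) = 0" using tv[of u] u by simp
    ultimately have "\<alpha> * (rvec a \<bullet> u - za) = 0" "\<beta> * (rvec b \<bullet> u - zb) = 0" by linarith+
    then show False using pos uniq u by auto
  qed
  then show ?thesis
  proof
    assume "\<alpha> = 0"
    then have "rvec t = \<beta> *\<^sub>R rvec b" "\<beta> > 0" using ab tn \<beta> by (auto simp: less_le)
    then have "t = b" using primitive_parallel edgesD(1) eb t by blast
    then show ?thesis using t vb by simp
  next
    assume "\<beta> = 0"
    then have "rvec t = \<alpha> *\<^sub>R rvec a" "\<alpha> > 0" using ab tn \<alpha> by (auto simp: less_le)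
    then have "t = a" using primitive_parallel edgesD(1) ea t by blast
    then show ?thesis using t va by simp
  qed
qed

text \<open>The new vertex lies on the cutting line, since otherwise a step towards the removed
  vertex would improve \<open>d\<close>. A cut on the left of \<open>d\<close> is thus the left edge
  there. If moreover \<open>b\<close> survives, the point where it meets the cutting line maximises
  \<open>d\<close> over the cone of \<open>t\<close> and \<open>b\<close>; so it is the new vertex,
  and \<open>b\<close> is its right edge.\<close>

lemma cut_corner_cases:
  assumes Q: "convex Q" and C: "corner d Q v a za b zb" and t: "primitive t" and tv: "rvec t \<bullet> v > s"
    and int: "interior (Q \<inter> halfplane t s) \<noteq> {}"
    and tc: "cross2 (rvec t) (rvec b) \<le> 0" "cross2 (rvec a) (rvec t) \<le> 0"
    and C': "corner d (Q \<inter> halfplane t s) v' a' za' b' zb'"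
  shows "cross2 (rvec t) d < 0 \<Longrightarrow> (a', za') = (t, s)"
    "cross2 (rvec t) d < 0 \<Longrightarrow> (b', zb') = (b, zb) \<or> (b, zb) \<notin> edges (Q \<inter> halfplane t s)"
proof -
  let ?Q' = "Q \<inter> halfplane t s"
  have c: "cross2 (rvec a) (rvec b) < 0" "cross2 (rvec a) d < 0" "cross2 d (rvec b) < 0"
    and ea: "(a, za) \<in> edges Q" and eb: "(b, zb) \<in> edges Q"
    and va: "rvec a \<bullet> v = za" and vb: "rvec b \<bullet> v = zb" and vQ: "v \<in> Q"
    using C by (auto simp: corner_def)
  have c': "cross2 (rvec a') (rvec b') < 0" "cross2 (rvec a') d < 0" "cross2 d (rvec b') < 0"
    and ea': "(a', za') \<in> edges ?Q'" and eb': "(b', zb') \<in> edges ?Q'"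
    and va': "rvec a' \<bullet> v' = za'" and vb': "rvec b' \<bullet> v' = zb'" and vQ': "v' \<in> ?Q'"
    using C' by (auto simp: corner_def)
  have max': "d \<bullet> x \<le> d \<bullet> v'" "d \<bullet> x = d \<bullet> v' \<Longrightarrow> x = v'" if "x \<in> ?Q'" for x
    using cone_apex_maximal[OF c'(2,3,1), of x v'] edgesD(3)[OF ea' that] edgesD(3)[OF eb' that] va' vb' by auto
  have te: "(t, s) \<in> edges ?Q'" by (rule cutting_edge[OF Q t int vQ tv])
  have tv': "rvec t \<bullet> v' = s"
  proof (rule ccontr)
    assume ne: "rvec t \<bullet> v' \<noteq> s"
    have "rvec t \<bullet> v' \<le> s" "v' \<in> Q" using vQ' by (auto simp: halfplane_def)
    then have lt: "rvec t \<bullet> v' < s" using ne by simp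
    obtain \<epsilon> where \<epsilon>: "0 < \<epsilon>" "v' + \<epsilon> *\<^sub>R (v - v') \<in> Q" "rvec t \<bullet> (v' + \<epsilon> *\<^sub>R (v - v')) \<le> s"
      using convex_local_point[OF Q \<open>v' \<in> Q\<close> vQ lt] by blast
    then have "d \<bullet> (v' + \<epsilon> *\<^sub>R (v - v')) \<le> d \<bullet> v'" by (intro max'(1)) (simp add: halfplane_def)
    then have "\<epsilon> * (d \<bullet> v - d \<bullet> v') \<le> 0" by (simp add: inner_add_right inner_diff_right)
    then have "d \<bullet> v \<le> d \<bullet> v'" using \<epsilon> by (simp add: mult_le_0_iff)
    moreover have "d \<bullet> v' \<le> d \<bullet> v" "d \<bullet> v' = d \<bullet> v \<Longrightarrow> v' = v"
      using cone_apex_maximal[OF c(2,3,1), of v' v] edgesD(3)[OF ea \<open>v' \<in> Q\<close>] edgesD(3)[OF eb \<open>v' \<in> Q\<close>] va vb by auto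
    ultimately have "v' = v" by simp
    then show False using lt tv by simp
  qed
  have cases: "(t, s) = (a', za') \<or> (t, s) = (b', zb')" by (rule corner_edge_cases[OF C' te tv'])
  assume td: "cross2 (rvec t) d < 0"
  show a': "(a', za') = (t, s)" using cases c'(3) td cross2_swap[of d "rvec b'"] by auto
  show "(b', zb') = (b, zb) \<or> (b, zb) \<notin> edges ?Q'"
  proof (rule disjCI)
    assume "\<not> (b, zb) \<notin> edges ?Q'"
    then have eb'': "(b, zb) \<in> edges ?Q'" by simp
    obtain u where u: "u \<in> ?Q'" "rvec b \<bullet> u = zb" using edgesD(4)[OF eb''] by blast
    obtain \<epsilon> where \<epsilon>: "0 \<le> \<epsilon>" "\<epsilon> < 1" "(1 - \<epsilon>) *\<^sub>R u + \<epsilon> *\<^sub>R v \<in> Q" "rvec t \<bullet> ((1 - \<epsilon>) *\<^sub>R u + \<epsilon> *\<^sub>R v) = s"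
      using convex_crossing[OF Q _ vQ _ tv, of u] u by (auto simp: halfplane_def)
    define w where "w = (1 - \<epsilon>) *\<^sub>R u + \<epsilon> *\<^sub>R v"
    have w: "w \<in> ?Q'" "rvec t \<bullet> w = s" using \<epsilon> by (auto simp: w_def halfplane_def)
    have wb: "rvec b \<bullet> w = zb" using u vb by (simp add: w_def inner_add_right algebra_simps)
    have tb: "cross2 (rvec t) (rvec b) < 0"
    proof (rule ccontr)
      assume "\<not> ?thesis"
      then have z: "cross2 (rvec t) (rvec b) = 0" using tc by simp
      obtain \<alpha> \<beta> where ab: "rvec t = \<alpha> *\<^sub>R rvec a + \<beta> *\<^sub>R rvec b" "\<alpha> = cross2 (rvec t) (rvec b) / cross2 (rvec a) (rvec b)"
        "\<beta> \<ge> 0" using cross2_cone[OF c(1), of "rvec t"] tc by metis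
      then have "rvec t = \<beta> *\<^sub>R rvec b" using z by simp
      then have "cross2 (rvec t) d = - \<beta> * cross2 d (rvec b)" by (simp add: cross2_def algebra_simps)
      moreover have "\<beta> * cross2 d (rvec b) \<le> 0" using c(3) ab(3) by (intro mult_nonneg_nonpos) auto
      ultimately show False using td by simp
    qed
    have "d \<bullet> v' \<le> d \<bullet> w" "d \<bullet> v' = d \<bullet> w \<Longrightarrow> v' = w"
      using cone_apex_maximal[OF td c(3) tb, of v' w] tv' w wb edgesD(3)[OF eb'' vQ'] by auto
    then have "v' = w" using max'(1)[OF w(1)] by linarith
    then have "rvec b \<bullet> v' = zb" using wb by simp
    then have "(b, zb) = (a', za') \<or> (b, zb) = (b', zb')" by (rule corner_edge_cases[OF C' eb''])
    moreover have "b \<noteq> t" using tb by (auto simp: cross2_def)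
    ultimately show "(b', zb') = (b, zb)" using a' by auto
  qed
qed

lemma surviving_edge_crossing:
  assumes Q: "convex Q" and v: "v \<in> Q" "rvec a \<bullet> v = za" "rvec t \<bullet> v > s"
    and e: "(a, za) \<in> edges (Q \<inter> halfplane t s)"
  shows "\<exists>w\<in>Q. rvec a \<bullet> w = za \<and> rvec t \<bullet> w = s"
proof -
  obtain u where u: "u \<in> Q \<inter> halfplane t s" "rvec a \<bullet> u = za" using edgesD(4)[OF e] by blast
  obtain \<epsilon> where \<epsilon>: "0 \<le> \<epsilon>" "\<epsilon> < 1" "(1 - \<epsilon>) *\<^sub>R u + \<epsilon> *\<^sub>R v \<in> Q" "rvec t \<bullet> ((1 - \<epsilon>) *\<^sub>R u + \<epsilon> *\<^sub>R v) = s"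
    using convex_crossing[OF Q _ v(1) _ v(3), of u] u by (auto simp: halfplane_def)
  moreover have "rvec a \<bullet> ((1 - \<epsilon>) *\<^sub>R u + \<epsilon> *\<^sub>R v) = za" using u v by (simp add: inner_add_right algebra_simps)
  ultimately show ?thesis by blast
qed

section \<open>A potential for the algorithm\<close>

definition left_edges :: "real^2 \<Rightarrow> (real^2) set \<Rightarrow> ((int^2) \<times> real) set" where
  "left_edges d Q = {(a, z) \<in> edges Q. cross2 (rvec a) d < 0}"

definition right_edges :: "real^2 \<Rightarrow> (real^2) set \<Rightarrow> ((int^2) \<times> real) set" where
  "right_edges d Q = {(a, z) \<in> edges Q. cross2 (rvec a) d > 0}"

definition integral_edge :: "(real^2) set \<Rightarrow> int^2 \<Rightarrow> real \<Rightarrow> bool" where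
  "integral_edge Q a z \<longleftrightarrow> (\<exists>p. rvec p \<in> Q \<and> of_int (idot a p) = z)"

text \<open>Once the edge to be tilted contains an integer point, the optimal vertex never moves to the
  left again, so that the left edges need not be counted. A right edge counts less than a left one
  since a tilt may turn a left edge into a right one.\<close>

definition edge_weight :: "real^2 \<Rightarrow> (real^2) set \<Rightarrow> int^2 \<Rightarrow> real \<Rightarrow> nat" where
  "edge_weight d Q a z =
     (if integral_edge Q a z then 0 else 2 * card (left_edges d Q)) + card (right_edges d Q)"

text \<open>While the right-hand side is fractional there is no pivot; a full phase and the
  strengthening cut are reserved.\<close>

definition phase_budget :: "real \<Rightarrow> int^2 \<Rightarrow> real \<Rightarrow> int^2 \<Rightarrow> real \<Rightarrow> int^2 \<Rightarrow> int^2 \<Rightarrow> real" where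
  "phase_budget L a za b zb p f =
     (if za \<in> \<int> then phase_potential (3 * L) (width a b) (slack b zb p) (idot b f) else 64 * L\<^sup>2 + 1)"

text \<open>The factor is the largest reserve \<open>64 * L\<^sup>2 + 1\<close> of a fresh phase
  plus the cut that opens it.\<close>

definition budget :: "real^2 \<Rightarrow> real \<Rightarrow> (real^2) set \<Rightarrow> int^2 \<Rightarrow> real \<Rightarrow> int^2 \<Rightarrow> real \<Rightarrow> int^2 \<Rightarrow> int^2 \<Rightarrow> real" where
  "budget d L Q a za b zb p f =
     (64 * L\<^sup>2 + 2) * real (edge_weight d Q a za) + phase_budget L a za b zb p f"

text \<open>An implication, so that any \<open>p\<close> and \<open>f\<close> will do as long as the
  edge is not strengthened.\<close>

definition corner_data :: "int^2 \<Rightarrow> real \<Rightarrow> int^2 \<Rightarrow> real \<Rightarrow> int^2 \<Rightarrow> int^2 \<Rightarrow> bool" where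
  "corner_data a za b zb p f \<longleftrightarrow>
     (za \<in> \<int> \<longrightarrow> of_int (idot a p) = za \<and> corner_lattice a b zb p f)"

text \<open>With slack 0 the pivot would lie on both boundary lines and be the fractional
  vertex.\<close>

lemma corner_slack_pos:
  assumes C: "corner d Q v a za b zb" and v: "v \<notin> int_pts"
    and p: "of_int (idot a p) = za" "corner_lattice a b zb p f"
  shows "slack b zb p > 0"
proof (rule ccontr)
  assume "\<not> slack b zb p > 0"
  then have "slack b zb p = 0" using p by (auto simp: corner_lattice_def)
  then have "rvec a \<bullet> rvec p = rvec a \<bullet> v" "rvec b \<bullet> rvec p = rvec b \<bullet> v"
    using C p by (auto simp: corner_def slack_def inner_rvec)
  then have "rvec p = v" using C by (intro cross2_lines_unique[of "rvec a" "rvec b"]) (auto simp: corner_def)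
  then show False using v by auto
qed

lemma phase_budget_bounds:
  assumes C: "corner d Q v a za b zb" and v: "v \<notin> int_pts" and p: "corner_data a za b zb p f"
    and L: "L \<ge> 1" "log 2 (of_int (width a b)) \<le> 3 * L"
  shows "0 \<le> phase_budget L a za b zb p f" "phase_budget L a za b zb p f \<le> 64 * L\<^sup>2 + 1"
    "za \<in> \<int> \<Longrightarrow> phase_budget L a za b zb p f \<le> 64 * L\<^sup>2"
proof -
  have "0 \<le> phase_budget L a za b zb p f \<and> phase_budget L a za b zb p f \<le> 64 * L\<^sup>2" if z: "za \<in> \<int>"
  proof -
    have "0 < slack b zb p" using corner_slack_pos[OF C v] p z by (auto simp: corner_data_def)
    then show ?thesis using p z unfolding phase_budget_def corner_data_def corner_lattice_def
      by (simp add: phase_potential_bounds[OF _ _ _ _ L])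
  qed
  then show "0 \<le> phase_budget L a za b zb p f" "phase_budget L a za b zb p f \<le> 64 * L\<^sup>2 + 1"
    "za \<in> \<int> \<Longrightarrow> phase_budget L a za b zb p f \<le> 64 * L\<^sup>2"
    by (cases "za \<in> \<int>"; force simp: phase_budget_def)+
qed

lemma budget_drop:
  assumes "edge_weight d Q' a' za' \<le> edge_weight d Q a za" "phase_budget L a' za' b' zb' p' f' + 1 \<le> phase_budget L a za b zb p f"
  shows "budget d L Q' a' za' b' zb' p' f' + 1 \<le> budget d L Q a za b zb p f"
proof -
  have "(64 * L\<^sup>2 + 2) * real (edge_weight d Q' a' za') \<le> (64 * L\<^sup>2 + 2) * real (edge_weight d Q a za)"
    using assms(1) by (intro mult_left_mono) auto
  then show ?thesis using assms(2) unfolding budget_def by linarith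
qed

lemma budget_drop_weight:
  assumes "edge_weight d Q' a' za' + 1 \<le> edge_weight d Q a za"
    "phase_budget L a' za' b' zb' p' f' \<le> 64 * L\<^sup>2 + 1" "0 \<le> phase_budget L a za b zb p f"
  shows "budget d L Q' a' za' b' zb' p' f' + 1 \<le> budget d L Q a za b zb p f"
proof -
  have "(64 * L\<^sup>2 + 2) * (real (edge_weight d Q' a' za') + 1) \<le> (64 * L\<^sup>2 + 2) * real (edge_weight d Q a za)"
    using assms(1) by (intro mult_left_mono) auto
  then have "(64 * L\<^sup>2 + 2) * real (edge_weight d Q' a' za') + (64 * L\<^sup>2 + 2) \<le> (64 * L\<^sup>2 + 2) * real (edge_weight d Q a za)"
    by (simp add: distrib_left)
  then show ?thesis using assms(2,3) unfolding budget_def by linarith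
qed

section \<open>Every cut lowers the budget by at least one\<close>

lemma finite_left_right_edges:
  assumes "finite (edges Q)" shows "finite (left_edges d Q)" "finite (right_edges d Q)"
  using assms by (auto simp: left_edges_def right_edges_def intro: finite_subset[OF _ assms])

lemma card_insert_Diff_le:
  assumes "finite A" "x \<in> A" "B \<subseteq> insert y (A - {x})"
  shows "card B \<le> card A"
proof -
  have "card B \<le> card (insert y (A - {x}))" using assms by (intro card_mono) auto
  also have "\<dots> \<le> Suc (card (A - {x}))" using assms by (intro card_insert_le_m1) auto
  also have "\<dots> = card A" using assms by (metis card_Suc_Diff1)
  finally show ?thesis .
qed

lemma card_Diff_less:
  assumes "finite A" "x \<in> A" "B \<subseteq> A - {x}"
  shows "card B + 1 \<le> card A"
proof -
  have "card B \<le> card (A - {x})" using assms by (intro card_mono) auto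
  then show ?thesis using assms by (metis Suc_eq_plus1 Suc_le_mono card_Suc_Diff1)
qed

text \<open>The left edge is replaced by a parallel one on the same side, so the weight cannot grow.
  The phase reserve loses at least the unit kept for this cut.\<close>

lemma strengthening_budget_drop:
  assumes Q: "convex Q" and fin: "finite (edges Q)" and C: "corner d Q v a za b zb" and za: "za \<notin> \<int>"
    and Q': "Q' = Q \<inter> halfplane a (of_int \<lfloor>za\<rfloor>)" and int: "interior Q' \<noteq> {}"
    and C': "corner d Q' v' a' za' b' zb'" and v': "v' \<notin> int_pts"
    and L: "L \<ge> 1" "log 2 (of_int (width a' b')) \<le> 3 * L" and p': "corner_data a' za' b' zb' p' f'"
  shows "budget d L Q' a' za' b' zb' p' f' + 1 \<le> budget d L Q a za b zb p f"
proof -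
  have c: "cross2 (rvec a) (rvec b) < 0" "cross2 (rvec a) d < 0" and ea: "(a, za) \<in> edges Q"
    and va: "rvec a \<bullet> v = za" and vQ: "v \<in> Q" using C by (auto simp: corner_def)
  have pa: "primitive a" using edgesD(1)[OF ea] .
  have "za \<noteq> of_int \<lfloor>za\<rfloor>" using za by (metis Ints_of_int)
  then have fl: "of_int \<lfloor>za\<rfloor> < za" using of_int_floor_le[of za] by linarith
  have tv: "rvec a \<bullet> v > of_int \<lfloor>za\<rfloor>" using fl va by simp
  note int' = int[unfolded Q'] and C'' = C'[unfolded Q']
  have a': "(a', za') = (a, of_int \<lfloor>za\<rfloor>)"
    by (rule cut_corner_cases(1)[OF Q C pa tv int' _ _ C'' c(2)]) (use c in \<open>auto simp: cross2_def\<close>)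
  have sub: "edges Q' \<subseteq> insert (a, of_int \<lfloor>za\<rfloor>) (edges Q)" unfolding Q' by (rule edges_Int_halfplane[OF Q pa int'])
  have dead: "(a, za) \<notin> edges Q'"
  proof
    assume "(a, za) \<in> edges Q'"
    then obtain w where "rvec a \<bullet> w = za" "rvec a \<bullet> w = of_int \<lfloor>za\<rfloor>"
      using surviving_edge_crossing[OF Q vQ va tv] unfolding Q' by blast
    then show False using fl by linarith
  qed
  have "\<not> integral_edge Q a za" using za by (auto simp: integral_edge_def)
  then have w: "edge_weight d Q a za = 2 * card (left_edges d Q) + card (right_edges d Q)" by (simp add: edge_weight_def)
  have l: "card (left_edges d Q') \<le> card (left_edges d Q)"
    by (rule card_insert_Diff_le[OF finite_left_right_edges(1)[OF fin], of "(a, za)" _ _ "(a, of_int \<lfloor>za\<rfloor>)"])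
       (use sub dead ea c in \<open>auto simp: left_edges_def\<close>)
  have r: "card (right_edges d Q') \<le> card (right_edges d Q)"
    by (rule card_mono[OF finite_left_right_edges(2)[OF fin]])
       (use sub c in \<open>auto simp: right_edges_def\<close>)
  have "edge_weight d Q' a' za' \<le> edge_weight d Q a za" unfolding w using l r by (simp add: edge_weight_def)
  moreover have "phase_budget L a' za' b' zb' p' f' \<le> 64 * L\<^sup>2"
    using phase_budget_bounds(3)[OF C' v' p' L] a' by simp
  then have "phase_budget L a' za' b' zb' p' f' + 1 \<le> phase_budget L a za b zb p f"
    using za by (simp add: phase_budget_def)
  ultimately show ?thesis by (rule budget_drop)
qed

text \<open>The pivot has the least nonnegative slack among the integer points of its line, so it
  lies between any integer point of the edge and the vertex, where the slack is 0.\<close>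

lemma pivot_in_convex:
  assumes Q: "convex Q" and C: "corner d Q v a za b zb"
    and p: "of_int (idot a p) = za" "corner_lattice a b zb p f" and u: "rvec u \<in> Q" "of_int (idot a u) = za"
  shows "rvec p \<in> Q"
proof -
  have pa: "primitive a" using C edgesD(1) by (auto simp: corner_def)
  have bv: "rvec b \<bullet> v = zb" and av: "rvec a \<bullet> v = za" and c: "cross2 (rvec a) (rvec b) < 0"
    and bu: "of_int (idot b u) \<le> zb" and vQ: "v \<in> Q"
    using C edgesD(3) u by (auto simp: corner_def inner_rvec[symmetric])
  have "idot a u = idot a p" using p u by (metis of_int_eq_iff)
  then obtain k where k: "p = u + k *s turn a" using lattice_line[OF pa] by metis
  have D: "width a b > 0" using p by (auto simp: corner_lattice_def)
  have bp: "real_of_int (idot b p) = of_int (idot b u) + of_int k * of_int (width a b)"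
    unfolding k width_def by (simp add: idot_simps)
  have k0: "k \<ge> 0"
  proof (rule ccontr)
    assume "\<not> k \<ge> 0"
    then have "k * width a b \<le> -1 * width a b" using D by (intro mult_right_mono) auto
    then have "real_of_int k * of_int (width a b) \<le> - of_int (width a b)"
      by (metis mult_minus1 of_int_le_iff of_int_minus of_int_mult)
    then show False using bp bu p by (auto simp: corner_lattice_def slack_def)
  qed
  define \<epsilon> where "\<epsilon> = (of_int (idot b p) - of_int (idot b u)) / (zb - of_int (idot b u))"
  have le: "of_int (idot b u) \<le> real_of_int (idot b p)" "of_int (idot b p) \<le> zb"
    using bp k0 D p by (auto simp: corner_lattice_def slack_def)
  show ?thesis
  proof (cases "zb = of_int (idot b u)")
    case True
    then have "k * width a b = 0" using le bp by (metis add_cancel_left_right antisym of_int_eq_0_iff of_int_mult)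
    then have "k = 0" using D by simp
    then have "p = u" using k by (simp add: vec_eq_2)
    then show ?thesis using u by simp
  next
    case False
    then have \<epsilon>: "0 \<le> \<epsilon>" "\<epsilon> \<le> 1" "\<epsilon> * (zb - of_int (idot b u)) = of_int (idot b p) - of_int (idot b u)"
      using le by (auto simp: \<epsilon>_def)
    have "rvec p = (1 - \<epsilon>) *\<^sub>R rvec u + \<epsilon> *\<^sub>R v"
      using c u p av bv \<epsilon>(3)
      by (intro cross2_lines_unique[of "rvec a" "rvec b"]) (auto simp: inner_add_right inner_rvec algebra_simps)
    then show ?thesis using Q u vQ \<epsilon> by (simp add: convexD)
  qed
qed

text \<open>If the edge contains an integer point, the cut stays on the left; then either the second
  edge persists and the phase continues, or a right edge is lost. If it contains none, the tilted
  edge is destroyed, and the cut either takes its place on the left, with the same two outcomes, or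
  joins the right side, where it weighs half.\<close>

lemma tilt_budget_drop:
  assumes Q: "convex Q" and fin: "finite (edges Q)" and C: "corner d Q v a za b zb" and v: "v \<notin> int_pts"
    and p: "of_int (idot a p) = za" "corner_lattice a b zb p f"
    and Q': "Q' = Q \<inter> tilt_plane a b zb p f" and int: "interior Q' \<noteq> {}"
    and td: "cross2 (rvec (tilt_normal a b zb p f)) d \<noteq> 0"
    and C': "corner d Q' v' a' za' b' zb'" and v': "v' \<notin> int_pts" and p': "corner_data a' za' b' zb' p' f'"
    and L: "L \<ge> 1" "log 2 (of_int (width a b)) \<le> 3 * L" "log 2 (of_int (width a' b')) \<le> 3 * L"
  shows "budget d L Q' a' za' b' zb' p' f' + 1 \<le> budget d L Q a za b zb p f"
proof -
  define t where "t = tilt_normal a b zb p f"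
  define s where "s = real_of_int (idot t p)"
  have Qs: "Q' = Q \<inter> halfplane t s" unfolding Q' tilt_plane_def t_def s_def ..
  have f: "idot a f = 1" using p by (simp add: corner_lattice_def)
  have c: "cross2 (rvec a) (rvec b) < 0" "cross2 (rvec a) d < 0" "cross2 d (rvec b) < 0"
    and ea: "(a, za) \<in> edges Q" and eb: "(b, zb) \<in> edges Q"
    and va: "rvec a \<bullet> v = za" and vb: "rvec b \<bullet> v = zb" and vQ: "v \<in> Q" using C by (auto simp: corner_def)
  have bd: "cross2 (rvec b) d > 0" using c cross2_swap[of d "rvec b"] by simp
  have zaZ: "za \<in> \<int>" using p by auto
  have pt: "primitive t" unfolding t_def by (rule tilt_normal_primitive[OF f])
  have sl: "slack b zb p > 0" by (rule corner_slack_pos[OF C v p])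
  have at: "cross2 (rvec a) (rvec t) < 0" and tb: "cross2 (rvec t) (rvec b) \<le> 0"
    unfolding t_def by (rule tilt_normal_cone[OF p(2)])+
  have tv: "rvec t \<bullet> v > s" unfolding t_def s_def
    by (rule tilt_normal_cone(3)[OF p(2)]) (use va vb p sl in auto)
  note int' = int[unfolded Qs] and C'' = C'[unfolded Qs]
  note cases = cut_corner_cases[OF Q C pt tv int' tb less_imp_le[OF at] C'']
  have sub: "edges Q' \<subseteq> insert (t, s) (edges Q)" unfolding Qs by (rule edges_Int_halfplane[OF Q pt int'])
  have cd: "corner_data a za b zb p f" using p by (simp add: corner_data_def)
  note pb = phase_budget_bounds(1)[OF C v cd L(1,2)]
  note pb' = phase_budget_bounds(2)[OF C' v' p' L(1,3)]
  have finL: "finite (left_edges d Q)" and finR: "finite (right_edges d Q)" using finite_left_right_edges[OF fin] by auto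
  have same_phase: "phase_budget L a' za' b' zb' p' f' + 1 \<le> phase_budget L a za b zb p f"
    if a': "(a', za') = (t, s)" and b': "(b', zb') = (b, zb)" and tl: "cross2 (rvec t) d < 0"
  proof -
    have z': "za' \<in> \<int>" using a' by (auto simp: s_def)
    have p'': "of_int (idot t p') = s" "corner_lattice t b zb p' f'" using p' z' a' b' by (auto simp: corner_data_def)
    have sl': "slack b zb p' > 0" using corner_slack_pos[OF C' v', of p' f'] p'' a' b' by simp
    \<comment> \<open>If this vanished, the cut would be parallel to the second edge and on the same
      side of \<open>d\<close>.\<close>
    have "idot b f \<noteq> 0"
    proof
      assume z: "idot b f = 0"
      then have tf: "t = turn f" by (simp add: t_def tilt_normal_def)
      have "b = width a b *s t" using normal_decomposition[OF f, of b] z by (simp add: tf vec_eq_2)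
      then have "rvec b = of_int (width a b) *\<^sub>R rvec t" by (metis rvec_arith(4))
      then have "cross2 (rvec b) d = of_int (width a b) * cross2 (rvec t) d" by (simp add: cross2_def algebra_simps)
      moreover have "width a b > 0" using p by (auto simp: corner_lattice_def)
      ultimately show False using tl bd by (simp add: zero_less_mult_iff)
    qed
    then have "phase_potential (3 * L) (width t b) (slack b zb p') (idot b f') + 1
      \<le> phase_potential (3 * L) (width a b) (slack b zb p) (idot b f)"
      using p'' by (intro phase_step[OF p(2) sl _ t_def _ _ sl' L(2)]) (auto simp: s_def)
    then show ?thesis using zaZ z' a' b' by (simp add: phase_budget_def)
  qed
  have Rle: "card (right_edges d Q') \<le> card (right_edges d Q)" if "cross2 (rvec t) d < 0"
    by (rule card_mono[OF finR]) (use sub that in \<open>auto simp: right_edges_def\<close>)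
  have Rlt: "card (right_edges d Q') + 1 \<le> card (right_edges d Q)" if "cross2 (rvec t) d < 0" "(b, zb) \<notin> edges Q'"
    by (rule card_Diff_less[OF finR, of "(b, zb)"]) (use sub that eb bd in \<open>auto simp: right_edges_def\<close>)
  show ?thesis
  proof (cases "integral_edge Q a za")
    case True
    then have w: "edge_weight d Q a za = card (right_edges d Q)" by (simp add: edge_weight_def)
    obtain u where u: "rvec u \<in> Q" "of_int (idot a u) = za" using True by (auto simp: integral_edge_def)
    have "rvec p \<in> Q" by (rule pivot_in_convex[OF Q C p u])
    then have pQ': "rvec p \<in> Q'" unfolding Qs s_def by simp
    \<comment> \<open>A cut on the right would enclose \<open>d\<close> together with
      \<open>a\<close>. The pivot, which is on both lines and in the new set, would then be the new
      vertex, contrary to \<open>v'\<close> being fractional.\<close>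
    have tl: "cross2 (rvec t) d < 0"
    proof (rule ccontr)
      assume "\<not> ?thesis"
      then have tr: "cross2 d (rvec t) < 0" using td cross2_swap[of d "rvec t"] unfolding t_def by simp
      have v'Q: "v' \<in> Q'" and ea': "(a', za') \<in> edges Q'" "(b', zb') \<in> edges Q'"
        and v'': "rvec a' \<bullet> v' = za'" "rvec b' \<bullet> v' = zb'"
        and c': "cross2 (rvec a') (rvec b') < 0" "cross2 (rvec a') d < 0" "cross2 d (rvec b') < 0"
        using C' by (auto simp: corner_def)
      have 1: "d \<bullet> rvec p \<le> d \<bullet> v'"
        by (rule cone_apex_maximal(1)[OF c'(2,3,1)]) (use edgesD(3)[OF ea'(1) pQ'] edgesD(3)[OF ea'(2) pQ'] v'' in auto)
      have "v' \<in> Q" "rvec t \<bullet> v' \<le> s" using v'Q unfolding Qs by (auto simp: halfplane_def)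
      then have 2: "rvec a \<bullet> v' \<le> rvec a \<bullet> rvec p" "rvec t \<bullet> v' \<le> rvec t \<bullet> rvec p"
        using edgesD(3)[OF ea] p by (auto simp: inner_rvec s_def)
      have "d \<bullet> v' \<le> d \<bullet> rvec p" "d \<bullet> v' = d \<bullet> rvec p \<Longrightarrow> v' = rvec p"
        using cone_apex_maximal[OF c(2) tr at 2] by auto
      then have "v' = rvec p" using 1 by simp
      then show False using v' by simp
    qed
    have a': "(a', za') = (t, s)" using cases(1)[OF tl] .
    have "integral_edge Q' t s" using pQ' by (auto simp: integral_edge_def s_def)
    then have w': "edge_weight d Q' a' za' = card (right_edges d Q')" using a' by (simp add: edge_weight_def)
    show ?thesis
    proof (cases "(b', zb') = (b, zb)")
      case True
      then show ?thesis using same_phase[OF a' _ tl] Rle[OF tl] w w' by (intro budget_drop) auto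
    next
      case False
      then have "(b, zb) \<notin> edges Q'" using cases(2)[OF tl] unfolding Qs by auto
      then show ?thesis using Rlt[OF tl] w w' by (intro budget_drop_weight[OF _ pb' pb]) auto
    qed
  next
    case False
    then have w: "edge_weight d Q a za = 2 * card (left_edges d Q) + card (right_edges d Q)" by (simp add: edge_weight_def)
    have w': "edge_weight d Q' a' za' \<le> 2 * card (left_edges d Q') + card (right_edges d Q')" by (simp add: edge_weight_def)
    \<comment> \<open>The tilted line meets the cutting line only in the pivot; survival would put
      this integer point on the edge.\<close>
    have dead: "(a, za) \<notin> edges Q'"
    proof
      assume "(a, za) \<in> edges Q'"
      then obtain x where x: "x \<in> Q" "rvec a \<bullet> x = za" "rvec t \<bullet> x = s"
        using surviving_edge_crossing[OF Q vQ va tv] unfolding Qs by blast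
      then have "x = rvec p" using at p
        by (intro cross2_lines_unique[of "rvec a" "rvec t"]) (auto simp: inner_rvec s_def)
      then have "integral_edge Q a za" using x p by (auto simp: integral_edge_def)
      then show False using False by simp
    qed
    have aL: "(a, za) \<in> left_edges d Q" using ea c by (simp add: left_edges_def)
    show ?thesis
    proof (cases "cross2 (rvec t) d < 0")
      case tl: True
      have l: "card (left_edges d Q') \<le> card (left_edges d Q)"
        by (rule card_insert_Diff_le[OF finL aL, of _ "(t, s)"]) (use sub dead in \<open>auto simp: left_edges_def\<close>)
      have a': "(a', za') = (t, s)" using cases(1)[OF tl] .
      show ?thesis
      proof (cases "(b', zb') = (b, zb)")
        case True
        then show ?thesis using same_phase[OF a' _ tl] Rle[OF tl] w w' l by (intro budget_drop) auto
      next
        case False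
        then have "(b, zb) \<notin> edges Q'" using cases(2)[OF tl] unfolding Qs by auto
        then show ?thesis using Rlt[OF tl] w w' l by (intro budget_drop_weight[OF _ pb' pb]) auto
      qed
    next
      case False
      then have tr: "cross2 (rvec t) d > 0" using td by (simp add: t_def)
      \<comment> \<open>The lost left edge counts 2, the cut as a new right edge counts 1.\<close>
      have l: "card (left_edges d Q') + 1 \<le> card (left_edges d Q)"
        by (rule card_Diff_less[OF finL aL]) (use sub dead tr in \<open>auto simp: left_edges_def\<close>)
      have "card (right_edges d Q') \<le> card (insert (t, s) (right_edges d Q))"
        by (rule card_mono) (use sub finR in \<open>auto simp: right_edges_def\<close>)
      also have "\<dots> \<le> card (right_edges d Q) + 1" using card_insert_le_m1[of "card (right_edges d Q) + 1" "right_edges d Q" "(t, s)"] by simp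
      finally have "card (right_edges d Q') \<le> card (right_edges d Q) + 1" .
      then show ?thesis using l w w' by (intro budget_drop_weight[OF _ pb' pb]) auto
    qed
  qed
qed

section \<open>Planar polyhedra\<close>

definition poly_set :: "((int^2) \<times> real) set \<Rightarrow> (real^2) set" where
  "poly_set S = {x. \<forall>(a, z)\<in>S. rvec a \<bullet> x \<le> z}"

lemma poly_set_Int_halfplane: "poly_set S \<inter> halfplane a z = poly_set (insert (a, z) S)"
  by (auto simp: poly_set_def halfplane_def)

lemma polyhedron_poly_set:
  assumes "finite S" shows "polyhedron (poly_set S)"
proof -
  have "poly_set S = \<Inter> ((\<lambda>(a, z). {x. rvec a \<bullet> x \<le> z}) ` S)" by (auto simp: poly_set_def)
  moreover have "polyhedron (\<Inter> ((\<lambda>(a, z). {x. rvec a \<bullet> x \<le> z}) ` S))"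
    using assms by (intro polyhedron_Inter) (auto simp: polyhedron_halfspace_le)
  ultimately show ?thesis by simp
qed

lemma poly_set_local:
  assumes "finite S" "v \<in> poly_set S" "\<And>a z. (a, z) \<in> S \<Longrightarrow> rvec a \<bullet> v = z \<Longrightarrow> rvec a \<bullet> e \<le> 0"
  shows "\<exists>\<epsilon>>0. v + \<epsilon> *\<^sub>R e \<in> poly_set S"
proof -
  \<comment> \<open>All smaller step lengths are included so that the radii of two rows can be
    combined by a minimum.\<close>
  have "\<exists>\<epsilon>>0. \<forall>\<delta>. 0 < \<delta> \<and> \<delta> \<le> \<epsilon> \<longrightarrow> v + \<delta> *\<^sub>R e \<in> poly_set S"
    using assms
  proof (induction S rule: finite_induct)
    case empty
    then show ?case by (auto simp: poly_set_def intro: exI[of _ 1])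
  next
    case (insert h S)
    obtain a z where h: "h = (a, z)" by (cases h)
    have "v \<in> poly_set S" using insert.prems by (auto simp: poly_set_def)
    then obtain \<epsilon> where \<epsilon>: "\<epsilon> > 0" "\<And>\<delta>. 0 < \<delta> \<Longrightarrow> \<delta> \<le> \<epsilon> \<Longrightarrow> v + \<delta> *\<^sub>R e \<in> poly_set S"
      using insert.IH insert.prems(2) by (metis insertI2)
    have "\<exists>\<eta>>0. \<forall>\<delta>. 0 < \<delta> \<and> \<delta> \<le> \<eta> \<longrightarrow> rvec a \<bullet> (v + \<delta> *\<^sub>R e) \<le> z"
    proof (cases "rvec a \<bullet> v = z")
      case True
      then have "rvec a \<bullet> e \<le> 0" using insert.prems(2) h by blast
      then show ?thesis using True by (auto simp: inner_add_right mult_nonneg_nonpos intro!: exI[of _ 1])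
    next
      case False
      then have lt: "rvec a \<bullet> v < z" using insert.prems(1) h by (auto simp: poly_set_def)
      define k where "k = \<bar>rvec a \<bullet> e\<bar> + 1"
      have k: "k > 0" by (simp add: k_def)
      have "rvec a \<bullet> (v + \<delta> *\<^sub>R e) \<le> z" if "0 < \<delta>" "\<delta> \<le> (z - rvec a \<bullet> v) / k" for \<delta>
      proof -
        have "\<delta> * (rvec a \<bullet> e) \<le> \<delta> * k" using that unfolding k_def by (intro mult_left_mono) auto
        also have "\<dots> \<le> z - rvec a \<bullet> v" using that k by (simp add: pos_le_divide_eq)
        finally show ?thesis by (simp add: inner_add_right)
      qed
      then show ?thesis using lt k by (intro exI[of _ "(z - rvec a \<bullet> v) / k"]) auto
    qed
    then obtain \<eta> where \<eta>: "\<eta> > 0" "\<And>\<delta>. 0 < \<delta> \<Longrightarrow> \<delta> \<le> \<eta> \<Longrightarrow> rvec a \<bullet> (v + \<delta> *\<^sub>R e) \<le> z" by blast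
    have "v + \<delta> *\<^sub>R e \<in> poly_set (insert h S)" if "0 < \<delta>" "\<delta> \<le> min \<epsilon> \<eta>" for \<delta>
      using \<epsilon>(2)[of \<delta>] \<eta>(2)[of \<delta>] that h by (auto simp: poly_set_def)
    then show ?case using \<epsilon> \<eta> by (intro exI[of _ "min \<epsilon> \<eta>"]) auto
  qed
  then show ?thesis by blast
qed

text \<open>At the midpoint some tight row must oppose the direction \<open>n\<close>, for otherwise
  a step along \<open>n\<close> would leave the supporting half-plane. A row tight at the midpoint
  is tight at both ends, hence parallel to \<open>n\<close>. The vector \<open>n\<close> is real
  because in dimension one it comes from an abstract hyperplane.\<close>

lemma poly_set_tight_row:
  assumes fin: "finite S" and n: "n \<noteq> 0" "\<And>x. x \<in> poly_set S \<Longrightarrow> n \<bullet> x \<le> k"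
    and xy: "x \<in> poly_set S" "y \<in> poly_set S" "x \<noteq> y" "n \<bullet> x = k" "n \<bullet> y = k"
  shows "\<exists>A b \<mu>. (A, b) \<in> S \<and> A \<noteq> 0 \<and> rvec A = \<mu> *\<^sub>R n \<and> b = \<mu> * k"
proof -
  define m where "m = (1/2) *\<^sub>R x + (1/2) *\<^sub>R y"
  have "convex (poly_set S)" using polyhedron_imp_convex polyhedron_poly_set fin by blast
  then have m: "m \<in> poly_set S" unfolding m_def using xy by (intro convexD) auto
  have nm: "n \<bullet> m = k" using xy by (simp add: m_def inner_add_right)
  have "\<exists>A b. (A, b) \<in> S \<and> rvec A \<bullet> m = b \<and> rvec A \<bullet> n > 0"
  proof (rule ccontr)
    assume "\<not> ?thesis"
    then obtain \<epsilon> where "\<epsilon> > 0" "m + \<epsilon> *\<^sub>R n \<in> poly_set S"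
      using poly_set_local[OF fin m, of n] by (metis not_less)
    then have "\<epsilon> * (n \<bullet> n) \<le> 0" using n(2) nm by (force simp: inner_add_right)
    moreover have "\<epsilon> * (n \<bullet> n) > 0" using \<open>\<epsilon> > 0\<close> n(1) by (intro mult_pos_pos) auto
    ultimately show False by simp
  qed
  then obtain A b where A: "(A, b) \<in> S" "rvec A \<bullet> m = b" "rvec A \<bullet> n > 0" by blast
  have "rvec A \<bullet> x \<le> b" "rvec A \<bullet> y \<le> b" using xy A by (auto simp: poly_set_def)
  then have Axy: "rvec A \<bullet> x = b" "rvec A \<bullet> y = b" using A(2) unfolding m_def by (auto simp: inner_add_right)
  then have "x - y \<noteq> 0" "n \<bullet> (x - y) = 0" "rvec A \<bullet> (x - y) = 0" using xy by (auto simp: inner_diff_right)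
  then obtain \<mu> where "rvec A = \<mu> *\<^sub>R n" using parallel_normals n by blast
  moreover have "A \<noteq> 0" using A(3) by (auto simp: rvec_arith)
  ultimately show ?thesis using A(1) Axy xy by (metis inner_scaleR_left)
qed

text \<open>This transfers the bound on the entries of \<open>A\<close> to the primitive normals and
  makes the levels rational.\<close>

lemma edge_row:
  assumes fin: "finite S" and e: "(a, z) \<in> edges (poly_set S)"
  shows "\<exists>A b g. (A, b) \<in> S \<and> g \<noteq> 0 \<and> A = g *s a \<and> b = of_int g * z"
proof -
  obtain x y where xy: "x \<in> poly_set S" "y \<in> poly_set S" "x \<noteq> y" "rvec a \<bullet> x = z" "rvec a \<bullet> y = z"
    using e by (auto simp: edges_def)
  obtain A b \<mu> where A: "(A, b) \<in> S" "A \<noteq> 0" "rvec A = \<mu> *\<^sub>R rvec a" "b = \<mu> * z"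
    using poly_set_tight_row[OF fin edgesD(2,3)[OF e] xy] by blast
  obtain f where f: "idot a f = 1" using primitive_bezout edgesD(1)[OF e] by blast
  have "real_of_int (idot A f) = \<mu> * of_int (idot a f)" by (metis A(3) inner_rvec inner_scaleR_left)
  then have \<mu>: "\<mu> = of_int (idot A f)" using f by simp
  then have "A = idot A f *s a" using A(3) rvec_eq_iff rvec_arith(4) by metis
  moreover have "idot A f \<noteq> 0" using A \<mu> by auto
  ultimately show ?thesis using A(1,4) \<mu> by blast
qed

lemma edges_finite_card:
  assumes fin: "finite S" and d: "aff_dim (poly_set S) = 2" and int: "interior (poly_set S) \<noteq> {}"
  shows "finite (edges (poly_set S))" "card (edges (poly_set S)) \<le> card {F. F facet_of poly_set S}"
proof -
  let ?Q = "poly_set S" and ?g = "\<lambda>(a, z). poly_set S \<inter> {x. rvec a \<bullet> x = z}"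
  have Q: "convex ?Q" using polyhedron_imp_convex polyhedron_poly_set fin by blast
  have F: "finite {F. F facet_of ?Q}" using finite_polyhedron_facets polyhedron_poly_set fin by blast
  have inj: "inj_on ?g (edges ?Q)"
  proof (rule inj_onI)
    fix e e' assume e: "e \<in> edges ?Q" "e' \<in> edges ?Q" "?g e = ?g e'"
    obtain a z t s where ee: "e = (a, z)" "e' = (t, s)" by (cases e, cases e')
    obtain x y where xy: "x \<in> ?Q" "y \<in> ?Q" "x \<noteq> y" "rvec a \<bullet> x = z" "rvec a \<bullet> y = z"
      using e(1) ee by (auto simp: edges_def)
    then have "x \<in> ?g e'" "y \<in> ?g e'" using e(3) ee by auto
    then have "rvec t \<bullet> x = s" "rvec t \<bullet> y = s" using ee by auto
    then show "e = e'" unfolding ee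
      using edges_unique[OF int edgesD(1) edgesD(3) edgesD(1) edgesD(3) xy(3-5), OF _ _ _ _]
        e(1,2)[unfolded ee] by simp
  qed
  have sub: "?g ` edges ?Q \<subseteq> {F. F facet_of ?Q}" using edge_facet[OF Q d] by auto
  show "finite (edges ?Q)" using inj_on_finite[OF inj sub F] .
  show "card (edges ?Q) \<le> card {F. F facet_of ?Q}" using card_inj_on_le[OF inj sub F] .
qed

lemma convex_aff_dim_interior:
  fixes Q :: "(real^2) set"
  assumes "convex Q" shows "aff_dim Q = 2 \<longleftrightarrow> interior Q \<noteq> {}"
proof
  assume "aff_dim Q = 2"
  show "interior Q \<noteq> {}"
  proof
    assume "interior Q = {}"
    then obtain a b where "a \<noteq> 0" "Q \<subseteq> {x. a \<bullet> x = b}" using empty_interior_subset_hyperplane assms by blast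
    then have "aff_dim Q \<le> 1" using aff_dim_subset[of Q "{x. a \<bullet> x = b}"] by (simp add: aff_dim_hyperplane)
    then show False using \<open>aff_dim Q = 2\<close> by simp
  qed
next
  assume "interior Q \<noteq> {}"
  then show "aff_dim Q = 2" using aff_dim_nonempty_interior[of Q] by simp
qed

section \<open>Optimal vertices\<close>

lemma ray_end:
  fixes x \<sigma> :: "real^2"
  assumes "closed Q" "convex Q" "x \<in> Q" "T \<ge> 0" "x + T *\<^sub>R \<sigma> \<notin> Q"
  shows "\<exists>t\<ge>0. x + t *\<^sub>R \<sigma> \<in> Q \<and> (\<forall>s>0. x + t *\<^sub>R \<sigma> + s *\<^sub>R \<sigma> \<notin> Q)"
proof -
  define K where "K = {0..T} \<inter> (\<lambda>t. x + t *\<^sub>R \<sigma>) -` Q"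
  have "closed ((\<lambda>t. x + t *\<^sub>R \<sigma>) -` Q)"
    by (rule closed_vimage[OF assms(1)]) (intro continuous_intros)
  then have "compact K" unfolding K_def by (rule compact_Int_closed[OF compact_Icc])
  moreover have "0 \<in> K" using assms(3,4) by (simp add: K_def)
  then have "K \<noteq> {}" by blast
  ultimately obtain t where t: "t \<in> K" "\<And>s. s \<in> K \<Longrightarrow> s \<le> t" using compact_attains_sup[of K] by auto
  have "x + t *\<^sub>R \<sigma> + s *\<^sub>R \<sigma> \<notin> Q" if s: "s > 0" for s
  proof
    assume "x + t *\<^sub>R \<sigma> + s *\<^sub>R \<sigma> \<in> Q"
    then have in_Q: "x + (t + s) *\<^sub>R \<sigma> \<in> Q" by (simp add: algebra_simps)
    have "t \<ge> 0" using t(1) by (simp add: K_def)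
    show False
    proof (cases "t + s \<le> T")
      case True
      then have "t + s \<in> K" using in_Q s \<open>t \<ge> 0\<close> True by (simp add: K_def)
      then show False using t(2)[of "t + s"] s by simp
    next
      case False
      define u where "u = T / (t + s)"
      have u: "0 \<le> u" "u \<le> 1" "u * (t + s) = T" using False assms(4) s \<open>t \<ge> 0\<close> by (simp_all add: u_def)
      have "(1 - u) *\<^sub>R x + u *\<^sub>R (x + (t + s) *\<^sub>R \<sigma>) \<in> Q" using assms in_Q u by (intro convexD) auto
      moreover have "(1 - u) *\<^sub>R x + u *\<^sub>R (x + (t + s) *\<^sub>R \<sigma>) = x + (u * (t + s)) *\<^sub>R \<sigma>"
        by (simp add: algebra_simps)
      ultimately show False using assms u(3) by simp
    qed
  qed
  moreover have "t \<ge> 0" "x + t *\<^sub>R \<sigma> \<in> Q" using t(1) by (simp_all add: K_def)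
  ultimately show ?thesis by blast
qed

text \<open>Some orientation leaves the set without decreasing \<open>c\<close>: if \<open>c\<close>
  is constant along the line this is pointedness, otherwise boundedness of \<open>c\<close>.\<close>

lemma line_end:
  fixes c \<delta> :: "real^2"
  assumes Q: "closed Q" "convex Q" "pointed Q" and x: "x \<in> Q" and \<delta>: "\<delta> \<noteq> 0" and c: "\<And>y. y \<in> Q \<Longrightarrow> c \<bullet> y \<le> \<beta>"
  obtains \<sigma> t where "\<sigma> = \<delta> \<or> \<sigma> = - \<delta>" "t \<ge> 0" "x + t *\<^sub>R \<sigma> \<in> Q" "c \<bullet> \<sigma> \<ge> 0"
    "\<And>s. s > 0 \<Longrightarrow> x + t *\<^sub>R \<sigma> + s *\<^sub>R \<sigma> \<notin> Q"
proof -
  have "\<exists>\<sigma> T. (\<sigma> = \<delta> \<or> \<sigma> = - \<delta>) \<and> c \<bullet> \<sigma> \<ge> 0 \<and> T \<ge> 0 \<and> x + T *\<^sub>R \<sigma> \<notin> Q"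
  proof (cases "c \<bullet> \<delta> = 0")
    case True
    obtain t where t: "x + t *\<^sub>R \<delta> \<notin> Q" using Q(3) \<delta> unfolding pointed_def by blast
    show ?thesis
    proof (cases "t \<ge> 0")
      case True
      then show ?thesis using t \<open>c \<bullet> \<delta> = 0\<close> by (intro exI[of _ \<delta>] exI[of _ t]) auto
    next
      case False
      then show ?thesis using t \<open>c \<bullet> \<delta> = 0\<close> by (intro exI[of _ "- \<delta>"] exI[of _ "- t"]) auto
    qed
  next
    case False
    define \<sigma> where "\<sigma> = (if c \<bullet> \<delta> > 0 then \<delta> else - \<delta>)"
    have \<sigma>: "c \<bullet> \<sigma> > 0" "\<sigma> = \<delta> \<or> \<sigma> = - \<delta>" using False by (auto simp: \<sigma>_def)
    define T where "T = (\<beta> - c \<bullet> x + 1) / (c \<bullet> \<sigma>)"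
    have "T \<ge> 0" unfolding T_def using \<sigma> c[OF x] by (intro divide_nonneg_pos) auto
    moreover have "T * (c \<bullet> \<sigma>) = \<beta> - c \<bullet> x + 1" using \<sigma> by (simp add: T_def)
    then have "c \<bullet> (x + T *\<^sub>R \<sigma>) > \<beta>" by (simp add: inner_add_right)
    then have "x + T *\<^sub>R \<sigma> \<notin> Q" using c[of "x + T *\<^sub>R \<sigma>"] by linarith
    ultimately show ?thesis using \<sigma> by (intro exI[of _ \<sigma>] exI[of _ T]) auto
  qed
  then obtain \<sigma> T where \<sigma>: "\<sigma> = \<delta> \<or> \<sigma> = - \<delta>" "c \<bullet> \<sigma> \<ge> 0" "T \<ge> 0" "x + T *\<^sub>R \<sigma> \<notin> Q" by blast
  obtain t where t: "t \<ge> 0" "x + t *\<^sub>R \<sigma> \<in> Q" "\<forall>s>0. x + t *\<^sub>R \<sigma> + s *\<^sub>R \<sigma> \<notin> Q"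
    using ray_end[OF Q(1,2) x \<sigma>(3,4)] by blast
  show thesis by (rule that[of \<sigma> t]) (use \<sigma>(1,2) t in auto)
qed

text \<open>A segment through \<open>y\<close> must stay on the supporting line, so one of its ends
  would lie beyond \<open>y\<close> in direction \<open>\<sigma>\<close>.\<close>

lemma supported_line_end_extreme:
  fixes n \<sigma> :: "real^2"
  assumes y: "y \<in> Q" and n: "n \<noteq> 0" "\<And>x. x \<in> Q \<Longrightarrow> n \<bullet> x \<le> n \<bullet> y" and \<sigma>: "\<sigma> \<noteq> 0" "n \<bullet> \<sigma> = 0"
    and out: "\<And>s. s > 0 \<Longrightarrow> y + s *\<^sub>R \<sigma> \<notin> Q"
  shows "y extreme_point_of Q"
  unfolding extreme_point_of_def
proof (intro conjI y ballI notI)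
  fix a b assume ab: "a \<in> Q" "b \<in> Q" "y \<in> open_segment a b"
  then obtain u where u: "0 < u" "u < 1" "y = (1 - u) *\<^sub>R a + u *\<^sub>R b" "a \<noteq> b"
    unfolding in_segment by blast
  have le: "n \<bullet> a \<le> n \<bullet> y" "n \<bullet> b \<le> n \<bullet> y" using n ab by auto
  have "(1 - u) * (n \<bullet> y - n \<bullet> a) + u * (n \<bullet> y - n \<bullet> b) = 0"
    using arg_cong[OF u(3), of "\<lambda>x. n \<bullet> x"] by (simp add: inner_add_right algebra_simps)
  moreover have "(1 - u) * (n \<bullet> y - n \<bullet> a) \<ge> 0" "u * (n \<bullet> y - n \<bullet> b) \<ge> 0" using u le by auto
  ultimately have "(1 - u) * (n \<bullet> y - n \<bullet> a) = 0" "u * (n \<bullet> y - n \<bullet> b) = 0" by linarith+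
  then have eq: "n \<bullet> a = n \<bullet> y" "n \<bullet> b = n \<bullet> y" using u by auto
  then have "n \<bullet> (b - a) = 0" by (simp add: inner_diff_right)
  then obtain r where r: "b - a = r *\<^sub>R \<sigma>" using parallel_if_orthogonal[of n \<sigma> "b - a"] n \<sigma> by blast
  then have r0: "r \<noteq> 0" using u by auto
  have b: "b = y + ((1 - u) * r) *\<^sub>R \<sigma>" and a: "a = y + (- u * r) *\<^sub>R \<sigma>"
  proof -
    have "b - y = (1 - u) *\<^sub>R (b - a)" "a - y = (- u) *\<^sub>R (b - a)" unfolding u(3) by (simp_all add: algebra_simps)
    then have "b - y = ((1 - u) * r) *\<^sub>R \<sigma>" "a - y = (- u * r) *\<^sub>R \<sigma>" unfolding r by simp_all
    then show "b = y + ((1 - u) * r) *\<^sub>R \<sigma>" "a = y + (- u * r) *\<^sub>R \<sigma>"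
      unfolding diff_eq_eq by (simp_all only: add.commute)
  qed
  show False
  proof (cases "r > 0")
    case True
    then have "(1 - u) * r > 0" using u by simp
    then have "y + ((1 - u) * r) *\<^sub>R \<sigma> \<notin> Q" by (rule out)
    then show False using ab(2) unfolding b[symmetric] by contradiction
  next
    case False
    then have "- u * r > 0" using r0 u by (simp add: mult_less_0_iff)
    then have "y + (- u * r) *\<^sub>R \<sigma> \<notin> Q" by (rule out)
    then show False using ab(1) unfolding a[symmetric] by contradiction
  qed
qed

text \<open>Two slides that do not decrease \<open>c\<close>: along a fixed direction to the
  boundary, then along a supporting line there to its end.\<close>

lemma extreme_point_above:
  fixes c :: "real^2"
  assumes Q: "closed Q" "convex Q" "pointed Q" "interior Q \<noteq> {}" and x: "x \<in> Q" and c: "\<And>y. y \<in> Q \<Longrightarrow> c \<bullet> y \<le> \<beta>"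
  shows "\<exists>v. v extreme_point_of Q \<and> c \<bullet> x \<le> c \<bullet> v"
proof -
  define \<delta> :: "real^2" where "\<delta> = axis 1 1"
  have \<delta>: "\<delta> \<noteq> 0" by (simp add: \<delta>_def axis_eq_0_iff)
  obtain \<sigma> t where \<sigma>: "\<sigma> = \<delta> \<or> \<sigma> = - \<delta>" "t \<ge> 0" "x + t *\<^sub>R \<sigma> \<in> Q" "c \<bullet> \<sigma> \<ge> 0"
    "\<And>s. s > 0 \<Longrightarrow> x + t *\<^sub>R \<sigma> + s *\<^sub>R \<sigma> \<notin> Q"
    by (rule line_end[OF Q(1-3) x \<delta>, of c \<beta>], erule c) (rule that)
  define y where "y = x + t *\<^sub>R \<sigma>"
  have y: "y \<in> Q" "\<And>s. s > 0 \<Longrightarrow> y + s *\<^sub>R \<sigma> \<notin> Q" using \<sigma>(3,5) by (simp_all add: y_def)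
  have cy: "c \<bullet> x \<le> c \<bullet> y" using \<sigma>(2,4) by (simp add: y_def inner_add_right)
  have \<sigma>0: "\<sigma> \<noteq> 0" using \<sigma>(1) \<delta> by auto
  have "y \<notin> interior Q"
  proof
    assume "y \<in> interior Q"
    then obtain e where e: "e > 0" "ball y e \<subseteq> Q" by (meson mem_interior)
    have "y + (e / 2 / norm \<sigma>) *\<^sub>R \<sigma> \<in> ball y e" using e \<sigma>0 by (simp add: dist_norm)
    moreover have "e / 2 / norm \<sigma> > 0" using e \<sigma>0 by simp
    ultimately show False using e(2) y(2) by blast
  qed
  then have "y \<notin> rel_interior Q" using rel_interior_nonempty_interior Q(4) by blast
  then obtain m where m: "m \<noteq> 0" "\<And>z. z \<in> Q \<Longrightarrow> m \<bullet> y \<le> m \<bullet> z"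
    using supporting_hyperplane_rel_boundary[OF Q(2) y(1)] by metis
  define n where "n = - m"
  have n: "n \<noteq> 0" "\<And>z. z \<in> Q \<Longrightarrow> n \<bullet> z \<le> n \<bullet> y" using m by (auto simp: n_def)
  have tn: "turn n \<noteq> 0" using n by simp
  obtain \<tau> u where \<tau>: "\<tau> = turn n \<or> \<tau> = - turn n" "u \<ge> 0" "y + u *\<^sub>R \<tau> \<in> Q" "c \<bullet> \<tau> \<ge> 0"
    "\<And>s. s > 0 \<Longrightarrow> y + u *\<^sub>R \<tau> + s *\<^sub>R \<tau> \<notin> Q"
    by (rule line_end[OF Q(1-3) y(1) tn, of c \<beta>], erule c) (rule that)
  have \<tau>0: "\<tau> \<noteq> 0" "n \<bullet> \<tau> = 0" using \<tau>(1) tn by auto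
  then have "n \<bullet> (y + u *\<^sub>R \<tau>) = n \<bullet> y" by (simp add: inner_add_right)
  then have "(y + u *\<^sub>R \<tau>) extreme_point_of Q" using n \<tau>0 \<tau>(5)
    by (intro supported_line_end_extreme[OF \<tau>(3), of n \<tau>]) simp_all
  moreover have "c \<bullet> y \<le> c \<bullet> (y + u *\<^sub>R \<tau>)" using \<tau>(2,4) by (simp add: inner_add_right)
  ultimately show ?thesis using cy order_trans by blast
qed

lemma optimal_vertex_exists:
  assumes fin: "finite S" and Q: "pointed (poly_set S)" "interior (poly_set S) \<noteq> {}"
    and c: "\<And>y. y \<in> poly_set S \<Longrightarrow> rvec c \<bullet> y \<le> \<beta>"
  shows "\<exists>v. optimal_vertex c (poly_set S) v"
proof -
  let ?Q = "poly_set S"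
  have P: "polyhedron ?Q" by (rule polyhedron_poly_set[OF fin])
  note Q' = polyhedron_imp_closed[OF P] polyhedron_imp_convex[OF P] Q
  define V where "V = {v. v extreme_point_of ?Q}"
  have V: "finite V" unfolding V_def by (rule finite_polyhedron_extreme_points[OF P])
  obtain x where x: "x \<in> ?Q" using Q(2) interior_subset by blast
  have above: "\<exists>w\<in>V. rvec c \<bullet> y \<le> rvec c \<bullet> w" if "y \<in> ?Q" for y
    unfolding V_def using extreme_point_above[OF Q' that, of "rvec c" \<beta>] c by blast
  have "V \<noteq> {}" using above[OF x] by blast
  then have "Max ((\<lambda>v. rvec c \<bullet> v) ` V) \<in> (\<lambda>v. rvec c \<bullet> v) ` V" using V by (intro Max_in) simp_all
  then obtain v0 where v0: "v0 \<in> V" "rvec c \<bullet> v0 = Max ((\<lambda>v. rvec c \<bullet> v) ` V)" by (metis imageE)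
  have v0max: "rvec c \<bullet> v \<le> rvec c \<bullet> v0" if "v \<in> V" for v unfolding v0(2) using V that by (intro Max_ge) simp_all
  \<comment> \<open>Ties are resolved as the algorithm prescribes: among the optimal vertices the
    one met first in the clockwise direction \<open>\<tau>\<close>.\<close>
  define U where "U = {v \<in> V. rvec c \<bullet> v = rvec c \<bullet> v0}"
  define \<tau> where "\<tau> = rvec (vector [c $ 2, - c $ 1])"
  have "finite U" using V by (simp add: U_def)
  moreover have "v0 \<in> U" using v0(1) by (simp add: U_def)
  ultimately have U: "finite U" "U \<noteq> {}" by blast+
  then have "Min ((\<lambda>v. \<tau> \<bullet> v) ` U) \<in> (\<lambda>v. \<tau> \<bullet> v) ` U" by (intro Min_in) simp_all
  then obtain v where v: "v \<in> U" "\<tau> \<bullet> v = Min ((\<lambda>v. \<tau> \<bullet> v) ` U)" by (metis imageE)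
  have vmin: "\<tau> \<bullet> v \<le> \<tau> \<bullet> w" if "w \<in> U" for w unfolding v(2) using U that by (intro Min_le) simp_all
  have vV: "v \<in> V" and cv: "rvec c \<bullet> v = rvec c \<bullet> v0" using v(1) by (simp_all add: U_def)
  have "rvec c \<bullet> y \<le> rvec c \<bullet> v" if "y \<in> ?Q" for y
    using above[OF that] v0max cv by fastforce
  moreover have "\<tau> \<bullet> v \<le> \<tau> \<bullet> w" if "w extreme_point_of ?Q" "rvec c \<bullet> w = rvec c \<bullet> v" for w
    by (rule vmin) (use that cv in \<open>simp add: U_def V_def\<close>)
  ultimately have "optimal_vertex c ?Q v"
    using vV unfolding optimal_vertex_def V_def \<tau>_def by blast
  then show ?thesis by blast
qed

section \<open>The two facets at an optimal vertex\<close>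

lemma tight_row_edge:
  assumes fin: "finite S" and v: "v \<in> poly_set S" and A: "(A, z) \<in> S" "A \<noteq> 0" "rvec A \<bullet> v = z"
    and e: "e \<noteq> 0" "rvec A \<bullet> e = 0" "\<And>B w. (B, w) \<in> S \<Longrightarrow> rvec B \<bullet> v = w \<Longrightarrow> rvec B \<bullet> e \<le> 0"
  shows "\<exists>a g. g > 0 \<and> A = g *s a \<and> (a, rvec a \<bullet> v) \<in> edges (poly_set S)"
proof -
  have "\<exists>\<epsilon>>0. v + \<epsilon> *\<^sub>R e \<in> poly_set S" by (rule poly_set_local[OF fin v]) (use e(3) in blast)
  then obtain \<epsilon> where \<epsilon>: "\<epsilon> > 0" "v + \<epsilon> *\<^sub>R e \<in> poly_set S" by blast
  obtain a g where a: "primitive a" "g > 0" "A = g *s a" using primitive_part A(2) by blast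
  have Aa: "rvec A = of_int g *\<^sub>R rvec a" unfolding a(3) by (rule rvec_arith)
  have "of_int g * (rvec a \<bullet> e) = 0" using e(2) unfolding Aa by simp
  then have ae: "rvec a \<bullet> e = 0" using a by simp
  have "rvec a \<bullet> x \<le> rvec a \<bullet> v" if "x \<in> poly_set S" for x
  proof -
    have "rvec A \<bullet> x \<le> rvec A \<bullet> v" using that A by (auto simp: poly_set_def)
    then show ?thesis unfolding Aa using a by simp
  qed
  moreover have "\<exists>x\<in>poly_set S. \<exists>y\<in>poly_set S. x \<noteq> y \<and> rvec a \<bullet> x = rvec a \<bullet> v \<and> rvec a \<bullet> y = rvec a \<bullet> v"
    by (rule bexI[OF _ v], rule bexI[OF _ \<epsilon>(2)]) (use \<epsilon> e ae in \<open>simp add: inner_add_right\<close>)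
  ultimately have "(a, rvec a \<bullet> v) \<in> edges (poly_set S)" using a(1) by (simp add: edges_def)
  then show ?thesis using a by blast
qed

lemma cross2_scale: "cross2 (r *\<^sub>R a) b = r * cross2 a b" "cross2 a (r *\<^sub>R b) = r * cross2 a b"
  by (simp_all add: cross2_def algebra_simps)

lemma cross2_lagrange: "(\<delta> \<bullet> \<delta>) * cross2 a b = (a \<bullet> \<delta>) * cross2 \<delta> b - (b \<bullet> \<delta>) * cross2 \<delta> a"
  by (simp add: cross2_def inner_2 algebra_simps)

text \<open>Vectors with negative product with \<open>\<delta>\<close> fill an open half-plane,
  where the clockwise order is linear; the quotient is the slope that realises it.\<close>

lemma cross2_slope:
  assumes "\<delta> \<noteq> 0" "a \<bullet> \<delta> < 0" "b \<bullet> \<delta> < 0"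
  shows "cross2 a b \<le> 0 \<longleftrightarrow> cross2 \<delta> a / - (a \<bullet> \<delta>) \<le> cross2 \<delta> b / - (b \<bullet> \<delta>)"
proof -
  have d: "\<delta> \<bullet> \<delta> > 0" using assms by simp
  have "cross2 a b \<le> 0 \<longleftrightarrow> (\<delta> \<bullet> \<delta>) * cross2 a b \<le> 0"
    using d by (metis mult_le_cancel_left_pos mult_zero_right)
  also have "\<dots> \<longleftrightarrow> cross2 \<delta> a * - (b \<bullet> \<delta>) \<le> cross2 \<delta> b * - (a \<bullet> \<delta>)" unfolding cross2_lagrange by (simp add: algebra_simps)
  also have "\<dots> \<longleftrightarrow> cross2 \<delta> a / - (a \<bullet> \<delta>) \<le> cross2 \<delta> b / - (b \<bullet> \<delta>)"
  proof -
    have "x * B \<le> y * A \<longleftrightarrow> x / A \<le> y / B" if "A > 0" "B > 0" for x y A B :: real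
      using that by (simp add: field_simps)
    from this[of "- (a \<bullet> \<delta>)" "- (b \<bullet> \<delta>)"] show ?thesis using assms by (simp only: neg_0_less_iff_less)
  qed
  finally show ?thesis .
qed

text \<open>A direction into the interior puts all tight normals in one open half-plane, so some
  have minimal and maximal slope; these are not parallel because the tight normals span the plane.
  Directions along the two extreme rows are feasible, which yields the edges and the position of
  \<open>c\<close>.\<close>

lemma corner_edges_exist:
  fixes c :: "real^2"
  assumes fin: "finite S" and int: "interior (poly_set S) \<noteq> {}" and v: "v extreme_point_of poly_set S"
    and c: "\<And>x. x \<in> poly_set S \<Longrightarrow> c \<bullet> x \<le> c \<bullet> v"
  shows "\<exists>a b. (a, rvec a \<bullet> v) \<in> edges (poly_set S) \<and> (b, rvec b \<bullet> v) \<in> edges (poly_set S) \<and>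
    cross2 (rvec a) (rvec b) < 0 \<and> cross2 (rvec a) c \<le> 0 \<and> cross2 c (rvec b) \<le> 0"
proof -
  let ?Q = "poly_set S"
  have vQ: "v \<in> ?Q" using v by (simp add: extreme_point_of_def)
  define T where "T = {a. a \<noteq> 0 \<and> (a, rvec a \<bullet> v) \<in> S}"
  have "T \<subseteq> fst ` S" by (force simp: T_def)
  then have finT: "finite T" using fin finite_surj by blast
  have tight: "rvec B \<bullet> e \<le> 0" if "(B, w) \<in> S" "rvec B \<bullet> v = w" "\<And>a. a \<in> T \<Longrightarrow> rvec a \<bullet> e \<le> 0" for B w e
    using that by (cases "B = 0") (auto simp: T_def rvec_arith)
  \<comment> \<open>Otherwise the vertex could move both ways along \<open>e\<close> and would lie
    inside a segment of the set.\<close>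
  have spans: "\<exists>a\<in>T. rvec a \<bullet> e \<noteq> 0" if e: "e \<noteq> 0" for e
  proof (rule ccontr)
    assume "\<not> ?thesis"
    then have z: "rvec a \<bullet> e = 0" if "a \<in> T" for a using that by blast
    have "\<exists>\<epsilon>>0. v + \<epsilon> *\<^sub>R e \<in> ?Q" by (rule poly_set_local[OF fin vQ]) (use tight z in force)
    then obtain \<epsilon> where \<epsilon>: "\<epsilon> > 0" "v + \<epsilon> *\<^sub>R e \<in> ?Q" by blast
    have "\<exists>\<epsilon>>0. v + \<epsilon> *\<^sub>R (- e) \<in> ?Q" by (rule poly_set_local[OF fin vQ]) (use tight[of _ _ "- e"] z in force)
    then obtain \<eta> where \<eta>: "\<eta> > 0" "v + \<eta> *\<^sub>R (- e) \<in> ?Q" by blast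
    define u where "u = \<epsilon> / (\<epsilon> + \<eta>)"
    have u: "0 < u" "u < 1" "u * (\<epsilon> + \<eta>) = \<epsilon>" using \<epsilon> \<eta> by (auto simp: u_def)
    have "(1 - u) *\<^sub>R (v + \<epsilon> *\<^sub>R e) + u *\<^sub>R (v + \<eta> *\<^sub>R (- e)) = v + (\<epsilon> - u * (\<epsilon> + \<eta>)) *\<^sub>R e"
      by (simp add: algebra_simps)
    then have "v = (1 - u) *\<^sub>R (v + \<epsilon> *\<^sub>R e) + u *\<^sub>R (v + \<eta> *\<^sub>R (- e))" using u(3) by simp
    moreover have "v + \<epsilon> *\<^sub>R e \<noteq> v + \<eta> *\<^sub>R (- e)"
    proof
      assume "v + \<epsilon> *\<^sub>R e = v + \<eta> *\<^sub>R (- e)"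
      then have "(\<epsilon> + \<eta>) *\<^sub>R e = 0" by (simp add: algebra_simps)
      then show False using \<epsilon> \<eta> e by simp
    qed
    ultimately have "v \<in> open_segment (v + \<epsilon> *\<^sub>R e) (v + \<eta> *\<^sub>R (- e))" unfolding in_segment using u by blast
    then show False using v \<epsilon> \<eta> unfolding extreme_point_of_def by blast
  qed
  obtain i where i: "i \<in> interior ?Q" using int by blast
  define \<delta> where "\<delta> = i - v"
  have neg: "rvec a \<bullet> \<delta> < 0" if a: "a \<in> T" for a
  proof -
    have "rvec a \<bullet> i < rvec a \<bullet> v"
      by (rule interior_strict[OF i]) (use a in \<open>auto simp: T_def poly_set_def\<close>)
    then show ?thesis by (simp add: \<delta>_def inner_diff_right)
  qed
  have "turn (axis 1 1 :: real^2) \<noteq> 0" by (simp add: axis_eq_0_iff)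
  then obtain a0 where "a0 \<in> T" using spans by blast
  then have T0: "T \<noteq> {}" by blast
  have \<delta>0: "\<delta> \<noteq> 0" using neg[OF \<open>a0 \<in> T\<close>] by auto
  define g where "g a = cross2 \<delta> (rvec a) / - (rvec a \<bullet> \<delta>)" for a
  have slope: "cross2 (rvec a) (rvec b) \<le> 0 \<longleftrightarrow> g a \<le> g b" if "a \<in> T" "b \<in> T" for a b
    unfolding g_def by (rule cross2_slope[OF \<delta>0 neg[OF that(1)] neg[OF that(2)]])
  have "Min (g ` T) \<in> g ` T" "Max (g ` T) \<in> g ` T" using finT T0 by auto
  then obtain A B where AB: "A \<in> T" "g A = Min (g ` T)" "B \<in> T" "g B = Max (g ` T)" by (metis imageE)
  have Amin: "cross2 (rvec A) (rvec x) \<le> 0" and Bmax: "cross2 (rvec x) (rvec B) \<le> 0" if "x \<in> T" for x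
    using slope that AB finT by simp_all
  have ne: "cross2 (rvec A) (rvec B) \<noteq> 0"
  proof
    assume z: "cross2 (rvec A) (rvec B) = 0"
    have "cross2 (rvec B) (rvec A) \<le> 0" using z cross2_swap[of "rvec B" "rvec A"] by simp
    then have "g B \<le> g A" using slope AB by blast
    have "turn (rvec A) \<noteq> 0" using AB by (auto simp: T_def)
    then obtain x where x: "x \<in> T" "rvec x \<bullet> turn (rvec A) \<noteq> 0" using spans by blast
    have "g x \<le> g B" using AB x finT by simp
    then have "g x \<le> g A" using \<open>g B \<le> g A\<close> by simp
    then have "cross2 (rvec x) (rvec A) \<le> 0" using slope x AB by blast
    then have "cross2 (rvec A) (rvec x) = 0" using Amin[OF x(1)] cross2_swap[of "rvec x" "rvec A"] by simp
    then show False using x(2) by (simp add: inner_turn_cross2)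
  qed
  then have AB0: "cross2 (rvec A) (rvec B) < 0" using Amin AB by force
  have A': "A \<noteq> 0" "(A, rvec A \<bullet> v) \<in> S" and B': "B \<noteq> 0" "(B, rvec B \<bullet> v) \<in> S" using AB by (auto simp: T_def)
  have dirA: "rvec x \<bullet> (- turn (rvec A)) \<le> 0" and dirB: "rvec x \<bullet> turn (rvec B) \<le> 0" if "x \<in> T" for x
    using Amin[OF that] Bmax[OF that] cross2_swap[of "rvec x" "rvec B"] by (simp_all add: inner_turn_cross2)
  have "\<exists>a g. g > 0 \<and> A = g *s a \<and> (a, rvec a \<bullet> v) \<in> edges ?Q"
    by (rule tight_row_edge[OF fin vQ A'(2,1) refl, of "- turn (rvec A)"])
       (use A'(1) in simp, simp, rule tight[OF _ _ dirA])
  then obtain a g1 where a: "g1 > 0" "A = g1 *s a" "(a, rvec a \<bullet> v) \<in> edges ?Q" by blast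
  have "\<exists>b g. g > 0 \<and> B = g *s b \<and> (b, rvec b \<bullet> v) \<in> edges ?Q"
    by (rule tight_row_edge[OF fin vQ B'(2,1) refl, of "turn (rvec B)"])
       (use B'(1) in simp, simp, rule tight[OF _ _ dirB])
  then obtain b g2 where b: "g2 > 0" "B = g2 *s b" "(b, rvec b \<bullet> v) \<in> edges ?Q" by blast
  have rA: "rvec A = of_int g1 *\<^sub>R rvec a" and rB: "rvec B = of_int g2 *\<^sub>R rvec b" using a b by (simp_all only: rvec_arith)
  have cone: "c \<bullet> e \<le> 0" if "\<And>x. x \<in> T \<Longrightarrow> rvec x \<bullet> e \<le> 0" for e
  proof -
    have "\<exists>\<epsilon>>0. v + \<epsilon> *\<^sub>R e \<in> ?Q" by (rule poly_set_local[OF fin vQ]) (use tight that in blast)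
    then obtain \<epsilon> where \<epsilon>: "\<epsilon> > 0" "v + \<epsilon> *\<^sub>R e \<in> ?Q" by blast
    then have "\<epsilon> * (c \<bullet> e) \<le> 0" using c[OF \<epsilon>(2)] by (simp add: inner_add_right)
    then show ?thesis using \<epsilon> by (simp add: mult_le_0_iff)
  qed
  have "cross2 (rvec A) c \<le> 0" using cone[of "- turn (rvec A)"] dirA by (simp add: inner_turn_cross2)
  moreover have "cross2 c (rvec B) \<le> 0" using cone[of "turn (rvec B)"] dirB cross2_swap[of c "rvec B"] by (simp add: inner_turn_cross2)
  ultimately have "cross2 (rvec a) c \<le> 0" "cross2 c (rvec b) \<le> 0" "cross2 (rvec a) (rvec b) < 0"
    using AB0 a(1) b(1) unfolding rA rB cross2_scale by (auto simp: mult_le_0_iff mult_less_0_iff)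
  then show ?thesis using a(3) b(3) by blast
qed

lemma convex_cone_hull_2:
  "convex_cone hull {x, y :: real^2} = {\<alpha> *\<^sub>R x + \<beta> *\<^sub>R y | \<alpha> \<beta>. 0 \<le> \<alpha> \<and> 0 \<le> \<beta>}" (is "_ = ?C")
proof
  have "conic ?C" unfolding conic_def
  proof (clarify)
    fix \<alpha> \<beta> r :: real assume "0 \<le> r" "0 \<le> \<alpha>" "0 \<le> \<beta>"
    then show "\<exists>\<alpha>' \<beta>'. r *\<^sub>R (\<alpha> *\<^sub>R x + \<beta> *\<^sub>R y) = \<alpha>' *\<^sub>R x + \<beta>' *\<^sub>R y \<and> 0 \<le> \<alpha>' \<and> 0 \<le> \<beta>'"
      by (intro exI[of _ "r * \<alpha>"] exI[of _ "r * \<beta>"]) (simp add: scaleR_add_right)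
  qed
  moreover have "convex ?C"
  proof (rule convexI)
    fix p q and u w :: real assume pq: "p \<in> ?C" "q \<in> ?C" and u: "0 \<le> u" "0 \<le> w" "u + w = 1"
    obtain \<alpha> \<beta> where p: "p = \<alpha> *\<^sub>R x + \<beta> *\<^sub>R y" "0 \<le> \<alpha>" "0 \<le> \<beta>" using pq by blast
    obtain \<alpha>' \<beta>' where q: "q = \<alpha>' *\<^sub>R x + \<beta>' *\<^sub>R y" "0 \<le> \<alpha>'" "0 \<le> \<beta>'" using pq by blast
    have "u *\<^sub>R p + w *\<^sub>R q = (u * \<alpha> + w * \<alpha>') *\<^sub>R x + (u * \<beta> + w * \<beta>') *\<^sub>R y"
      unfolding p q by (simp add: algebra_simps)
    moreover have "0 \<le> u * \<alpha> + w * \<alpha>'" "0 \<le> u * \<beta> + w * \<beta>'" using p q u by auto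
    ultimately show "u *\<^sub>R p + w *\<^sub>R q \<in> ?C" by blast
  qed
  moreover have "?C \<noteq> {}" by auto
  ultimately have "convex_cone ?C" by (simp add: convex_cone_def)
  moreover have "x = 1 *\<^sub>R x + 0 *\<^sub>R y" "y = 0 *\<^sub>R x + 1 *\<^sub>R y" by auto
  then have "{x, y} \<subseteq> ?C" by (auto simp del: scaleR_one scaleR_zero_left) (metis order_refl zero_le_one)+
  ultimately show "convex_cone hull {x, y} \<subseteq> ?C" by (rule hull_minimal[rotated])
  show "?C \<subseteq> convex_cone hull {x, y}"
    by (auto intro!: convex_cone_hull_add convex_cone_hull_mul simp: hull_inc)
qed

text \<open>Bridge from the facets of the algorithm to \<open>edges\<close>: positive scaling of
  normals changes no sign of \<open>cross2\<close>, and membership of \<open>c\<close> in the cone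
  is a pair of signs.\<close>

lemma corner_facets_iff:
  assumes Q: "convex Q" "aff_dim Q = 2" and rat: "\<forall>(a, z)\<in>edges Q. z \<in> \<rat>"
  shows "corner_facets c Q v Hm H1 \<longleftrightarrow> (\<exists>a za b zb. Hm = halfplane a za \<and> H1 = halfplane b zb \<and>
    (a, za) \<in> edges Q \<and> (b, zb) \<in> edges Q \<and> rvec a \<bullet> v = za \<and> rvec b \<bullet> v = zb \<and>
    cross2 (rvec a) (rvec b) < 0 \<and> cross2 (rvec a) (rvec c) \<le> 0 \<and> cross2 (rvec c) (rvec b) \<le> 0)" (is "_ \<longleftrightarrow> ?rhs")
proof
  assume cf: "corner_facets c Q v Hm H1"
  obtain a za where a: "(a, za) \<in> edges Q" "Hm = halfplane a za"
    using cf facet_halfplane_iff_edge[OF Q] unfolding corner_facets_def by blast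
  obtain b zb where b: "(b, zb) \<in> edges Q" "H1 = halfplane b zb"
    using cf facet_halfplane_iff_edge[OF Q] unfolding corner_facets_def by blast
  have an: "a \<noteq> 0" "b \<noteq> 0" using edgesD(1) primitive_nonzero a b by blast+
  have v: "rvec a \<bullet> v = za" "rvec b \<bullet> v = zb"
    using cf unfolding corner_facets_def a(2) b(2) frontier_halfplane[OF an(1)] frontier_halfplane[OF an(2)] by auto
  obtain am zm a1 z1 where m: "halfplane a za = halfplane am zm" "halfplane b zb = halfplane a1 z1"
    "am $ 1 * a1 $ 2 - am $ 2 * a1 $ 1 < 0" "rvec c \<in> convex_cone hull {rvec am, rvec a1}"
    using cf unfolding corner_facets_def a(2) b(2) by blast
  have "am \<noteq> 0" "a1 \<noteq> 0" using m(3) by auto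
  then obtain \<mu> \<nu> where \<mu>: "\<mu> > 0" "rvec am = \<mu> *\<^sub>R rvec a" "\<nu> > 0" "rvec a1 = \<nu> *\<^sub>R rvec b"
    using halfplane_eq_scaled m(1,2) an by meson
  have "cross2 (rvec am) (rvec a1) = of_int (am $ 1 * a1 $ 2 - am $ 2 * a1 $ 1)" by (simp add: cross2_def)
  then have "cross2 (rvec am) (rvec a1) < 0" using m(3) by linarith
  then have ab: "cross2 (rvec a) (rvec b) < 0" using \<mu> by (simp add: cross2_scale mult_less_0_iff)
  obtain \<alpha> \<beta> where "0 \<le> \<alpha>" "0 \<le> \<beta>" "rvec c = \<alpha> *\<^sub>R rvec am + \<beta> *\<^sub>R rvec a1"
    using m(4) unfolding convex_cone_hull_2 by blast
  then have c: "rvec c = (\<alpha> * \<mu>) *\<^sub>R rvec a + (\<beta> * \<nu>) *\<^sub>R rvec b" "0 \<le> \<alpha> * \<mu>" "0 \<le> \<beta> * \<nu>" using \<mu> by auto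
  have "cross2 (rvec a) (rvec c) = (\<beta> * \<nu>) * cross2 (rvec a) (rvec b)"
    "cross2 (rvec c) (rvec b) = (\<alpha> * \<mu>) * cross2 (rvec a) (rvec b)"
    unfolding c(1) by (simp_all add: cross2_def algebra_simps)
  then have "cross2 (rvec a) (rvec c) \<le> 0" "cross2 (rvec c) (rvec b) \<le> 0"
    using c(2,3) ab by (simp_all add: mult_nonneg_nonpos)
  then show ?rhs using a b v ab by blast
next
  assume ?rhs
  then obtain a za b zb where H: "Hm = halfplane a za" "H1 = halfplane b zb"
    and e: "(a, za) \<in> edges Q" "(b, zb) \<in> edges Q" and v: "rvec a \<bullet> v = za" "rvec b \<bullet> v = zb"
    and c: "cross2 (rvec a) (rvec b) < 0" "cross2 (rvec a) (rvec c) \<le> 0" "cross2 (rvec c) (rvec b) \<le> 0" by blast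
  have an: "a \<noteq> 0" "b \<noteq> 0" using edgesD(1) primitive_nonzero e by blast+
  have "za \<in> \<rat>" "zb \<in> \<rat>" using rat e by auto
  then have "facet_halfplane Q Hm" "facet_halfplane Q H1" using facet_halfplane_iff_edge[OF Q] e H by blast+
  moreover have "v \<in> frontier Hm" "v \<in> frontier H1"
    unfolding H frontier_halfplane[OF an(1)] frontier_halfplane[OF an(2)] using v by auto
  moreover have "real_of_int (a $ 1 * b $ 2 - a $ 2 * b $ 1) < 0" using c(1) by (simp add: cross2_def)
  then have "a $ 1 * b $ 2 - a $ 2 * b $ 1 < 0" by linarith
  moreover obtain \<alpha> \<beta> where "rvec c = \<alpha> *\<^sub>R rvec a + \<beta> *\<^sub>R rvec b" "0 \<le> \<alpha>" "0 \<le> \<beta>"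
    using cross2_cone[OF c(1), of "rvec c"] c(2,3) by metis
  then have "rvec c \<in> convex_cone hull {rvec a, rvec b}" unfolding convex_cone_hull_2 by blast
  ultimately show "corner_facets c Q v Hm H1" unfolding corner_facets_def using H by blast
qed

section \<open>Breaking ties by a generic objective\<close>

lemma turn_cross2: "cross2 a (turn c) = - (a \<bullet> c)" "a \<bullet> turn c = cross2 a c"
  by (simp_all add: cross2_def inner_2 algebra_simps)

lemma optimal_vertexD:
  assumes "optimal_vertex c Q v"
  shows "v \<in> Q" "v extreme_point_of Q" "\<And>x. x \<in> Q \<Longrightarrow> rvec c \<bullet> x \<le> rvec c \<bullet> v"
    "\<And>w. w extreme_point_of Q \<Longrightarrow> rvec c \<bullet> w = rvec c \<bullet> v \<Longrightarrow> turn (rvec c) \<bullet> v \<le> turn (rvec c) \<bullet> w"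
proof -
  have "rvec (vector [c $ 2, - c $ 1]) = turn (rvec c)" by (simp add: vec_eq_2)
  then show "v \<in> Q" "v extreme_point_of Q" "\<And>x. x \<in> Q \<Longrightarrow> rvec c \<bullet> x \<le> rvec c \<bullet> v"
    "\<And>w. w extreme_point_of Q \<Longrightarrow> rvec c \<bullet> w = rvec c \<bullet> v \<Longrightarrow> turn (rvec c) \<bullet> v \<le> turn (rvec c) \<bullet> w"
    using assms unfolding optimal_vertex_def extreme_point_of_def by auto
qed

text \<open>If \<open>c\<close> were parallel to \<open>a\<close>, the optimal face would be the
  \<open>a\<close>-edge, extending from \<open>v\<close> backwards against
  \<open>turn (rvec c)\<close>. By \<open>bd\<close> it ends there in an earlier optimal vertex,
  contrary to the choice of \<open>v\<close>.\<close>

lemma first_facet_strict: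
  assumes Q: "closed Q" "convex Q" and v: "optimal_vertex c Q v" and c0: "c \<noteq> 0"
    and e: "(a, za) \<in> edges Q" "(b, zb) \<in> edges Q" "rvec a \<bullet> v = za" "rvec b \<bullet> v = zb"
    and ab: "cross2 (rvec a) (rvec b) < 0" and ac: "cross2 (rvec a) (rvec c) \<le> 0" and cb: "cross2 (rvec c) (rvec b) \<le> 0"
    and bd: "\<And>x. x \<in> Q \<Longrightarrow> \<exists>t\<ge>0. x - t *\<^sub>R turn (rvec c) \<notin> Q"
  shows "cross2 (rvec a) (rvec c) < 0"
proof (rule ccontr)
  assume "\<not> ?thesis"
  then have z: "cross2 (rvec a) (rvec c) = 0" using ac by simp
  obtain \<alpha> \<beta> where "rvec c = \<alpha> *\<^sub>R rvec a + \<beta> *\<^sub>R rvec b" "\<beta> = cross2 (rvec a) (rvec c) / cross2 (rvec a) (rvec b)" "\<alpha> \<ge> 0"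
    using cross2_cone[OF ab, of "rvec c"] cb by metis
  then have c: "rvec c = \<alpha> *\<^sub>R rvec a" "\<alpha> \<ge> 0" using z by simp_all
  have "rvec c \<noteq> 0" using c0 by simp
  then have \<alpha>: "\<alpha> > 0" using c by (cases "\<alpha> = 0") auto
  obtain u where u: "u \<in> Q" "u \<noteq> v" "rvec a \<bullet> u = za" using edgesD(4)[OF e(1)] by blast
  have a0: "rvec a \<noteq> 0" using edgesD(2)[OF e(1)] .
  define \<tau> where "\<tau> = turn (rvec c)"
  have \<tau>: "\<tau> \<noteq> 0" "rvec a \<bullet> \<tau> = 0" unfolding \<tau>_def turn_cross2 using z \<open>rvec c \<noteq> 0\<close> by simp_all
  have "rvec a \<bullet> (u - v) = 0" using u e(3) by (simp add: inner_diff_right)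
  then obtain r where r: "u - v = r *\<^sub>R \<tau>" using parallel_if_orthogonal[OF a0 \<tau>(2) _ \<tau>(1)] by blast
  have "rvec b \<bullet> \<tau> = \<alpha> * - cross2 (rvec a) (rvec b)"
    unfolding \<tau>_def turn_cross2 c(1) cross2_scale using cross2_swap[of "rvec b" "rvec a"] by simp
  then have b\<tau>: "rvec b \<bullet> \<tau> > 0" using \<alpha> ab by (simp add: mult_pos_neg)
  have "rvec b \<bullet> (u - v) \<le> 0" using edgesD(3)[OF e(2) u(1)] e(4) by (simp add: inner_diff_right)
  then have "r * (rvec b \<bullet> \<tau>) \<le> 0" unfolding r by simp
  then have r0: "r \<le> 0" using b\<tau> by (simp add: mult_le_0_iff)
  have "r \<noteq> 0" using r u by auto
  then have r0: "r < 0" using r0 by simp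
  obtain T where T: "T \<ge> 0" "u + T *\<^sub>R (- \<tau>) \<notin> Q" using bd[OF u(1)] by (auto simp: \<tau>_def)
  obtain t where t: "t \<ge> 0" "u + t *\<^sub>R (- \<tau>) \<in> Q" "\<forall>s>0. u + t *\<^sub>R (- \<tau>) + s *\<^sub>R (- \<tau>) \<notin> Q"
    using ray_end[OF Q u(1) T] by blast
  define y where "y = u + t *\<^sub>R (- \<tau>)"
  have ay: "rvec a \<bullet> y = za" using u \<tau> by (simp add: y_def inner_diff_right inner_add_right)
  have "y extreme_point_of Q"
  proof (rule supported_line_end_extreme[of y Q "rvec a" "- \<tau>"])
    show "y \<in> Q" using t by (simp add: y_def)
    show "rvec a \<bullet> x \<le> rvec a \<bullet> y" if "x \<in> Q" for x using edgesD(3)[OF e(1) that] ay by simp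
    show "y + s *\<^sub>R (- \<tau>) \<notin> Q" if "s > 0" for s using t(3) that unfolding y_def by blast
  qed (use a0 \<tau> in auto)
  moreover have "rvec c \<bullet> y = rvec c \<bullet> v" unfolding c(1) using ay e(3) by simp
  ultimately have "\<tau> \<bullet> v \<le> \<tau> \<bullet> y" unfolding \<tau>_def by (rule optimal_vertexD(4)[OF v])
  moreover have "y = v + (r - t) *\<^sub>R \<tau>"
  proof -
    have "u = v + r *\<^sub>R \<tau>" using r by (simp add: algebra_simps)
    then show ?thesis by (simp add: y_def algebra_simps)
  qed
  ultimately have "(r - t) * (\<tau> \<bullet> \<tau>) \<ge> 0" by (simp add: inner_add_right)
  moreover have "\<tau> \<bullet> \<tau> > 0" using \<tau> by simp
  moreover have "r - t < 0" using r0 t by simp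
  ultimately show False by (simp add: zero_le_mult_iff)
qed

text \<open>The backward ray at \<open>v\<close> satisfies the \<open>a\<close>-inequality, which
  reverses the sign in \<open>ac\<close>. So the optimal facet is unbounded backwards and takes the
  last place in the numbering.\<close>

lemma last_facet_parallel:
  assumes v: "optimal_vertex c Q v" and c0: "c \<noteq> 0"
    and e: "(a, za) \<in> edges Q" "rvec a \<bullet> v = za"
    and ab: "cross2 (rvec a) (rvec b) < 0" and ac: "cross2 (rvec a) (rvec c) \<le> 0" and cb: "cross2 (rvec c) (rvec b) \<le> 0"
    and ray: "\<And>x t. x \<in> Q \<Longrightarrow> t \<ge> 0 \<Longrightarrow> x - t *\<^sub>R turn (rvec c) \<in> Q"
  shows "cross2 (rvec a) (rvec c) = 0" "cross2 (rvec c) (rvec b) < 0"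
proof -
  have "v - 1 *\<^sub>R turn (rvec c) \<in> Q" using ray[OF optimal_vertexD(1)[OF v], of 1] by simp
  then have "rvec a \<bullet> (v - 1 *\<^sub>R turn (rvec c)) \<le> za" by (rule edgesD(3)[OF e(1)])
  then have "cross2 (rvec a) (rvec c) \<ge> 0" using e(2) by (simp add: inner_diff_right turn_cross2)
  then show z: "cross2 (rvec a) (rvec c) = 0" using ac by simp
  show "cross2 (rvec c) (rvec b) < 0"
  proof (rule ccontr)
    assume "\<not> ?thesis"
    then have "cross2 (rvec c) (rvec b) = 0" using cb by simp
    then have "rvec c = 0" using cramer_2[of "rvec a" "rvec b" "rvec c"] ab z by simp
    then show False using c0 by simp
  qed
qed

text \<open>\<open>\<kappa>\<close> is 1 or -1; the rotation is too small to change a strict turn relative to a normal with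
  entries bounded by \<open>M\<close>.\<close>

definition generic_objective :: "int^2 \<Rightarrow> int \<Rightarrow> real \<Rightarrow> real^2" where
  "generic_objective c M \<kappa> =
     rvec c - (\<kappa> / (1 + of_int (M * (\<bar>c $ 1\<bar> + \<bar>c $ 2\<bar>)))) *\<^sub>R turn (rvec c)"

text \<open>The determinant of \<open>a\<close> and the rotated objective is
  \<open>w + \<kappa> * \<epsilon> * q\<close>, where the integers \<open>w\<close> and
  \<open>q\<close> are the determinant and the inner product of \<open>a\<close> and
  \<open>c\<close>. As the absolute value of \<open>q\<close> is at most \<open>R\<close> and
  \<open>\<epsilon>\<close> is the inverse of \<open>1 + R\<close>, the correction is below 1 and
  decides only if \<open>w = 0\<close>; then \<open>q\<close> is nonzero for nonzero
  \<open>a\<close>.\<close>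

lemma generic_objective_sign:
  assumes M: "M \<ge> 0" "\<bar>a $ 1\<bar> \<le> M" "\<bar>a $ 2\<bar> \<le> M" and \<kappa>: "\<kappa> = 1 \<or> \<kappa> = -1" and c0: "c \<noteq> 0"
  shows "cross2 (rvec a) (rvec c) < 0 \<Longrightarrow> cross2 (rvec a) (generic_objective c M \<kappa>) < 0"
    "cross2 (rvec a) (rvec c) > 0 \<Longrightarrow> cross2 (rvec a) (generic_objective c M \<kappa>) > 0"
    "a \<noteq> 0 \<Longrightarrow> cross2 (rvec a) (generic_objective c M \<kappa>) \<noteq> 0"
    "cross2 (rvec a) (rvec c) = 0 \<Longrightarrow> \<kappa> * (rvec a \<bullet> rvec c) > 0 \<Longrightarrow> cross2 (rvec a) (generic_objective c M \<kappa>) > 0"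
    "cross2 (rvec a) (rvec c) = 0 \<Longrightarrow> \<kappa> * (rvec a \<bullet> rvec c) < 0 \<Longrightarrow> cross2 (rvec a) (generic_objective c M \<kappa>) < 0"
proof -
  define R where "R = M * (\<bar>c $ 1\<bar> + \<bar>c $ 2\<bar>)"
  define \<epsilon> where "\<epsilon> = 1 / (1 + real_of_int R)"
  have R0: "R \<ge> 0" using M by (simp add: R_def)
  have \<epsilon>: "\<epsilon> > 0" using R0 by (simp add: \<epsilon>_def)
  define q where "q = idot a c"
  have "\<bar>q\<bar> \<le> \<bar>a $ 1\<bar> * \<bar>c $ 1\<bar> + \<bar>a $ 2\<bar> * \<bar>c $ 2\<bar>" unfolding q_def idot_def
    by (rule order_trans[OF abs_triangle_ineq]) (simp add: abs_mult)
  also have "\<dots> \<le> M * \<bar>c $ 1\<bar> + M * \<bar>c $ 2\<bar>" using M by (intro add_mono mult_right_mono) auto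
  finally have "\<bar>q\<bar> \<le> R" by (simp add: R_def algebra_simps)
  then have "\<bar>real_of_int q\<bar> < 1 + real_of_int R" by linarith
  then have "\<epsilon> * \<bar>real_of_int q\<bar> < 1" unfolding \<epsilon>_def using R0 by simp
  then have small: "\<bar>\<kappa> * \<epsilon> * real_of_int q\<bar> < 1" using \<kappa> \<epsilon> by (auto simp: abs_mult)
  define w where "w = - width a c"
  have cw: "cross2 (rvec a) (rvec c) = of_int w" by (simp add: width_cross2 w_def)
  have qc: "rvec a \<bullet> rvec c = of_int q" by (simp add: q_def inner_rvec)
  have d: "cross2 (rvec a) (generic_objective c M \<kappa>) = of_int w + \<kappa> * \<epsilon> * of_int q"
  proof -
    have "generic_objective c M \<kappa> = rvec c - (\<kappa> * \<epsilon>) *\<^sub>R turn (rvec c)"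
      by (simp add: generic_objective_def \<epsilon>_def R_def)
    then have "cross2 (rvec a) (generic_objective c M \<kappa>) = cross2 (rvec a) (rvec c - (\<kappa> * \<epsilon>) *\<^sub>R turn (rvec c))"
      by (rule arg_cong)
    also have "\<dots> = cross2 (rvec a) (rvec c) - (\<kappa> * \<epsilon>) * cross2 (rvec a) (turn (rvec c))"
      by (simp add: cross2_def algebra_simps)
    finally have "cross2 (rvec a) (generic_objective c M \<kappa>) = cross2 (rvec a) (rvec c) - (\<kappa> * \<epsilon>) * cross2 (rvec a) (turn (rvec c))" .
    then show ?thesis unfolding turn_cross2 cw qc by simp
  qed
  show 1: "cross2 (rvec a) (generic_objective c M \<kappa>) < 0" if "cross2 (rvec a) (rvec c) < 0"
  proof -
    have "w \<le> -1" using that cw by simp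
    then have "real_of_int w \<le> -1" by linarith
    then show ?thesis unfolding d using small by linarith
  qed
  show 2: "cross2 (rvec a) (generic_objective c M \<kappa>) > 0" if "cross2 (rvec a) (rvec c) > 0"
  proof -
    have "w \<ge> 1" using that cw by simp
    then have "real_of_int w \<ge> 1" by linarith
    then show ?thesis unfolding d using small by linarith
  qed
  show 3: "cross2 (rvec a) (generic_objective c M \<kappa>) > 0" if "cross2 (rvec a) (rvec c) = 0" "\<kappa> * (rvec a \<bullet> rvec c) > 0"
  proof -
    have "\<epsilon> * (\<kappa> * of_int q) > 0" using mult_pos_pos[OF \<epsilon> that(2)] unfolding qc .
    then show ?thesis unfolding d using that cw by (simp add: mult_ac)
  qed
  show 4: "cross2 (rvec a) (generic_objective c M \<kappa>) < 0" if "cross2 (rvec a) (rvec c) = 0" "\<kappa> * (rvec a \<bullet> rvec c) < 0"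
  proof -
    have "\<epsilon> * (\<kappa> * of_int q) < 0" using mult_pos_neg[OF \<epsilon> that(2)] unfolding qc .
    then show ?thesis unfolding d using that cw by (simp add: mult_ac)
  qed
  show "cross2 (rvec a) (generic_objective c M \<kappa>) \<noteq> 0" if a0: "a \<noteq> 0"
  proof (cases "cross2 (rvec a) (rvec c) = 0")
    case True
    have "rvec a \<bullet> rvec c \<noteq> 0"
    proof
      assume "rvec a \<bullet> rvec c = 0"
      then have 0: "rvec c \<bullet> rvec a = 0" "turn (rvec c) \<bullet> rvec a = 0"
        using True turn_cross2(2)[of "rvec a" "rvec c"] by (simp_all add: inner_commute)
      have "rvec c \<noteq> 0" using c0 by simp
      then obtain s where "turn (rvec c) = s *\<^sub>R rvec c" using parallel_normals[of "rvec a" "rvec c" "turn (rvec c)"] 0 a0 by auto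
      then have "rvec c \<bullet> turn (rvec c) = s * (rvec c \<bullet> rvec c)" by simp
      then have "s = 0" using \<open>rvec c \<noteq> 0\<close> by simp
      then show False using \<open>turn (rvec c) = s *\<^sub>R rvec c\<close> \<open>rvec c \<noteq> 0\<close> by simp
    qed
    then have "\<kappa> * (rvec a \<bullet> rvec c) > 0 \<or> \<kappa> * (rvec a \<bullet> rvec c) < 0" using \<kappa> by auto
    then show ?thesis using 3 4 True by force
  next
    case False
    then have "cross2 (rvec a) (rvec c) < 0 \<or> cross2 (rvec a) (rvec c) > 0" by linarith
    then show ?thesis using 1 2 by force
  qed
qed

section \<open>Polyhedra of dimension one\<close>

lemma one_dim_line:
  assumes fin: "finite S" and d: "aff_dim (poly_set S) = 1"
  obtains a z where "primitive a" "poly_set S \<subseteq> {x. rvec a \<bullet> x = z}" "affine hull (poly_set S) = {x. rvec a \<bullet> x = z}"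
proof -
  let ?Q = "poly_set S"
  have cQ: "convex ?Q" using polyhedron_imp_convex[OF polyhedron_poly_set[OF fin]] .
  have "?Q \<noteq> {}" using d by auto
  then obtain x where x: "x \<in> ?Q" by blast
  have "?Q \<noteq> {x}" using d by (metis aff_dim_sing zero_neq_one)
  then obtain y where y: "y \<in> ?Q" "x \<noteq> y" using x by blast
  have "interior ?Q = {}" using convex_aff_dim_interior[OF cQ] d by auto
  then obtain n k where n: "n \<noteq> 0" "?Q \<subseteq> {x. n \<bullet> x = k}" using empty_interior_subset_hyperplane[OF cQ] by metis
  have nk: "n \<bullet> w = k" if "w \<in> ?Q" for w using n(2) that by blast
  obtain A b \<mu> where A: "A \<noteq> 0" "rvec A = \<mu> *\<^sub>R n" "b = \<mu> * k"
    using poly_set_tight_row[OF fin n(1) eq_refl[OF nk] x y nk[OF x] nk[OF y(1)]] by blast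
  obtain a g where a: "primitive a" "g > 0" "A = g *s a" using primitive_part[OF A(1)] by blast
  have line: "rvec a \<bullet> w = b / of_int g" if "w \<in> ?Q" for w
  proof -
    have "of_int g * (rvec a \<bullet> w) = rvec A \<bullet> w" unfolding a(3) rvec_arith by simp
    also have "\<dots> = b" using n(2) that A by auto
    finally show ?thesis using a(2) by (simp add: field_simps)
  qed
  have a0: "rvec a \<noteq> 0" using primitive_nonzero[OF a(1)] by simp
  have "{x. rvec a \<bullet> x = b / of_int g} = affine hull {x, y}"
    by (rule affine_hull_2_eq_line[symmetric]) (use a0 line x y in auto)
  also have "\<dots> \<subseteq> affine hull ?Q" using x y by (intro hull_mono) auto
  finally have "{x. rvec a \<bullet> x = b / of_int g} \<subseteq> affine hull ?Q" .
  moreover have "affine hull ?Q \<subseteq> {x. rvec a \<bullet> x = b / of_int g}"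
    by (rule hull_minimal) (use line in \<open>auto simp: affine_hyperplane\<close>)
  ultimately show thesis using that[OF a(1)] line by blast
qed

text \<open>Guarantees at least one facet in dimension one, where the bound must admit a
  cut.\<close>

lemma one_dim_facet:
  assumes fin: "finite S" and d: "aff_dim (poly_set S) = 1" and p: "pointed (poly_set S)"
  shows "\<exists>F. F facet_of poly_set S"
proof -
  let ?Q = "poly_set S"
  note P = polyhedron_poly_set[OF fin]
  obtain a z where a: "primitive a" "?Q \<subseteq> {x. rvec a \<bullet> x = z}" using one_dim_line[OF fin d] by metis
  have a0: "rvec a \<noteq> 0" using primitive_nonzero[OF a(1)] by simp
  have "?Q \<noteq> {}" using d by auto
  then obtain x where x: "x \<in> ?Q" by blast
  have t0: "turn (rvec a) \<noteq> 0" using a0 by simp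
  obtain \<sigma> t where \<sigma>: "\<sigma> = turn (rvec a) \<or> \<sigma> = - turn (rvec a)" "t \<ge> 0" "x + t *\<^sub>R \<sigma> \<in> ?Q" "0 \<bullet> \<sigma> \<ge> (0::real)"
    "\<And>s. s > 0 \<Longrightarrow> x + t *\<^sub>R \<sigma> + s *\<^sub>R \<sigma> \<notin> ?Q"
    by (rule line_end[OF polyhedron_imp_closed[OF P] polyhedron_imp_convex[OF P] p x t0, of 0 0], simp) (rule that)
  have "(x + t *\<^sub>R \<sigma>) extreme_point_of ?Q"
  proof (rule supported_line_end_extreme[OF \<sigma>(3) a0 _ _ _ \<sigma>(5)])
    show "rvec a \<bullet> w \<le> rvec a \<bullet> (x + t *\<^sub>R \<sigma>)" if "w \<in> ?Q" for w
    proof -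
      have "rvec a \<bullet> w = z" "rvec a \<bullet> (x + t *\<^sub>R \<sigma>) = z" using a(2) that \<sigma>(3) by blast+
      then show ?thesis by simp
    qed
  qed (use \<sigma>(1) a0 in auto)
  then have "{x + t *\<^sub>R \<sigma>} facet_of ?Q" using d by (simp add: facet_of_def face_of_singleton)
  then show ?thesis by blast
qed

lemma one_dim_progress:
  assumes fin: "finite S" and d: "aff_dim (poly_set S) = 1" and p: "pointed (poly_set S)"
    and c: "\<And>x. x \<in> poly_set S \<Longrightarrow> rvec c \<bullet> x \<le> \<beta>"
  shows "\<exists>s'. clockwise_step c (Running (poly_set S) k) s'"
proof -
  let ?Q = "poly_set S"
  note P = polyhedron_poly_set[OF fin]
  obtain a z where a: "primitive a" "?Q \<subseteq> {x. rvec a \<bullet> x = z}" and aff: "affine hull ?Q = {x. rvec a \<bullet> x = z}"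
    using one_dim_line[OF fin d] by metis
  have an: "a \<noteq> 0" using primitive_nonzero[OF a(1)] .
  then have a0: "rvec a \<noteq> 0" by simp
  have aQ: "rvec a \<bullet> x = z" if "x \<in> ?Q" for x using a(2) that by blast
  show ?thesis
  proof (cases "affine hull ?Q \<inter> int_pts = {}")
    case True
    have "z \<noteq> of_int \<lfloor>z\<rfloor>"
    proof
      assume zf: "z = of_int \<lfloor>z\<rfloor>"
      obtain f where "idot a f = 1" using primitive_bezout[OF a(1)] by blast
      then have "rvec a \<bullet> rvec (\<lfloor>z\<rfloor> *s f) = z" using zf by (simp add: inner_rvec idot_simps)
      then have "rvec (\<lfloor>z\<rfloor> *s f) \<in> affine hull ?Q \<inter> int_pts" unfolding aff by simp
      then show False using True by blast
    qed
    then have lt: "of_int \<lfloor>z\<rfloor> < z" using of_int_floor_le[of z] by linarith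
    have "chvatal_cut ?Q a \<lfloor>z\<rfloor>" unfolding chvatal_cut_def
    proof (intro conjI an equals0I)
      fix x assume "x \<in> ?Q \<inter> {x. of_int (\<lfloor>z\<rfloor> + 1) \<le> rvec a \<bullet> x}"
      then have "of_int \<lfloor>z\<rfloor> + 1 \<le> z" using aQ by auto
      then show False by linarith
    qed
    moreover have "\<forall>x\<in>?Q. \<forall>y\<in>?Q. rvec a \<bullet> x = rvec a \<bullet> y" using aQ by simp
    moreover have "?Q \<inter> halfplane a (of_int \<lfloor>z\<rfloor>) = {}"
    proof (rule equals0I)
      fix x assume "x \<in> ?Q \<inter> halfplane a (of_int \<lfloor>z\<rfloor>)"
      then show False using aQ[of x] lt by (simp add: halfplane_def)
    qed
    ultimately show ?thesis using clockwise_step.line_lattice_free[OF d True] by blast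
  next
    case False
    then obtain p0 where p0: "rvec a \<bullet> rvec p0 = z" unfolding aff int_pts_eq by auto
    obtain f where f: "idot a f = 1" using primitive_bezout[OF a(1)] by blast
    have "?Q \<noteq> {}" using d by auto
    then obtain x where x: "x \<in> ?Q" by blast
    have t0: "turn (rvec a) \<noteq> 0" using a0 by simp
    obtain \<sigma> t where \<sigma>: "\<sigma> = turn (rvec a) \<or> \<sigma> = - turn (rvec a)" "t \<ge> 0" "x + t *\<^sub>R \<sigma> \<in> ?Q" "rvec c \<bullet> \<sigma> \<ge> 0"
      "\<And>s. s > 0 \<Longrightarrow> x + t *\<^sub>R \<sigma> + s *\<^sub>R \<sigma> \<notin> ?Q"
      by (rule line_end[OF polyhedron_imp_closed[OF P] polyhedron_imp_convex[OF P] p x t0, of "rvec c" \<beta>], erule c) (rule that)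
    define y where "y = x + t *\<^sub>R \<sigma>"
    have y: "y \<in> ?Q" "\<And>s. s > 0 \<Longrightarrow> y + s *\<^sub>R \<sigma> \<notin> ?Q" using \<sigma>(3,5) by (simp_all add: y_def)
    \<comment> \<open>\<open>u\<close> is the primitive direction in which \<open>c\<close> does not
      decrease, and \<open>w\<close> has value 1 on it, so the levels of \<open>w\<close> number the
      integer points of the line.\<close>
    define u where "u = (if \<sigma> = turn (rvec a) then turn a else - turn a)"
    define w where "w = (if \<sigma> = turn (rvec a) then turn f else - turn f)"
    have ru: "rvec u = \<sigma>" using \<sigma>(1) by (auto simp: u_def rvec_arith)
    have pu: "primitive u" using primitive_turn[OF a(1)] by (simp add: u_def primitive_def)
    have wu: "idot w u = 1" using f unfolding w_def u_def
      by (simp add: idot_simps idot_turn_turn) (simp add: idot_def algebra_simps)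
    have w0: "w \<noteq> 0" using wu by (auto simp: idot_def)
    have w\<sigma>: "rvec w \<bullet> \<sigma> = 1" unfolding ru[symmetric] inner_rvec wu by simp
    have a\<sigma>: "rvec a \<bullet> \<sigma> = 0" using \<sigma>(1) by auto
    have \<sigma>0: "\<sigma> \<noteq> 0" using w\<sigma> by auto
    have par: "q = r + (rvec w \<bullet> q - rvec w \<bullet> r) *\<^sub>R \<sigma>" if "rvec a \<bullet> q = z" "rvec a \<bullet> r = z" for q r
    proof -
      have "rvec a \<bullet> (q - r) = 0" using that by (simp add: inner_diff_right)
      then obtain s where s: "q - r = s *\<^sub>R \<sigma>" using parallel_if_orthogonal[OF a0 a\<sigma> _ \<sigma>0] by blast
      then have "rvec w \<bullet> (q - r) = s" using w\<sigma> by simp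
      then have "s = rvec w \<bullet> q - rvec w \<bullet> r" by (simp add: inner_diff_right)
      then show ?thesis using s by (metis add.commute diff_add_cancel)
    qed
    define \<omega> where "\<omega> = rvec w \<bullet> y"
    have wle: "rvec w \<bullet> q \<le> \<omega>" if q: "q \<in> ?Q" for q
    proof (rule ccontr)
      assume "\<not> rvec w \<bullet> q \<le> \<omega>"
      then have "rvec w \<bullet> q - rvec w \<bullet> y > 0" by (simp add: \<omega>_def)
      then have "y + (rvec w \<bullet> q - rvec w \<bullet> y) *\<^sub>R \<sigma> \<notin> ?Q" by (rule y(2))
      then show False using par[OF aQ[OF q] aQ[OF y(1)]] q by simp
    qed
    define T where "T = halfplane w (of_int \<lfloor>\<omega>\<rfloor>)"
    have cc: "chvatal_cut ?Q w \<lfloor>\<omega>\<rfloor>" unfolding chvatal_cut_def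
    proof (intro conjI w0 equals0I)
      fix x assume "x \<in> ?Q \<inter> {x. of_int (\<lfloor>\<omega>\<rfloor> + 1) \<le> rvec w \<bullet> x}"
      then have "of_int \<lfloor>\<omega>\<rfloor> + 1 \<le> \<omega>" using wle[of x] by auto
      then show False by linarith
    qed
    have dirs: "\<forall>x\<in>?Q. \<forall>y\<in>?Q. \<exists>t. x - y = t *\<^sub>R rvec u"
    proof (intro ballI)
      fix q r assume "q \<in> ?Q" "r \<in> ?Q"
      then have "q = r + (rvec w \<bullet> q - rvec w \<bullet> r) *\<^sub>R \<sigma>" using par aQ by blast
      then have "q - r = (rvec w \<bullet> q - rvec w \<bullet> r) *\<^sub>R rvec u" unfolding ru by (metis add_diff_cancel_left')
      then show "\<exists>t. q - r = t *\<^sub>R rvec u" by blast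
    qed
    have wu1: "\<bar>w $ 1 * u $ 1 + w $ 2 * u $ 2\<bar> = 1" using wu by (simp add: idot_def)
    note rule = clockwise_step.line_lattice[OF d False pu dirs cc wu1 T_def]
    show ?thesis
    proof (cases "?Q \<inter> T = {}")
      case True
      then show ?thesis using rule[of Infeasible] by blast
    next
      case nonempty: False
      then obtain q where q: "q \<in> ?Q" "rvec w \<bullet> q \<le> of_int \<lfloor>\<omega>\<rfloor>" by (auto simp: T_def halfplane_def)
      \<comment> \<open>The integer point on the level of the cut, the last one not beyond the end
        \<open>y\<close>. If the cut leaves a point \<open>q\<close>, it lies between
        \<open>q\<close> and \<open>y\<close>, hence in the set.\<close>
      define r where "r = p0 + (\<lfloor>\<omega>\<rfloor> - idot w p0) *s u"
      have rr: "rvec r = rvec p0 + of_int (\<lfloor>\<omega>\<rfloor> - idot w p0) *\<^sub>R \<sigma>" unfolding r_def rvec_arith ru ..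
      have ar: "rvec a \<bullet> rvec r = z" unfolding rr using p0 a\<sigma> by (simp add: inner_add_right)
      have wr: "rvec w \<bullet> rvec r = of_int \<lfloor>\<omega>\<rfloor>" unfolding rr using w\<sigma> by (simp add: inner_add_right inner_rvec)
      have rQ: "rvec r \<in> ?Q"
      proof (cases "rvec w \<bullet> q = \<omega>")
        case True
        then have "of_int \<lfloor>\<omega>\<rfloor> = \<omega>" using q(2) of_int_floor_le[of \<omega>] by linarith
        then have "rvec r = q" using par[OF ar aQ[OF q(1)]] wr True by simp
        then show ?thesis using q by simp
      next
        case False
        define s where "s = (of_int \<lfloor>\<omega>\<rfloor> - rvec w \<bullet> q) / (\<omega> - rvec w \<bullet> q)"
        have pos: "\<omega> - rvec w \<bullet> q > 0" using False wle[OF q(1)] by simp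
        have s: "0 \<le> s" "s \<le> 1" "s * (\<omega> - rvec w \<bullet> q) = of_int \<lfloor>\<omega>\<rfloor> - rvec w \<bullet> q"
          using pos q(2) unfolding s_def by (simp_all add: divide_le_eq_1)
        have yq: "y = q + (\<omega> - rvec w \<bullet> q) *\<^sub>R \<sigma>" using par[OF aQ[OF y(1)] aQ[OF q(1)]] unfolding \<omega>_def .
        have "rvec r = q + (of_int \<lfloor>\<omega>\<rfloor> - rvec w \<bullet> q) *\<^sub>R \<sigma>" using par[OF ar aQ[OF q(1)]] unfolding wr .
        also have "\<dots> = (1 - s) *\<^sub>R q + s *\<^sub>R (q + (\<omega> - rvec w \<bullet> q) *\<^sub>R \<sigma>)" unfolding s(3)[symmetric] by (simp add: algebra_simps)
        also have "\<dots> = (1 - s) *\<^sub>R q + s *\<^sub>R y" using yq by simp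
        finally show ?thesis using polyhedron_imp_convex[OF P] q(1) y(1) s(1,2) by (simp add: convexD)
      qed
      have opt: "rvec c \<bullet> x' \<le> rvec c \<bullet> rvec r" if x': "x' \<in> ?Q \<inter> T" for x'
      proof -
        have x1: "x' \<in> ?Q" "rvec w \<bullet> x' \<le> of_int \<lfloor>\<omega>\<rfloor>" using x' by (auto simp: T_def halfplane_def)
        have "rvec r = x' + (of_int \<lfloor>\<omega>\<rfloor> - rvec w \<bullet> x') *\<^sub>R \<sigma>" using par[OF ar aQ[OF x1(1)]] unfolding wr .
        then have "rvec c \<bullet> rvec r = rvec c \<bullet> x' + (of_int \<lfloor>\<omega>\<rfloor> - rvec w \<bullet> x') * (rvec c \<bullet> \<sigma>)" by (simp add: inner_add_right)
        moreover have "(of_int \<lfloor>\<omega>\<rfloor> - rvec w \<bullet> x') * (rvec c \<bullet> \<sigma>) \<ge> 0" using x1 \<sigma>(4) by (intro mult_nonneg_nonneg) auto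
        ultimately show ?thesis by simp
      qed
      have "rvec r \<in> ?Q \<inter> T \<inter> int_pts" using rQ wr by (simp add: T_def halfplane_def)
      then show ?thesis using rule[of "Optimal (rvec r)"] opt by blast
    qed
  qed
qed

section \<open>Runs of the algorithm\<close>

lemma is_tilt_valid:
  assumes "is_tilt H1 H2 T" and x: "x \<in> H1" "x \<in> H2" "x \<in> int_pts"
  shows "x \<in> T"
proof -
  let ?C = "H1 \<inter> H2"
  obtain W0 W1 p where sd: "split_disjunction W0 W1" and
    T: "if ?C \<inter> W1 = {} then T = W0 else \<exists>x' y'. lattice_gap (frontier W1) ?C x' y' \<and> split_cut ?C W0 W1 T \<and>
      p \<in> frontier T \<and> y' \<in> frontier T"
    using assms(1) unfolding is_tilt_def Let_def by blast
  obtain a k where a: "W0 = halfplane a (of_int k)" "W1 = {x. rvec a \<bullet> x \<ge> of_int (k + 1)}"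
    using sd unfolding split_disjunction_def by blast
  obtain q where q: "x = rvec q" using x(3) by (auto simp: int_pts_eq)
  have "idot a q \<le> k \<or> k + 1 \<le> idot a q" by linarith
  then have W: "x \<in> W0 \<or> x \<in> W1"
    unfolding a q by (metis inner_rvec mem_Collect_eq of_int_le_iff rvec_in_halfplane)
  show ?thesis
  proof (cases "?C \<inter> W1 = {}")
    case True
    then show ?thesis using T W x by auto
  next
    case False
    then have "split_cut ?C W0 W1 T" using T by auto
    then have "convex hull (?C \<inter> W0 \<union> ?C \<inter> W1) \<subseteq> T" unfolding split_cut_def by blast
    moreover have "x \<in> convex hull (?C \<inter> W0 \<union> ?C \<inter> W1)" by (rule hull_inc) (use W x in blast)
    ultimately show ?thesis by blast
  qed
qed

text \<open>Origin of the factor 3: the determinant is at most twice the square of the entry bound,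
  hence at most the third power of its maximum with 2.\<close>

lemma log_width_bound:
  assumes "width a b > 0" "\<bar>a $ 1\<bar> \<le> M" "\<bar>a $ 2\<bar> \<le> M" "\<bar>b $ 1\<bar> \<le> M" "\<bar>b $ 2\<bar> \<le> M"
  shows "log 2 (of_int (width a b)) \<le> 3 * log 2 (max 2 (of_int M))"
proof -
  define X where "X = max 2 (real_of_int M)"
  have M: "M \<ge> 0" using assms(2) by linarith
  have "width a b = b $ 1 * a $ 2 + b $ 2 * - a $ 1" by (simp add: width_def idot_def)
  also have "\<dots> \<le> \<bar>b $ 1\<bar> * \<bar>a $ 2\<bar> + \<bar>b $ 2\<bar> * \<bar>a $ 1\<bar>"
    by (intro add_mono) (metis abs_ge_self abs_mult, metis abs_ge_self abs_minus_cancel abs_mult)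
  also have "\<dots> \<le> M * M + M * M" using assms M by (intro add_mono mult_mono) auto
  finally have "real_of_int (width a b) \<le> of_int (M * M + M * M)" by linarith
  also have "\<dots> = 2 * (of_int M * of_int M)" by simp
  also have "\<dots> \<le> X * (X * X)" using M unfolding X_def by (intro mult_mono) auto
  finally have "log 2 (of_int (width a b)) \<le> log 2 (X * (X * X))"
    using assms(1) unfolding X_def by (subst log_le_cancel_iff) auto
  also have "\<dots> = 3 * log 2 X" by (simp add: log_mult X_def)
  finally show ?thesis by (simp add: X_def)
qed

text \<open>\<open>ray\<close> stands for unboundedness in direction \<open>- turn (rvec c)\<close>.
  Only its negation is an assumption on \<open>P\<close>, since that passes to subsets; the positive
  case has to be maintained under cuts and belongs to the invariant.\<close>

locale clockwise_run =
  fixes c :: "int^2" and ray :: bool and M :: int and N \<beta> :: real and P :: "(real^2) set"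
  assumes c0: "c \<noteq> 0" and M0: "M \<ge> 0" and pointed_P: "pointed P"
    and c_bounded: "\<And>x. x \<in> P \<Longrightarrow> rvec c \<bullet> x \<le> \<beta>"
    and not_ray: "\<And>x. \<not> ray \<Longrightarrow> x \<in> P \<Longrightarrow> \<exists>t\<ge>0. x - t *\<^sub>R turn (rvec c) \<notin> P"
begin

definition "L = log 2 (max 2 (real_of_int M))"

definition "d = generic_objective c M (if ray then -1 else 1)"

text \<open>The 2 beyond the budget covers the cut about to be made and, should that cut make the
  set one-dimensional, the final Chvatal cut. A budget is required only at a fractional corner,
  since an integral optimal vertex ends the run.\<close>

definition invariant :: "(real^2) set \<Rightarrow> nat \<Rightarrow> bool" where
  "invariant Q k \<longleftrightarrow>
     (\<exists>S. finite S \<and> Q = poly_set S) \<and> Q \<subseteq> P \<and> P \<inter> int_pts \<subseteq> Q \<and>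
     (ray \<longrightarrow> (\<forall>x\<in>Q. \<forall>t\<ge>0. x - t *\<^sub>R turn (rvec c) \<in> Q)) \<and>
     (aff_dim Q = 2 \<longrightarrow> finite (edges Q) \<and> (\<forall>(a, z)\<in>edges Q. z \<in> \<rat> \<and> \<bar>a $ 1\<bar> \<le> M \<and> \<bar>a $ 2\<bar> \<le> M)) \<and>
     real k \<le> N \<and> (aff_dim Q = 1 \<longrightarrow> real k + 1 \<le> N) \<and>
     (aff_dim Q = 2 \<longrightarrow> (\<forall>v a za b zb p f. corner d Q v a za b zb \<longrightarrow> v \<notin> int_pts \<longrightarrow>
        corner_data a za b zb p f \<longrightarrow> real k + budget d L Q a za b zb p f + 2 \<le> N))"

lemma L_ge_1: "L \<ge> 1"
proof -
  have "log 2 2 \<le> L" unfolding L_def by (subst log_le_cancel_iff) auto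
  then show ?thesis by simp
qed

lemma invariant_geometry:
  assumes "invariant Q k"
  shows "convex Q" "closed Q" "pointed Q" "\<And>x. x \<in> Q \<Longrightarrow> rvec c \<bullet> x \<le> \<beta>"
    "\<And>x. \<not> ray \<Longrightarrow> x \<in> Q \<Longrightarrow> \<exists>t\<ge>0. x - t *\<^sub>R turn (rvec c) \<notin> Q"
    "\<And>x t. ray \<Longrightarrow> x \<in> Q \<Longrightarrow> t \<ge> 0 \<Longrightarrow> x - t *\<^sub>R turn (rvec c) \<in> Q"
    "aff_dim Q = 2 \<Longrightarrow> interior Q \<noteq> {}"
proof -
  obtain S where S: "finite S" "Q = poly_set S" using assms by (auto simp: invariant_def)
  have QP: "Q \<subseteq> P" using assms by (simp add: invariant_def)
  show cQ: "convex Q" "closed Q" using polyhedron_poly_set[OF S(1)] S(2) polyhedron_imp_convex polyhedron_imp_closed by auto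
  show "pointed Q" using pointed_P QP unfolding pointed_def by blast
  show "rvec c \<bullet> x \<le> \<beta>" if "x \<in> Q" for x using c_bounded that QP by blast
  show "\<exists>t\<ge>0. x - t *\<^sub>R turn (rvec c) \<notin> Q" if "\<not> ray" "x \<in> Q" for x
    using not_ray[OF that(1), of x] that(2) QP by blast
  show "x - t *\<^sub>R turn (rvec c) \<in> Q" if "ray" "x \<in> Q" "t \<ge> 0" for x t
    using assms that unfolding invariant_def by blast
  show "interior Q \<noteq> {}" if "aff_dim Q = 2" using convex_aff_dim_interior[OF cQ(1)] that by blast
qed

lemma edge_bounds:
  assumes "invariant Q k" "aff_dim Q = 2" "(a, z) \<in> edges Q"
  shows "z \<in> \<rat>" "\<bar>a $ 1\<bar> \<le> M" "\<bar>a $ 2\<bar> \<le> M"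
  using assms by (auto simp: invariant_def)

lemma rational_edges:
  assumes "invariant Q k" "aff_dim Q = 2"
  shows "\<forall>(a, z)\<in>edges Q. z \<in> \<rat>"
  using edge_bounds(1)[OF assms] by blast

text \<open>The sense of rotation in \<open>d\<close> makes a facet with normal in direction
  \<open>c\<close> a right edge without a backward ray and a left one with it. This agrees with the
  numbering of the algorithm, so its two facets form a corner for \<open>d\<close>.\<close>

lemma corner_facets_corner:
  assumes inv: "invariant Q k" and Q2: "aff_dim Q = 2" and v: "optimal_vertex c Q v"
    and cf: "corner_facets c Q v Hm H1"
  obtains a za b zb where "Hm = halfplane a za" "H1 = halfplane b zb" "corner d Q v a za b zb"
    "ray \<Longrightarrow> cross2 (rvec a) (rvec c) = 0"
proof -
  note geo = invariant_geometry[OF inv]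
  obtain a za b zb where H: "Hm = halfplane a za" "H1 = halfplane b zb"
    and e: "(a, za) \<in> edges Q" "(b, zb) \<in> edges Q" and t: "rvec a \<bullet> v = za" "rvec b \<bullet> v = zb"
    and ab: "cross2 (rvec a) (rvec b) < 0" and ac: "cross2 (rvec a) (rvec c) \<le> 0" and cb: "cross2 (rvec c) (rvec b) \<le> 0"
    using cf[unfolded corner_facets_iff[OF geo(1) Q2 rational_edges[OF inv Q2]]] by blast
  obtain \<alpha> \<gamma> where cone: "rvec c = \<alpha> *\<^sub>R rvec a + \<gamma> *\<^sub>R rvec b"
    "\<alpha> = cross2 (rvec c) (rvec b) / cross2 (rvec a) (rvec b)" "\<gamma> = cross2 (rvec a) (rvec c) / cross2 (rvec a) (rvec b)"
    "\<alpha> > 0 \<longleftrightarrow> cross2 (rvec c) (rvec b) < 0" "\<gamma> > 0 \<longleftrightarrow> cross2 (rvec a) (rvec c) < 0"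
    using cross2_cone[OF ab, of "rvec c"] by metis
  have bc: "cross2 (rvec b) (rvec c) = - cross2 (rvec c) (rvec b)" by (rule cross2_swap)
  have \<kappa>: "(if ray then - 1 else 1) = (1::real) \<or> (if ray then - 1 else 1) = (-1::real)" by simp
  note sa = generic_objective_sign[OF M0 edge_bounds(2,3)[OF inv Q2 e(1)] \<kappa> c0, folded d_def]
  note sb = generic_objective_sign[OF M0 edge_bounds(2,3)[OF inv Q2 e(2)] \<kappa> c0, folded d_def]
  have ab_nz: "rvec a \<noteq> 0" "rvec b \<noteq> 0" using edgesD(2) e by blast+
  have signs: "cross2 (rvec a) d < 0 \<and> cross2 (rvec b) d > 0 \<and> (ray \<longrightarrow> cross2 (rvec a) (rvec c) = 0)"
  proof (cases ray)
    case True
    have ray: "x - u *\<^sub>R turn (rvec c) \<in> Q" if "x \<in> Q" "u \<ge> 0" for x u by (rule geo(6)[OF True that])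
    have z: "cross2 (rvec a) (rvec c) = 0" "cross2 (rvec c) (rvec b) < 0"
      by (rule last_facet_parallel[OF v c0 e(1) t(1) ab ac cb], erule (1) ray)+
    have "rvec c = \<alpha> *\<^sub>R rvec a" using cone(1,3) z(1) by simp
    then have "rvec a \<bullet> rvec c = \<alpha> * (rvec a \<bullet> rvec a)" by simp
    moreover have "\<alpha> * (rvec a \<bullet> rvec a) > 0" using cone(4) z(2) ab_nz by (intro mult_pos_pos) auto
    ultimately have "cross2 (rvec a) d < 0" using sa(5) z(1) True by simp
    moreover have "cross2 (rvec b) d > 0" using sb(2) bc z(2) by simp
    ultimately show ?thesis using z(1) by simp
  next
    case False
    have neg: "cross2 (rvec a) (rvec c) < 0"
      by (rule first_facet_strict[OF geo(2,1) v c0 e t ab ac cb]) (rule geo(5)[OF False])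
    have "cross2 (rvec b) d > 0"
    proof (cases "cross2 (rvec c) (rvec b) = 0")
      case True
      have "rvec c = \<gamma> *\<^sub>R rvec b" using cone(1,2) True by simp
      then have "rvec b \<bullet> rvec c = \<gamma> * (rvec b \<bullet> rvec b)" by simp
      moreover have "\<gamma> * (rvec b \<bullet> rvec b) > 0" using cone(5) neg ab_nz by (intro mult_pos_pos) auto
      ultimately show ?thesis using sb(4) True bc False by simp
    next
      case False
      then show ?thesis using sb(2) bc cb by simp
    qed
    then show ?thesis using sa(1) neg False by simp
  qed
  have "corner d Q v a za b zb" unfolding corner_def
    using e t ab signs optimal_vertexD(1)[OF v] cross2_swap[of d "rvec b"] by simp
  then show thesis using that H signs by blast
qed

text \<open>The part shared by strengthening and tilting. \<open>B\<close> is the budget before the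
  cut: the counter grows by one while the budget falls by at least one.\<close>

lemma invariant_cut:
  assumes inv: "invariant Q k" and Q2: "aff_dim Q = 2" and v: "v \<in> Q" "rvec t \<bullet> v > s"
    and t: "primitive t" "s \<in> \<rat>" "\<bar>t $ 1\<bar> \<le> M" "\<bar>t $ 2\<bar> \<le> M" and valid: "P \<inter> int_pts \<subseteq> halfplane t s"
    and ray: "ray \<Longrightarrow> cross2 (rvec t) (rvec c) \<ge> 0"
    and B: "0 \<le> B" "real k + B + 2 \<le> N"
    and drop: "\<And>v' a' za' b' zb' p' f'. interior (Q \<inter> halfplane t s) \<noteq> {} \<Longrightarrow>
      corner d (Q \<inter> halfplane t s) v' a' za' b' zb' \<Longrightarrow> v' \<notin> int_pts \<Longrightarrow> corner_data a' za' b' zb' p' f' \<Longrightarrow>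
      log 2 (of_int (width a' b')) \<le> 3 * L \<Longrightarrow> budget d L (Q \<inter> halfplane t s) a' za' b' zb' p' f' + 1 \<le> B"
  shows "invariant (Q \<inter> halfplane t s) (k + 1)"
proof -
  let ?Q' = "Q \<inter> halfplane t s"
  note geo = invariant_geometry[OF inv]
  obtain S where S: "finite S" "Q = poly_set S" using inv by (auto simp: invariant_def)
  have poly: "\<exists>S'. finite S' \<and> ?Q' = poly_set S'"
    using S poly_set_Int_halfplane[of S t s] by (intro exI[of _ "insert (t, s) S"]) simp
  have cQ': "convex ?Q'" unfolding halfplane_def by (intro convex_Int geo(1) convex_halfspace_le)
  have QP: "Q \<subseteq> P" "P \<inter> int_pts \<subseteq> Q" using inv by (auto simp: invariant_def)
  have fin: "finite (edges Q)" using inv Q2 by (simp add: invariant_def)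
  have ray': "x - u *\<^sub>R turn (rvec c) \<in> ?Q'" if "ray" "x \<in> ?Q'" "u \<ge> 0" for x u
  proof -
    have "x - u *\<^sub>R turn (rvec c) \<in> Q" using geo(6) that by simp
    moreover have "u * cross2 (rvec t) (rvec c) \<ge> 0" using ray that by simp
    then have "rvec t \<bullet> (x - u *\<^sub>R turn (rvec c)) \<le> s"
      using that(2) by (simp add: inner_diff_right turn_cross2 halfplane_def)
    ultimately show ?thesis by (simp add: halfplane_def)
  qed
  have edges': "edges ?Q' \<subseteq> insert (t, s) (edges Q)" if "interior ?Q' \<noteq> {}"
    by (rule edges_Int_halfplane[OF geo(1) t(1) that])
  have bounds: "z \<in> \<rat> \<and> \<bar>a $ 1\<bar> \<le> M \<and> \<bar>a $ 2\<bar> \<le> M" if "interior ?Q' \<noteq> {}" "(a, z) \<in> edges ?Q'" for a z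
    using edges'[OF that(1)] that(2) edge_bounds[OF inv Q2, of a z] t by blast
  have dim: "interior ?Q' \<noteq> {}" if "aff_dim ?Q' = 2" using convex_aff_dim_interior[OF cQ'] that by blast
  have budgets: "real (k + 1) + budget d L ?Q' a' za' b' zb' p' f' + 2 \<le> N"
    if Q'2: "aff_dim ?Q' = 2" and C': "corner d ?Q' v' a' za' b' zb'" and v': "v' \<notin> int_pts"
      and p': "corner_data a' za' b' zb' p' f'" for v' a' za' b' zb' p' f'
  proof -
    have e': "(a', za') \<in> edges ?Q'" "(b', zb') \<in> edges ?Q'" "cross2 (rvec a') (rvec b') < 0" using C' by (auto simp: corner_def)
    have "width a' b' > 0" using e'(3) by (simp add: width_cross2)
    then have "log 2 (of_int (width a' b')) \<le> 3 * L" unfolding L_def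
      using bounds[OF dim[OF Q'2] e'(1)] bounds[OF dim[OF Q'2] e'(2)] by (intro log_width_bound) auto
    then show ?thesis using drop[OF dim[OF Q'2] C' v' p'] B by simp
  qed
  show ?thesis unfolding invariant_def
  proof (intro conjI impI allI)
    show "\<exists>S. finite S \<and> ?Q' = poly_set S" by (rule poly)
    show "?Q' \<subseteq> P" "P \<inter> int_pts \<subseteq> ?Q'" using QP valid by blast+
    show "\<forall>x\<in>?Q'. \<forall>u\<ge>0. x - u *\<^sub>R turn (rvec c) \<in> ?Q'" if ray using ray'[OF that] by blast
    show "finite (edges ?Q')" if "aff_dim ?Q' = 2"
      by (rule finite_subset[OF edges'[OF dim[OF that]]]) (simp add: fin)
    show "\<forall>(a, z)\<in>edges ?Q'. z \<in> \<rat> \<and> \<bar>a $ 1\<bar> \<le> M \<and> \<bar>a $ 2\<bar> \<le> M" if "aff_dim ?Q' = 2"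
      using bounds[OF dim[OF that]] by blast
    show "real (k + 1) \<le> N" "real (k + 1) + 1 \<le> N" using B by simp_all
  qed (rule budgets)
qed

lemma corner_budget_nonneg:
  assumes inv: "invariant Q k" and Q2: "aff_dim Q = 2" and C: "corner d Q v a za b zb" and v: "v \<notin> int_pts"
    and p: "corner_data a za b zb p f"
  shows "log 2 (of_int (width a b)) \<le> 3 * L" "0 \<le> budget d L Q a za b zb p f"
    "real k + budget d L Q a za b zb p f + 2 \<le> N"
proof -
  have e: "(a, za) \<in> edges Q" "(b, zb) \<in> edges Q" "cross2 (rvec a) (rvec b) < 0" using C by (auto simp: corner_def)
  have "width a b > 0" using e(3) by (simp add: width_cross2)
  then show l: "log 2 (of_int (width a b)) \<le> 3 * L" unfolding L_def
    using edge_bounds[OF inv Q2 e(1)] edge_bounds[OF inv Q2 e(2)] by (intro log_width_bound) auto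
  show "0 \<le> budget d L Q a za b zb p f" unfolding budget_def
    using phase_budget_bounds(1)[OF C v p L_ge_1 l] by simp
  show "real k + budget d L Q a za b zb p f + 2 \<le> N"
    using inv Q2 C v p unfolding invariant_def by blast
qed

lemma invariant_strengthen:
  assumes inv: "invariant Q k" and Q2: "aff_dim Q = 2" and v: "optimal_vertex c Q v" "v \<notin> int_pts"
    and cf: "corner_facets c Q v Hm H1" and ns: "\<not> chvatal_strengthened Hm" and T: "is_chvatal_strengthening Hm T"
  shows "invariant (Q \<inter> T) (k + 1)"
proof -
  obtain a za b zb where H: "Hm = halfplane a za" "H1 = halfplane b zb" and C: "corner d Q v a za b zb"
    and par: "ray \<Longrightarrow> cross2 (rvec a) (rvec c) = 0"
    by (rule corner_facets_corner[OF inv Q2 v(1) cf]) (rule that)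
  have e: "(a, za) \<in> edges Q" and vQ: "v \<in> Q" and va: "rvec a \<bullet> v = za" using C by (auto simp: corner_def)
  have pa: "primitive a" using edgesD(1)[OF e] .
  have za: "za \<notin> \<int>" using ns pa unfolding H(1) chvatal_strengthened_def by blast
  obtain a' z where a': "primitive a'" "Hm = halfplane a' z" "T = halfplane a' (of_int \<lfloor>z\<rfloor>)"
    using T unfolding is_chvatal_strengthening_def by blast
  have "a' = a" "z = za" using halfplane_eq_iff[OF a'(1) pa, of z za] a'(2) H(1) by auto
  then have T': "T = halfplane a (of_int \<lfloor>za\<rfloor>)" using a'(3) by simp
  have "za \<noteq> of_int \<lfloor>za\<rfloor>" using za by (metis Ints_of_int)
  then have fl: "of_int \<lfloor>za\<rfloor> < za" using of_int_floor_le[of za] by linarith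
  \<comment> \<open>The right-hand side is fractional, so any lattice data are admissible.\<close>
  have cd: "corner_data a za b zb 0 0" using za by (simp add: corner_data_def)
  note bn = corner_budget_nonneg[OF inv Q2 C v(2) cd]
  note geo = invariant_geometry[OF inv]
  have fin: "finite (edges Q)" using inv Q2 by (simp add: invariant_def)
  show ?thesis unfolding T'
  proof (rule invariant_cut[OF inv Q2 vQ _ pa _ edge_bounds(2,3)[OF inv Q2 e] _ _ bn(2,3)])
    show "of_int \<lfloor>za\<rfloor> < rvec a \<bullet> v" using fl va by simp
    show "P \<inter> int_pts \<subseteq> halfplane a (of_int \<lfloor>za\<rfloor>)"
    proof
      fix x assume x: "x \<in> P \<inter> int_pts"
      then have "x \<in> Q" using inv by (auto simp: invariant_def)
      then have "rvec a \<bullet> x \<le> za" by (rule edgesD(3)[OF e])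
      moreover obtain q where q: "x = rvec q" using x by (auto simp: int_pts_eq)
      ultimately have "idot a q \<le> \<lfloor>za\<rfloor>" by (simp add: inner_rvec le_floor_iff)
      then show "x \<in> halfplane a (of_int \<lfloor>za\<rfloor>)" unfolding q by simp
    qed
    show "cross2 (rvec a) (rvec c) \<ge> 0" if ray using par[OF that] by simp
    show "budget d L (Q \<inter> halfplane a (of_int \<lfloor>za\<rfloor>)) a' za' b' zb' p' f' + 1 \<le> budget d L Q a za b zb 0 0"
      if "interior (Q \<inter> halfplane a (of_int \<lfloor>za\<rfloor>)) \<noteq> {}" "corner d (Q \<inter> halfplane a (of_int \<lfloor>za\<rfloor>)) v' a' za' b' zb'"
        "v' \<notin> int_pts" "corner_data a' za' b' zb' p' f'" "log 2 (of_int (width a' b')) \<le> 3 * L" for v' a' za' b' zb' p' f'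
      by (rule strengthening_budget_drop[OF geo(1) fin C za refl that(1-3) L_ge_1 that(5,4)])
  qed simp
qed

lemma invariant_tilt:
  assumes inv: "invariant Q k" and Q2: "aff_dim Q = 2" and v: "optimal_vertex c Q v" "v \<notin> int_pts"
    and cf: "corner_facets c Q v Hm H1" and st: "chvatal_strengthened Hm" and T: "is_tilt Hm H1 T"
  shows "invariant (Q \<inter> T) (k + 1)"
proof -
  obtain a za b zb where H: "Hm = halfplane a za" "H1 = halfplane b zb" and C: "corner d Q v a za b zb"
    and par: "ray \<Longrightarrow> cross2 (rvec a) (rvec c) = 0"
    by (rule corner_facets_corner[OF inv Q2 v(1) cf]) (rule that)
  have e: "(a, za) \<in> edges Q" "(b, zb) \<in> edges Q" and vQ: "v \<in> Q" and va: "rvec a \<bullet> v = za" and vb: "rvec b \<bullet> v = zb"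
    and ab: "cross2 (rvec a) (rvec b) < 0" and ad: "cross2 (rvec a) d < 0" and db: "cross2 d (rvec b) < 0"
    using C by (auto simp: corner_def)
  have pa: "primitive a" using edgesD(1)[OF e(1)] .
  obtain a' z where a': "primitive a'" "z \<in> \<int>" "Hm = halfplane a' z" using st unfolding chvatal_strengthened_def by blast
  have "z = za" using halfplane_eq_iff[OF a'(1) pa, of z za] a'(3) H(1) by auto
  then obtain z1 where z1: "za = of_int z1" using a'(2) by (auto elim: Ints_cases)
  have D: "width a b > 0" using ab by (simp add: width_cross2)
  obtain p f where p: "idot a p = z1" "corner_lattice a b zb p f" "T = tilt_plane a b zb p f"
    using is_tilt_imp_tilt_plane[OF T[unfolded H z1] pa D] by blast
  define t where "t = tilt_normal a b zb p f"
  define s where "s = real_of_int (idot t p)"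
  have T': "T = halfplane t s" unfolding p(3) tilt_plane_def t_def s_def ..
  have pz: "of_int (idot a p) = za" using p(1) z1 by simp
  have cd: "corner_data a za b zb p f" using p(2) pz by (simp add: corner_data_def)
  note bn = corner_budget_nonneg[OF inv Q2 C v(2) cd]
  note geo = invariant_geometry[OF inv]
  have fin: "finite (edges Q)" using inv Q2 by (simp add: invariant_def)
  have sl: "slack b zb p > 0" by (rule corner_slack_pos[OF C v(2) pz p(2)])
  have f: "idot a f = 1" using p(2) by (simp add: corner_lattice_def)
  have pt: "primitive t" unfolding t_def by (rule tilt_normal_primitive[OF f])
  have tM: "\<bar>t $ 1\<bar> \<le> M" "\<bar>t $ 2\<bar> \<le> M" unfolding t_def
    using edge_bounds[OF inv Q2 e(1)] edge_bounds[OF inv Q2 e(2)] by (auto intro!: tilt_normal_bound[OF p(2)])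
  have at: "cross2 (rvec a) (rvec t) < 0" unfolding t_def by (rule tilt_normal_cone(1)[OF p(2)])
  have \<kappa>: "(if ray then - 1 else 1) = (1::real) \<or> (if ray then - 1 else 1) = (-1::real)" by simp
  have td: "cross2 (rvec t) d \<noteq> 0" unfolding d_def
    by (rule generic_objective_sign(3)[OF M0 tM \<kappa> c0 primitive_nonzero[OF pt]])
  show ?thesis unfolding T'
  proof (rule invariant_cut[OF inv Q2 vQ _ pt _ tM _ _ bn(2,3)])
    show "s < rvec t \<bullet> v" unfolding s_def t_def
      by (rule tilt_normal_cone(3)[OF p(2)]) (use va vb pz sl in auto)
    show "P \<inter> int_pts \<subseteq> halfplane t s"
    proof
      fix x assume x: "x \<in> P \<inter> int_pts"
      then have xQ: "x \<in> Q" using inv by (auto simp: invariant_def)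
      have "x \<in> T"
        by (rule is_tilt_valid[OF T]) (use x edgesD(3)[OF e(1) xQ] edgesD(3)[OF e(2) xQ] in \<open>auto simp: H halfplane_def\<close>)
      then show "x \<in> halfplane t s" by (simp add: T')
    qed
    \<comment> \<open>The tilted facet is parallel to the optimal face here. The cut turns its
      normal clockwise beyond \<open>c\<close>, so the backward ray stays feasible.\<close>
    show "cross2 (rvec t) (rvec c) \<ge> 0" if ray
    proof -
      have "cross2 (rvec a) (rvec c) = 0" by (rule par[OF that])
      then obtain \<alpha> where \<alpha>: "rvec c = \<alpha> *\<^sub>R rvec a" "\<alpha> = cross2 (rvec c) (rvec b) / cross2 (rvec a) (rvec b)"
        using cramer_2[of "rvec a" "rvec b" "rvec c"] ab by auto
      have "\<alpha> \<ge> 0"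
      proof -
        have "cross2 (rvec c) (rvec b) \<le> 0"
          using cf corner_facets_iff[OF geo(1) Q2 rational_edges[OF inv Q2]] H halfplane_eq_iff edgesD(1) e by metis
        then show ?thesis unfolding \<alpha>(2) using ab by (simp add: divide_nonpos_neg)
      qed
      moreover have "cross2 (rvec t) (rvec c) = \<alpha> * - cross2 (rvec a) (rvec t)"
        unfolding \<alpha>(1) cross2_scale using cross2_swap[of "rvec t" "rvec a"] by simp
      ultimately show ?thesis using at by (simp add: mult_nonneg_nonpos)
    qed
    show "budget d L (Q \<inter> halfplane t s) a' za' b' zb' p' f' + 1 \<le> budget d L Q a za b zb p f"
      if "interior (Q \<inter> halfplane t s) \<noteq> {}" "corner d (Q \<inter> halfplane t s) v' a' za' b' zb'"
        "v' \<notin> int_pts" "corner_data a' za' b' zb' p' f'" "log 2 (of_int (width a' b')) \<le> 3 * L" for v' a' za' b' zb' p' f'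
      using that T' p(3) td
      by (intro tilt_budget_drop[OF geo(1) fin C v(2) pz p(2) _ _ _ _ _ _ L_ge_1 bn(1)]) (auto simp: t_def)
  qed (simp add: s_def)
qed

section \<open>Correctness, progress and termination of runs\<close>

lemma step_cases:
  assumes inv: "invariant Q k" and step: "clockwise_step c (Running Q k) s"
  shows "case s of Running Q' k' \<Rightarrow> invariant Q' k' | Halted r k' \<Rightarrow> real k' \<le> N \<and> correct_outcome c P r"
proof -
  have QP: "Q \<subseteq> P" "P \<inter> int_pts \<subseteq> Q" and kN: "real k \<le> N" "aff_dim Q = 1 \<Longrightarrow> real k + 1 \<le> N"
    using inv by (auto simp: invariant_def)
  show ?thesis using step
  proof (cases rule: clockwise_step.cases)
    case empty
    then show ?thesis using QP kN by (auto simp: correct_outcome_def)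
  next
    case (point_integral q)
    then show ?thesis using QP kN by (auto simp: correct_outcome_def)
  next
    case (point_fractional q)
    then show ?thesis using QP kN by (auto simp: correct_outcome_def)
  next
    case (line_lattice_free a a0)
    have "x \<in> Q \<inter> halfplane a (of_int a0)" if x: "x \<in> P \<inter> int_pts" for x
    proof -
      obtain q where q: "x = rvec q" using x by (auto simp: int_pts_eq)
      have xQ: "x \<in> Q" using x QP by blast
      then have "\<not> of_int (a0 + 1) \<le> rvec a \<bullet> x" using line_lattice_free(4) by (auto simp: chvatal_cut_def)
      then have "\<not> a0 + 1 \<le> idot a q" unfolding q inner_rvec by linarith
      then show ?thesis using xQ q by simp
    qed
    then have "P \<inter> int_pts = {}" using line_lattice_free(6) by blast
    then show ?thesis using kN(2) line_lattice_free(1,2) by (simp add: correct_outcome_def)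
  next
    case (line_lattice u a a0 T r)
    have sub: "P \<inter> int_pts \<subseteq> Q \<inter> T"
    proof
      fix x assume x: "x \<in> P \<inter> int_pts"
      obtain q where q: "x = rvec q" using x by (auto simp: int_pts_eq)
      have xQ: "x \<in> Q" using x QP by blast
      then have "\<not> of_int (a0 + 1) \<le> rvec a \<bullet> x" using line_lattice(6) by (auto simp: chvatal_cut_def)
      then have "\<not> a0 + 1 \<le> idot a q" unfolding q inner_rvec by linarith
      then show "x \<in> Q \<inter> T" using xQ q line_lattice(8) by simp
    qed
    have "correct_outcome c P r"
      using line_lattice(9)
    proof
      assume "r = Infeasible \<and> Q \<inter> T = {}"
      then show ?thesis using sub by (auto simp: correct_outcome_def)
    next
      assume "\<exists>v. r = Optimal v \<and> v \<in> Q \<inter> T \<inter> int_pts \<and> (\<forall>y\<in>Q \<inter> T. rvec c \<bullet> y \<le> rvec c \<bullet> v)"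
      then obtain v where "r = Optimal v" "v \<in> Q \<inter> T \<inter> int_pts" "\<forall>y\<in>Q \<inter> T. rvec c \<bullet> y \<le> rvec c \<bullet> v" by blast
      then show ?thesis using sub QP by (auto simp: correct_outcome_def)
    qed
    then show ?thesis using kN(2) line_lattice(1,2) by simp
  next
    case (integral_vertex v)
    have "v \<in> P \<inter> int_pts" using optimal_vertexD(1)[OF integral_vertex(3)] integral_vertex(4) QP by blast
    moreover have "rvec c \<bullet> y \<le> rvec c \<bullet> v" if "y \<in> P \<inter> int_pts" for y
      using optimal_vertexD(3)[OF integral_vertex(3), of y] that QP by blast
    ultimately show ?thesis using integral_vertex(1) kN by (simp add: correct_outcome_def)
  next
    case (strengthen v Hm H1 T)
    then show ?thesis using invariant_strengthen[OF inv] by simp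
  next
    case (tilt v Hm H1 T)
    then show ?thesis using invariant_tilt[OF inv] by simp
  qed
qed

lemma progress:
  assumes inv: "invariant Q k"
  shows "\<exists>s. clockwise_step c (Running Q k) s"
proof -
  note geo = invariant_geometry[OF inv]
  obtain S where S: "finite S" "Q = poly_set S" using inv by (auto simp: invariant_def)
  have "aff_dim Q \<le> 2" using aff_dim_le_DIM[of Q] by simp
  moreover have "aff_dim Q \<ge> -1" by (rule aff_dim_geq)
  ultimately consider "aff_dim Q = -1" | "aff_dim Q = 0" | "aff_dim Q = 1" | "aff_dim Q = 2" by linarith
  then show ?thesis
  proof cases
    case 1
    then have "Q = {}" by (simp add: aff_dim_empty)
    then show ?thesis using clockwise_step.empty by blast
  next
    case 2
    then obtain q where "Q = {q}" using aff_dim_eq_0 by blast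
    then show ?thesis using clockwise_step.point_integral clockwise_step.point_fractional by blast
  next
    case 3
    then show ?thesis using one_dim_progress[OF S(1)] geo(3,4) unfolding S(2) by blast
  next
    case 4
    obtain v where v: "optimal_vertex c Q v"
      using optimal_vertex_exists[OF S(1), folded S(2), OF geo(3) geo(7)[OF 4], of c \<beta>] geo(4) by blast
    show ?thesis
    proof (cases "v \<in> int_pts")
      case True
      then show ?thesis using clockwise_step.integral_vertex[OF 4 v] by blast
    next
      case vi: False
      obtain a b where e: "(a, rvec a \<bullet> v) \<in> edges Q" "(b, rvec b \<bullet> v) \<in> edges Q"
        and ab: "cross2 (rvec a) (rvec b) < 0" "cross2 (rvec a) (rvec c) \<le> 0" "cross2 (rvec c) (rvec b) \<le> 0"
        using corner_edges_exist[OF S(1), folded S(2), OF geo(7)[OF 4] optimal_vertexD(2,3)[OF v]] by blast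
      have cf: "corner_facets c Q v (halfplane a (rvec a \<bullet> v)) (halfplane b (rvec b \<bullet> v))"
        using corner_facets_iff[OF geo(1) 4 rational_edges[OF inv 4]] e ab by blast
      have pa: "primitive a" using edgesD(1)[OF e(1)] .
      show ?thesis
      proof (cases "chvatal_strengthened (halfplane a (rvec a \<bullet> v))")
        case True
        then obtain a' z where a': "primitive a'" "z \<in> \<int>" "halfplane a (rvec a \<bullet> v) = halfplane a' z"
          unfolding chvatal_strengthened_def by blast
        then have "rvec a \<bullet> v = z" using halfplane_eq_iff[OF pa a'(1)] by blast
        then obtain z1 where z1: "rvec a \<bullet> v = of_int z1" using a'(2) by (auto elim: Ints_cases)
        have "width a b > 0" using ab(1) by (simp add: width_cross2)
        then obtain p f where "idot a p = z1" "corner_lattice a b (rvec b \<bullet> v) p f"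
          using corner_lattice_exists[OF pa] by blast
        then have "is_tilt (halfplane a (rvec a \<bullet> v)) (halfplane b (rvec b \<bullet> v)) (tilt_plane a b (rvec b \<bullet> v) p f)"
          unfolding z1 by (intro is_tilt_tilt_plane[OF pa])
        then show ?thesis using clockwise_step.tilt[OF 4 v vi cf True] by blast
      next
        case False
        have "is_chvatal_strengthening (halfplane a (rvec a \<bullet> v)) (halfplane a (of_int \<lfloor>rvec a \<bullet> v\<rfloor>))"
          unfolding is_chvatal_strengthening_def using pa by blast
        then show ?thesis using clockwise_step.strengthen[OF 4 v vi cf False] by blast
      qed
    qed
  qed
qed

lemma solves:
  assumes init: "invariant P 0"
  shows "solves_ip_within c P N"
proof -
  have reach: "case s of Running Q k \<Rightarrow> invariant Q k | Halted r k \<Rightarrow> real k \<le> N \<and> correct_outcome c P r"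
    if "(clockwise_step c)\<^sup>*\<^sup>* (Running P 0) s" for s
    using that
  proof (induction rule: rtranclp_induct)
    case base
    then show ?case using init by simp
  next
    case (step s s')
    show ?case
    proof (cases s)
      case (Running Q k)
      then show ?thesis using step step_cases by simp
    next
      case (Halted r k)
      then show ?thesis using step(2) by (auto elim: clockwise_step.cases)
    qed
  qed
  have "real (num_cuts s) \<le> N \<and>
        (case s of Running Q k \<Rightarrow> \<exists>s'. clockwise_step c s s' | Halted r k \<Rightarrow> correct_outcome c P r)"
    if "(clockwise_step c)\<^sup>*\<^sup>* (Running P 0) s" for s
  proof (cases s)
    case (Running Q k)
    then have "invariant Q k" using reach[OF that] by simp
    then show ?thesis using Running progress by (auto simp: invariant_def)
  next
    case (Halted r k)
    then show ?thesis using reach[OF that] by simp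
  qed
  then show ?thesis unfolding solves_ip_within_def by blast
qed

end

section \<open>The initial invariant\<close>

lemma polyhedron_of_eq_poly_set: "polyhedron_of n A b = poly_set ((\<lambda>i. (A i, of_int (b i))) ` {..<n})"
  by (auto simp: polyhedron_of_def poly_set_def)

lemma max_abs_entry_ge:
  assumes "i < n" shows "\<bar>A i $ j\<bar> \<le> max_abs_entry n A"
proof -
  have "{\<bar>A i $ j\<bar> | i j. i < n} = (\<lambda>(i, j). \<bar>A i $ j\<bar>) ` ({..<n} \<times> UNIV)" by auto
  then have "finite {\<bar>A i $ j\<bar> | i j. i < n}" by simp
  moreover have "\<bar>A i $ j\<bar> \<in> {\<bar>A i $ j\<bar> | i j. i < n}" using assms by blast
  ultimately show ?thesis unfolding max_abs_entry_def by (rule Max_ge)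
qed

theorem theorem17:
  shows "\<exists>K::real. \<forall>(n::nat) (A :: nat \<Rightarrow> int^2) (b :: nat \<Rightarrow> int) (c :: int^2) (P :: (real^2) set) (m::nat).
    P = polyhedron_of n A b \<longrightarrow> pointed P \<longrightarrow> m = card {F. F facet_of P} \<longrightarrow> c \<noteq> 0 \<longrightarrow>
    (\<exists>x\<in>P. \<forall>y\<in>P. rvec c \<bullet> y \<le> rvec c \<bullet> x) \<longrightarrow>
    solves_ip_within c P (K * real m * (log 2 (max 2 (real_of_int (max_abs_entry n A))))\<^sup>2)"
proof (intro exI allI impI)
  fix n :: nat and A :: "nat \<Rightarrow> int^2" and b :: "nat \<Rightarrow> int" and c :: "int^2" and P :: "(real^2) set" and m :: nat
  assume P: "P = polyhedron_of n A b" and pt: "pointed P" and m: "m = card {F. F facet_of P}" and c0: "c \<noteq> 0"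
    and opt: "\<exists>x\<in>P. \<forall>y\<in>P. rvec c \<bullet> y \<le> rvec c \<bullet> x"
  define M where "M = max_abs_entry n A"
  define S where "S = (\<lambda>i. (A i, real_of_int (b i))) ` {..<n}"
  \<comment> \<open>At a corner, \<open>m \<ge> 1\<close>. Weight at most \<open>2 * m\<close> with
    factor \<open>64 * L\<^sup>2 + 2\<close>, the first phase reserve
    \<open>64 * L\<^sup>2 + 1\<close> and the extra 2 add up to at most
    \<open>199 * m * L\<^sup>2\<close>, as \<open>L \<ge> 1\<close>.\<close>
  define N where "N = 200 * real m * (log 2 (max 2 (real_of_int M)))\<^sup>2"
  have fin: "finite S" by (simp add: S_def)
  have PS: "P = poly_set S" unfolding P S_def by (rule polyhedron_of_eq_poly_set)
  obtain x0 where x0: "x0 \<in> P" "\<And>y. y \<in> P \<Longrightarrow> rvec c \<bullet> y \<le> rvec c \<bullet> x0" using opt by blast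
  have "n > 0"
  proof (rule ccontr)
    assume "\<not> n > 0"
    then have "P = UNIV" unfolding P by (simp add: polyhedron_of_def)
    moreover have "rvec c \<noteq> 0" using c0 by simp
    ultimately show False using pt unfolding pointed_def by blast
  qed
  then have "\<bar>A 0 $ 1\<bar> \<le> M" unfolding M_def by (rule max_abs_entry_ge)
  then have M0: "M \<ge> 0" by linarith
  \<comment> \<open>No row increases along \<open>- turn (rvec c)\<close>, so this is a recession
    direction of the given system; it decides the sense of rotation.\<close>
  define ray where "ray \<longleftrightarrow> (\<forall>(a, z)\<in>S. rvec a \<bullet> turn (rvec c) \<ge> 0)"
  have not_ray: "\<exists>t\<ge>0. x - t *\<^sub>R turn (rvec c) \<notin> P" if nr: "\<not> ray" for x
  proof -
    obtain a z where az: "(a, z) \<in> S" "rvec a \<bullet> turn (rvec c) < 0" using nr unfolding ray_def by (auto simp: not_le)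
    define q where "q = - (rvec a \<bullet> turn (rvec c))"
    define t where "t = (\<bar>z - rvec a \<bullet> x\<bar> + 1) / q"
    have q: "q > 0" using az by (simp add: q_def)
    have "t \<ge> 0" using q by (simp add: t_def)
    moreover have "t * q = \<bar>z - rvec a \<bullet> x\<bar> + 1" using q by (simp add: t_def)
    then have "rvec a \<bullet> (x - t *\<^sub>R turn (rvec c)) > z" by (simp add: q_def inner_diff_right)
    then have "x - t *\<^sub>R turn (rvec c) \<notin> P" using az(1) unfolding PS poly_set_def by force
    ultimately show ?thesis by blast
  qed
  have rayP: "x - t *\<^sub>R turn (rvec c) \<in> P" if "ray" "x \<in> P" "t \<ge> 0" for x t
    unfolding PS poly_set_def
  proof (clarify)
    fix a z assume az: "(a, z) \<in> S"
    then have "rvec a \<bullet> x \<le> z" "rvec a \<bullet> turn (rvec c) \<ge> 0" using that unfolding PS poly_set_def ray_def by auto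
    moreover from this have "t * (rvec a \<bullet> turn (rvec c)) \<ge> 0" using that by simp
    ultimately show "rvec a \<bullet> (x - t *\<^sub>R turn (rvec c)) \<le> z" by (simp add: inner_diff_right)
  qed
  interpret clockwise_run c ray M N "rvec c \<bullet> x0" P
    by unfold_locales (use c0 M0 pt x0 not_ray in auto)
  have poly: "polyhedron P" unfolding PS by (rule polyhedron_poly_set[OF fin])
  have finF: "finite {F. F facet_of P}" by (rule finite_polyhedron_facets[OF poly])
  have NL: "N = 200 * real m * L\<^sup>2" by (simp add: N_def L_def)
  have L2: "L\<^sup>2 \<ge> 1" using L_ge_1 by (simp add: one_le_power)
  have N1: "N \<ge> 200 * L\<^sup>2" if "m \<ge> 1"
  proof -
    have "200 * L\<^sup>2 * 1 \<le> 200 * L\<^sup>2 * real m" using that by (intro mult_left_mono) auto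
    then show ?thesis by (simp add: NL mult_ac)
  qed
  have edges_P: "z \<in> \<rat> \<and> \<bar>a $ 1\<bar> \<le> M \<and> \<bar>a $ 2\<bar> \<le> M" if az: "(a, z) \<in> edges P" for a z
  proof -
    obtain B w g where B: "(B, w) \<in> S" "g \<noteq> 0" "B = g *s a" "w = of_int g * z"
      using edge_row[OF fin az[unfolded PS]] by blast
    obtain i where i: "i < n" "B = A i" "w = of_int (b i)" using B(1) by (auto simp: S_def)
    have "\<bar>a $ j\<bar> \<le> M" for j
    proof -
      have "1 * \<bar>a $ j\<bar> \<le> \<bar>g\<bar> * \<bar>a $ j\<bar>" using B(2) by (intro mult_right_mono) auto
      also have "\<dots> = \<bar>A i $ j\<bar>" using B(3) i(2) by (metis abs_mult vector_smult_component)
      also have "\<dots> \<le> M" unfolding M_def by (rule max_abs_entry_ge[OF i(1)])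
      finally show ?thesis by simp
    qed
    moreover have "z = of_int (b i) / of_int g" using B(2,4) i(3) by (simp add: field_simps)
    then have "z \<in> \<rat>" by simp
    ultimately show ?thesis by blast
  qed
  have int_P: "interior P \<noteq> {}" if "aff_dim P = 2"
    using convex_aff_dim_interior[OF polyhedron_imp_convex[OF poly]] that by blast
  have "invariant P 0" unfolding invariant_def
  proof (intro conjI impI allI)
    show "\<exists>S. finite S \<and> P = poly_set S" using fin PS by blast
    show "P \<inter> int_pts \<subseteq> P" by blast
    show "\<forall>x\<in>P. \<forall>t\<ge>0. x - t *\<^sub>R turn (rvec c) \<in> P" if ray using rayP[OF that] by blast
    show "finite (edges P)" if "aff_dim P = 2"
      using edges_finite_card(1)[OF fin] that int_P[OF that] unfolding PS by blast
    show "\<forall>(a, z)\<in>edges P. z \<in> \<rat> \<and> \<bar>a $ 1\<bar> \<le> M \<and> \<bar>a $ 2\<bar> \<le> M" using edges_P by blast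
    show "real 0 \<le> N" by (simp add: NL)
    show "real 0 + 1 \<le> N" if "aff_dim P = 1"
    proof -
      have "{F. F facet_of P} \<noteq> {}" using one_dim_facet[OF fin] that pt unfolding PS by blast
      then have "m \<ge> 1" unfolding m using finF by (metis card_0_eq less_one not_less)
      then show ?thesis using N1 L2 by simp
    qed
    fix v a za b' zb p f
    assume P2: "aff_dim P = 2" and C: "corner d P v a za b' zb" and v: "v \<notin> int_pts" and cd: "corner_data a za b' zb p f"
    have finE: "finite (edges P)" and mE: "card (edges P) \<le> m"
      unfolding m PS by (rule edges_finite_card[OF fin P2[unfolded PS] int_P[OF P2, unfolded PS]])+
    have e: "(a, za) \<in> edges P" "(b', zb) \<in> edges P" "cross2 (rvec a) (rvec b') < 0" using C by (auto simp: corner_def)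
    have "edges P \<noteq> {}" using e(1) by blast
    then have m1: "m \<ge> 1" using mE finE by (metis card_0_eq le_zero_eq less_one not_less)
    \<comment> \<open>Left and right edges are disjoint, so together there are at most
      \<open>m\<close>; counting the left ones twice gives at most \<open>2 * m\<close>.\<close>
    have "card (left_edges d P) \<le> card (edges P)" "card (left_edges d P \<union> right_edges d P) \<le> card (edges P)"
      using finE by (auto intro!: card_mono simp: left_edges_def right_edges_def)
    moreover have "card (left_edges d P \<union> right_edges d P) = card (left_edges d P) + card (right_edges d P)"
      by (rule card_Un_disjoint) (use finite_left_right_edges[OF finE] in \<open>auto simp: left_edges_def right_edges_def\<close>)
    ultimately have "edge_weight d P a za \<le> 2 * m" using mE unfolding edge_weight_def by auto
    then have w: "(64 * L\<^sup>2 + 2) * real (edge_weight d P a za) \<le> (64 * L\<^sup>2 + 2) * (2 * real m)"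
      by (intro mult_left_mono) auto
    have "width a b' > 0" using e(3) by (simp add: width_cross2)
    then have l: "log 2 (of_int (width a b')) \<le> 3 * L" unfolding L_def
      using edges_P[OF e(1)] edges_P[OF e(2)] by (intro log_width_bound) auto
    have "budget d L P a za b' zb p f + 2 \<le> (64 * L\<^sup>2 + 2) * (2 * real m) + (64 * L\<^sup>2 + 3)"
      using w phase_budget_bounds(2)[OF C v cd L_ge_1 l] unfolding budget_def by linarith
    also have "\<dots> \<le> 132 * real m * L\<^sup>2 + 67 * real m * L\<^sup>2"
    proof -
      have "1 * 1 \<le> real m * L\<^sup>2" "real m * 1 \<le> real m * L\<^sup>2" "1 * L\<^sup>2 \<le> real m * L\<^sup>2"
        using m1 L2 by (intro mult_mono; simp)+
      then show ?thesis by (simp add: algebra_simps)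
    qed
    also have "\<dots> \<le> N" unfolding NL by (simp add: algebra_simps)
    finally show "real 0 + budget d L P a za b' zb p f + 2 \<le> N" by simp
  qed simp_all
  then show "solves_ip_within c P (200 * real m * (log 2 (max 2 (real_of_int (max_abs_entry n A))))\<^sup>2)"
    using solves unfolding N_def M_def by simp
qed

end
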